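(* Let $\Phi=\{f_i(x)=A_ix+t_i\}_{i\in\mathcal{A}}$ be a planar IFS of affinities with affinity dimension $s_0\in(1,2]$. Suppose that $\Phi$ is dominated and satisfies the open bounded neighbourhood condition. Denote by $X$ the attractor of $\Phi$. If $\mathcal{H}^{s_0}(X)>0$ then $\dim_{\rm A}X=s_0$, where $\dim_{\rm A}$ denotes the Assouad dimension.
   Context: Planar IFS of affinities: $\mathcal{A}$ is a finite index set and $f_i(x)=A_ix+t_i$ on $\mathbb{R}^2$ with $A_i$ a real $2\times2$ matrix, $\|A_i\|<1$, $\det A_i\neq0$, $t_i\in\mathbb{R}^2$. The attractor $X$ is the unique non-empty compact set with $X=\bigcup_{i\in\mathcal{A}}f_i(X)$. Words: $\Sigma_*=\bigcup_{n\ge0}\mathcal{A}^n$; $|\mathbf{i}|$ is the length of $\mathbf{i}$; $\mathbf{i}_-$ is the word $\mathbf{i}$ with its last symbol removed. For $\mathbf{i}=(i_1,\dots,i_n)$: $f_{\mathbf{i}}=f_{i_1}\circ\cdots\circ f_{i_n}$, $A_{\mathbf{i}}=A_{i_1}\cdots A_{i_n}$ (identity for the empty word). Affinity dimension: with $\alpha_1(A)\ge\alpha_2(A)$ the singular values, $\varphi^s(A)=\alpha_1(A)^s$ for $0\le s\le1$, $\varphi^s(A)=\alpha_1(A)\alpha_2(A)^{s-1}$ for $1< s\le2$, $\varphi^s(A)=|\det A|^{s/2}$ for $s>2$; $s_0=\inf\{s>0:\sum_{n\ge1}\sum_{\mathbf{i}\in\mathcal{A}^n}\varphi^s(A_{\mathbf{i}})<\infty\}$.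 Dominated: there are $C>0$, $0<\tau<1$ with $\alpha_2(A_{\mathbf{i}})\le C\tau^{|\mathbf{i}|}\alpha_1(A_{\mathbf{i}})$ for all $\mathbf{i}\in\Sigma_*$. Open bounded neighbourhood condition (OBNC): for $r>0$ let $\Delta_r=\{\mathbf{i}\in\Sigma_*:\alpha_2(A_{\mathbf{i}})|X|\le r<\alpha_2(A_{\mathbf{i}_-})|X|\}$, where $|X|$ is the diameter of $X$ (only words of length at least $1$ are considered). $\Phi$ satisfies the OBNC if there exist a non-empty open bounded set $U\subset\mathbb{R}^2$ with $f_i(U)\subseteq U$ for every $i\in\mathcal{A}$ and a constant $C>0$ such that $\#\{\mathbf{i}\in\Delta_r:f_{\mathbf{i}}(U)\cap B(x,r)\neq\emptyset\}\le C$ for every $r>0$ and $x\in\mathbb{R}^2$, where $B(x,r)$ is the ball of radius $r$ centred at $x$. $\mathcal{H}^s$ is $s$-dimensional Hausdorff measure. *)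

theory Defs
  imports "HOL-Analysis.Analysis"
begin

section \<open>Singular values and the singular value function\<close>

definition eigenvalues :: "real^'n^'n \<Rightarrow> real set" where
  "eigenvalues M = {c. \<exists>v. v \<noteq> 0 \<and> M *v v = c *\<^sub>R v}"

text \<open>A \<open>2 \<times> 2\<close> matrix has exactly two singular values counted with multiplicity, so they are the
  square roots of the largest and of the smallest eigenvalue of the Gram matrix.\<close>

definition \<alpha>\<^sub>1 :: "real^2^2 \<Rightarrow> real" where
  "\<alpha>\<^sub>1 M = sqrt (Max (eigenvalues (transpose M ** M)))"

definition \<alpha>\<^sub>2 :: "real^2^2 \<Rightarrow> real" where
  "\<alpha>\<^sub>2 M = sqrt (Min (eigenvalues (transpose M ** M)))"

definition sv_fun :: "real \<Rightarrow> real^2^2 \<Rightarrow> real" where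
  "sv_fun s M =
     (if s \<le> 1 then \<alpha>\<^sub>1 M powr s
      else if s \<le> 2 then \<alpha>\<^sub>1 M * \<alpha>\<^sub>2 M powr (s - 1)
      else \<bar>det M\<bar> powr (s / 2))"

section \<open>Planar affine iterated function systems\<close>

text \<open>A system is given by an index set \<open>I\<close>, linear parts \<open>A\<close> and translations \<open>t\<close>;
  finite words over \<open>I\<close> are the elements of \<^term>\<open>lists I\<close>.\<close>

definition aff :: "('i \<Rightarrow> real^2^2) \<Rightarrow> ('i \<Rightarrow> real^2) \<Rightarrow> 'i \<Rightarrow> real^2 \<Rightarrow> real^2" where
  "aff A t i x = A i *v x + t i"

definition affine_IFS :: "'i set \<Rightarrow> ('i \<Rightarrow> real^2^2) \<Rightarrow> ('i \<Rightarrow> real^2) \<Rightarrow> bool" where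
  "affine_IFS I A t \<longleftrightarrow> finite I \<and> (\<forall>i\<in>I. onorm ((*v) (A i)) < 1 \<and> det (A i) \<noteq> 0)"

definition is_attractor ::
  "'i set \<Rightarrow> ('i \<Rightarrow> real^2^2) \<Rightarrow> ('i \<Rightarrow> real^2) \<Rightarrow> (real^2) set \<Rightarrow> bool" where
  "is_attractor I A t X \<longleftrightarrow> X \<noteq> {} \<and> compact X \<and> X = (\<Union>i\<in>I. aff A t i ` X)"

definition aff_word :: "('i \<Rightarrow> real^2^2) \<Rightarrow> ('i \<Rightarrow> real^2) \<Rightarrow> 'i list \<Rightarrow> real^2 \<Rightarrow> real^2" where
  "aff_word A t w = foldr (\<lambda>i g. aff A t i \<circ> g) w id"

definition mat_word :: "('i \<Rightarrow> real^2^2) \<Rightarrow> 'i list \<Rightarrow> real^2^2" where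
  "mat_word A w = foldr (\<lambda>i M. A i ** M) w (mat 1)"

text \<open>For a finite system of contractions the infimum is over a non-empty set, so the
  real-valued \<^const>\<open>Inf\<close> is meaningful.\<close>

definition affinity_dim :: "'i set \<Rightarrow> ('i \<Rightarrow> real^2^2) \<Rightarrow> real" where
  "affinity_dim I A =
     Inf {s. s > 0 \<and>
       summable (\<lambda>n. \<Sum>w | w \<in> lists I \<and> length w = Suc n. sv_fun s (mat_word A w))}"

definition dominated :: "'i set \<Rightarrow> ('i \<Rightarrow> real^2^2) \<Rightarrow> bool" where
  "dominated I A \<longleftrightarrow>
     (\<exists>C \<tau>. C > 0 \<and> 0 < \<tau> \<and> \<tau> < 1 \<and>
       (\<forall>w\<in>lists I. \<alpha>\<^sub>2 (mat_word A w) \<le> C * \<tau> ^ length w * \<alpha>\<^sub>1 (mat_word A w)))"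

definition stopping_words :: "'i set \<Rightarrow> ('i \<Rightarrow> real^2^2) \<Rightarrow> (real^2) set \<Rightarrow> real \<Rightarrow> 'i list set" where
  "stopping_words I A X r =
     {w \<in> lists I. w \<noteq> [] \<and> \<alpha>\<^sub>2 (mat_word A w) * diameter X \<le> r \<and>
       r < \<alpha>\<^sub>2 (mat_word A (butlast w)) * diameter X}"

definition OBNC ::
  "'i set \<Rightarrow> ('i \<Rightarrow> real^2^2) \<Rightarrow> ('i \<Rightarrow> real^2) \<Rightarrow> (real^2) set \<Rightarrow> bool" where
  "OBNC I A t X \<longleftrightarrow>
     (\<exists>U (C::real). U \<noteq> {} \<and> open U \<and> bounded U \<and> (\<forall>i\<in>I. aff A t i ` U \<subseteq> U) \<and> C > 0 \<and>
       (\<forall>r>0. \<forall>x.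
         finite {w \<in> stopping_words I A X r. aff_word A t w ` U \<inter> cball x r \<noteq> {}} \<and>
         real (card {w \<in> stopping_words I A X r. aff_word A t w ` U \<inter> cball x r \<noteq> {}}) \<le> C))"

section \<open>Hausdorff measure and Assouad dimension\<close>

text \<open>The conventions are \<open>|\<emptyset>|\<^sup>s = 0\<close>, and \<open>|U|\<^sup>0 = 1\<close> for \<open>U \<noteq> \<emptyset>\<close> (whereas \<open>0 powr 0 = 0\<close>).\<close>

definition diam_pow :: "real \<Rightarrow> 'a::metric_space set \<Rightarrow> ennreal" where
  "diam_pow s U =
     (if U = {} then 0 else if s = 0 then 1 else ennreal (diameter U powr s))"

text \<open>Boundedness is required explicitly because \<^const>\<open>diameter\<close> is unspecified on
  unbounded sets.  Finite covers are included, as members of the sequence may be empty.\<close>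

definition hausdorff_content :: "real \<Rightarrow> real \<Rightarrow> 'a::metric_space set \<Rightarrow> ennreal" where
  "hausdorff_content s \<delta> X =
     (INF U \<in> {U :: nat \<Rightarrow> 'a set. X \<subseteq> (\<Union>n. U n) \<and> (\<forall>n. bounded (U n) \<and> diameter (U n) \<le> \<delta>)}.
        \<Sum>n. diam_pow s (U n))"

definition hausdorff_measure :: "real \<Rightarrow> 'a::metric_space set \<Rightarrow> ennreal" where
  "hausdorff_measure s X = (SUP \<delta>\<in>{0<..}. hausdorff_content s \<delta> X)"

definition assouad_dim :: "'a::metric_space set \<Rightarrow> ereal" where
  "assouad_dim X =
     Inf {ereal s | s. s \<ge> 0 \<and>
       (\<exists>C>0. \<forall>r R x. 0 < r \<longrightarrow> r < R \<longrightarrow> x \<in> X \<longrightarrow>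
         (\<exists>P. finite P \<and> real (card P) \<le> C * (R / r) powr s \<and>
            X \<inter> cball x R \<subseteq> (\<Union>p\<in>P. cball p r)))}"

end

theory Submission
  imports Defs
begin

text \<open>
  Write \<open>\<psi>(w) = \<alpha>\<^sub>1 \<alpha>\<^sub>2\<^sup>s\<^sup>-\<^sup>1\<close> for the singular value function of the word \<open>w\<close> at the critical exponent
  \<open>s\<close>. Domination makes \<open>\<alpha>\<^sub>1\<close>, \<open>\<alpha>\<^sub>2\<close> and \<open>\<psi>\<close> multiplicative up to constants, so the \<open>\<psi>\<close>-weights of all words
  of a given length sum up to a quantity bounded above and below: \<open>\<psi>\<close> is a substitute for
  a quasi-Bernoulli measure.

  The core is a density bound: the words \<open>v\<close> for which the piece \<open>f\<^sub>w\<^sub>v(X)\<close> lies in a ball of radius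
  \<open>a \<ge> \<alpha>\<^sub>2(w) |X|\<close> have total weight at most \<open>M a / \<alpha>\<^sub>1(w)\<close>. If this failed with a large \<open>M\<close> for some ball,
  then for every prefix \<open>q\<close> the image of the ball in \<open>f\<^sub>q\<^sub>w(X)\<close> would be a short rectangle whose
  content is a small multiple of its weight; as almost every infinite word meets such a bad block,
  these images would exhaust \<open>X\<close> and its Hausdorff content would be less than it is.

  By the neighbourhood condition a ball of radius \<open>R\<close> meets boundedly many pieces of width about
  \<open>R\<close>. Inside one of them, the pieces of width about \<open>r\<close> meeting the ball are grouped
  dyadically by their length. The density bound controls each group by \<open>(R/r)\<^sup>s\<close> balls of radius
  \<open>r\<close>, and there are only \<open>O(1 + log (R/r))\<close> groups, which does not affect the dimension.
\<close>

section \<open>Singular values of planar matrices\<close>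

text \<open>A cylinder of length \<open>a1\<close> and width \<open>a2\<close> is covered by about
  \<open>a1 / a2\<close> squares of side \<open>a2\<close>, which explains the weight
  \<open>a1 * a2 powr (s - 1)\<close>. The neighbourhood condition counts only cylinders whose width
  is comparable to the radius of a ball. How thinner pieces pile up along the long direction of one
  cylinder is controlled by positive Hausdorff measure alone: too much weight in a short rectangle
  would yield a cover that is too cheap.

  No measure is constructed; finite weight sums replace it, so all comparisons need constants
  independent of the word length. The delicate one is that the norm of a product is bounded below by
  a multiple of the product of the norms: domination compares the singular values of each product,
  but does not speak directly of the angles between the directions of its factors. Instead of
  invariant cones, the proof follows single orbits and studies the scalar sequence
  \<open>orbit_ratio\<close>; the determinant then carries the bound over to
  \<open>a2\<close>.\<close>

definition wedge :: "real^2 \<Rightarrow> real^2 \<Rightarrow> real" where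
  "wedge x y = x$1 * y$2 - x$2 * y$1"

lemma wedge_matrix: "wedge (M *v x) (M *v y) = det M * wedge x y" for M :: "real^2^2"
  by (simp add: wedge_def det_2 matrix_vector_mult_def sum_2 algebra_simps)

text \<open>Lagrange's identity. As a matrix multiplies \<open>wedge\<close> by its determinant, it
  turns statements about areas into statements about norms.\<close>

lemma wedge_sq: "(wedge x y)\<^sup>2 + (x \<bullet> y)\<^sup>2 = (norm x)\<^sup>2 * (norm y)\<^sup>2"
  unfolding power2_norm_eq_inner
  by (simp add: wedge_def inner_vec_def sum_2) algebra

lemma abs_wedge_le: "\<bar>wedge x y\<bar> \<le> norm x * norm y"
proof -
  have "(wedge x y)\<^sup>2 \<le> (norm x * norm y)\<^sup>2"
    using wedge_sq[of x y] by (simp add: power_mult_distrib) (smt (verit) zero_le_power2)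
  then show ?thesis
    by (metis abs_le_square_iff abs_mult abs_norm_cancel)
qed

lemma orthonormal_2_expand:
  fixes e1 e2 x :: "real^2"
  assumes "norm e1 = 1" "norm e2 = 1" "e1 \<bullet> e2 = 0"
  shows "x = (x \<bullet> e1) *\<^sub>R e1 + (x \<bullet> e2) *\<^sub>R e2"
    and "(norm x)\<^sup>2 = (x \<bullet> e1)\<^sup>2 + (x \<bullet> e2)\<^sup>2"
proof -
  let ?a = "e1$1" let ?b = "e1$2" let ?c = "e2$1" let ?d = "e2$2"
  have ab: "?a\<^sup>2 + ?b\<^sup>2 = 1" and cd: "?c\<^sup>2 + ?d\<^sup>2 = 1" and o: "?a * ?c + ?b * ?d = 0"
    using assms by (simp_all add: norm_eq_1 inner_vec_def sum_2 power2_eq_square)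
  have "(?a * ?d - ?b * ?c)\<^sup>2 = 1"
    using wedge_sq[of e1 e2] assms by (simp add: wedge_def)
  then obtain \<epsilon> where e: "\<epsilon>\<^sup>2 = 1" "?a * ?d - ?b * ?c = \<epsilon>"
    by auto
  \<comment> \<open>\<open>e2\<close> is \<open>e1\<close> turned by a right angle, in the direction
    given by the sign \<open>\<epsilon>\<close>.\<close>
  have c: "?c = - \<epsilon> * ?b" and d: "?d = \<epsilon> * ?a"
    using ab o e by algebra+
  show 1: "x = (x \<bullet> e1) *\<^sub>R e1 + (x \<bullet> e2) *\<^sub>R e2"
  proof (simp add: vec_eq_iff forall_2 inner_vec_def sum_2, intro conjI)
    show "x $ 1 = (x$1 * ?a + x$2 * ?b) * ?a + (x$1 * ?c + x$2 * ?d) * ?c"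
      unfolding c d using ab e(1) by algebra
    show "x $ 2 = (x$1 * ?a + x$2 * ?b) * ?b + (x$1 * ?c + x$2 * ?d) * ?d"
      unfolding c d using ab e(1) by algebra
  qed
  show "(norm x)\<^sup>2 = (x \<bullet> e1)\<^sup>2 + (x \<bullet> e2)\<^sup>2"
    unfolding power2_norm_eq_inner
    by (subst (1) 1, subst inner_add_left) (simp add: power2_eq_square inner_commute)
qed

lemma gram_inner: "((transpose M ** M) *v x) \<bullet> y = (M *v x) \<bullet> (M *v y)" for M :: "real^2^2"
  by (metis dot_lmul_matrix matrix_vector_mul_assoc transpose_matrix_vector inner_commute)

text \<open>The singular values are defined through the spectrum of the Gram matrix; everything
  later uses this geometric form. The vector \<open>e1\<close> maximizes the norm of the image on
  the unit circle, and orthogonality of the two images is the first-order condition at this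
  maximum.\<close>

lemma singular_frame:
  fixes M :: "real^2^2"
  obtains e1 e2 where "norm e1 = 1" "norm e2 = 1" "e1 \<bullet> e2 = 0" "(M *v e1) \<bullet> (M *v e2) = 0"
    "norm (M *v e1) = \<alpha>\<^sub>1 M" "norm (M *v e2) = \<alpha>\<^sub>2 M" "\<alpha>\<^sub>2 M \<le> \<alpha>\<^sub>1 M"
proof -
  have "continuous_on (sphere 0 1) (\<lambda>x. norm (M *v x))"
    by (intro continuous_intros)
  moreover have "sphere (0::real^2) 1 \<noteq> {}"
    by simp
  ultimately obtain e1 :: "real^2" where "e1 \<in> sphere 0 1"
    and mx0: "\<forall>y\<in>sphere 0 1. norm (M *v y) \<le> norm (M *v e1)"
    using continuous_attains_sup[OF compact_sphere] by blast
  then have e1: "norm e1 = 1" by simp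
  from mx0 have mx: "norm (M *v y) \<le> norm (M *v e1)" if "norm y = 1" for y
    using that by simp
  define e2 :: "real^2" where "e2 = vector [- e1$2, e1$1]"
  have e2: "norm e2 = 1" and o: "e1 \<bullet> e2 = 0"
    using e1 by (simp_all add: e2_def norm_eq_1 inner_vec_def sum_2)
  define b where "b = (M *v e1) \<bullet> (M *v e2)"
  have mx': "(norm (M *v y))\<^sup>2 \<le> (norm (M *v e1))\<^sup>2 * (norm y)\<^sup>2" for y
  proof (cases "y = 0")
    case False
    have "norm (M *v (inverse (norm y) *\<^sub>R y)) \<le> norm (M *v e1)"
      by (rule mx) (use False in simp)
    then have "inverse (norm y) * norm (M *v y) \<le> norm (M *v e1)"
      by (simp only: matrix_vector_mult_scaleR norm_scaleR abs_inverse abs_norm_cancel)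
    then have "norm (M *v y) \<le> norm (M *v e1) * norm y"
      using False by (simp add: divide_simps)
    then have "(norm (M *v y))\<^sup>2 \<le> (norm (M *v e1) * norm y)\<^sup>2"
      by (rule power_mono) simp
    then show ?thesis
      by (simp add: power_mult_distrib)
  qed simp
  \<comment> \<open>Maximality at \<open>e1\<close> tested against the perturbation
    \<open>e1 + u e2\<close>: the linear term \<open>2 * b * u\<close> has to be absorbed by a
    quadratic one, which is possible for all \<open>u\<close> only if \<open>b = 0\<close>.\<close>
  have quad: "2 * b * u \<le> u\<^sup>2 * ((norm (M *v e1))\<^sup>2 - (norm (M *v e2))\<^sup>2)" for u
  proof -
    have "(norm (e1 + u *\<^sub>R e2))\<^sup>2 = 1 + u\<^sup>2"
    proof -
      have "e1 \<bullet> e1 = 1" "e2 \<bullet> e2 = 1" "e2 \<bullet> e1 = 0"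
        using e1 e2 o by (simp_all add: norm_eq_1 inner_commute)
      then show ?thesis
        using o unfolding power2_norm_eq_inner
        by (simp add: inner_add_left inner_add_right power2_eq_square)
    qed
    moreover have "(norm (M *v (e1 + u *\<^sub>R e2)))\<^sup>2
        = (norm (M *v e1))\<^sup>2 + 2 * b * u + u\<^sup>2 * (norm (M *v e2))\<^sup>2"
      unfolding b_def power2_norm_eq_inner
      by (simp add: matrix_vector_right_distrib matrix_vector_mult_scaleR
          inner_add_left inner_add_right inner_commute[of "M *v e2" "M *v e1"] power2_eq_square
          algebra_simps)
    ultimately show ?thesis
      using mx'[of "e1 + u *\<^sub>R e2"] by (simp add: algebra_simps)
  qed
  have b0: "b = 0"
  proof (rule ccontr)
    assume "b \<noteq> 0"
    define q where "q = (norm (M *v e1))\<^sup>2 - (norm (M *v e2))\<^sup>2"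
    have q: "q \<ge> 0"
      using mx[OF e2] by (simp add: q_def)
    \<comment> \<open>Of the sign of \<open>b\<close>; the summand 1 keeps the denominator positive
      when both images have equal norm.\<close>
    define u where "u = b / (q + 1)"
    have b: "b = u * (q + 1)" using q by (simp add: u_def)
    have "2 * b * u \<le> u\<^sup>2 * q"
      using quad[of u] by (simp add: q_def)
    then have "u\<^sup>2 * (q + 2) \<le> 0"
      unfolding b by (simp add: algebra_simps power2_eq_square)
    moreover have "u\<^sup>2 * (q + 2) > 0"
      using q b \<open>b \<noteq> 0\<close> by simp
    ultimately show False by simp
  qed
  define G where "G = transpose M ** M"
  let ?l1 = "(norm (M *v e1))\<^sup>2" let ?l2 = "(norm (M *v e2))\<^sup>2"
  have G1: "G *v e1 = ?l1 *\<^sub>R e1" and G2: "G *v e2 = ?l2 *\<^sub>R e2"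
    using orthonormal_2_expand(1)[OF e1 e2 o, of "G *v e1"]
      orthonormal_2_expand(1)[OF e1 e2 o, of "G *v e2"] b0
    unfolding G_def gram_inner b_def by (simp_all add: power2_norm_eq_inner inner_commute)
  have "eigenvalues G = {?l1, ?l2}"
  proof (intro equalityI subsetI)
    fix c assume "c \<in> eigenvalues G"
    then obtain v where v: "v \<noteq> 0" "G *v v = c *\<^sub>R v"
      by (auto simp: eigenvalues_def)
    have "(G *v v) \<bullet> e1 = v \<bullet> (G *v e1)" "(G *v v) \<bullet> e2 = v \<bullet> (G *v e2)"
      unfolding G_def by (metis gram_inner inner_commute)+
    then have "c * (v \<bullet> e1) = ?l1 * (v \<bullet> e1)" "c * (v \<bullet> e2) = ?l2 * (v \<bullet> e2)"
      by (simp_all add: v G1 G2)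
    moreover have "v \<bullet> e1 \<noteq> 0 \<or> v \<bullet> e2 \<noteq> 0"
      using orthonormal_2_expand(2)[OF e1 e2 o, of v] v(1) by auto
    ultimately show "c \<in> {?l1, ?l2}" by auto
  next
    fix c assume "c \<in> {?l1, ?l2}"
    moreover have "e1 \<noteq> 0" "e2 \<noteq> 0" using e1 e2 by auto
    ultimately show "c \<in> eigenvalues G"
      using G1 G2 by (auto simp: eigenvalues_def)
  qed
  moreover have "norm (M *v e2) \<le> norm (M *v e1)" by (rule mx[OF e2])
  ultimately have "\<alpha>\<^sub>1 M = norm (M *v e1)" "\<alpha>\<^sub>2 M = norm (M *v e2)"
    by (simp_all add: \<alpha>\<^sub>1_def \<alpha>\<^sub>2_def G_def[symmetric] max_def min_def power_mono)
  then show thesis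
    using that[OF e1 e2 o] b0 \<open>norm (M *v e2) \<le> norm (M *v e1)\<close> by (simp add: b_def)
qed

lemma \<alpha>\<^sub>2_nonneg: "0 \<le> \<alpha>\<^sub>2 M"
  by (rule singular_frame[of M]) (metis norm_ge_zero)

lemma \<alpha>\<^sub>2_le_\<alpha>\<^sub>1: "\<alpha>\<^sub>2 M \<le> \<alpha>\<^sub>1 M"
  by (rule singular_frame[of M])

lemma \<alpha>\<^sub>1_nonneg: "0 \<le> \<alpha>\<^sub>1 M"
  using \<alpha>\<^sub>2_nonneg \<alpha>\<^sub>2_le_\<alpha>\<^sub>1 order_trans by blast

lemma \<alpha>_bounds: "norm (M *v x) \<le> \<alpha>\<^sub>1 M * norm x" "\<alpha>\<^sub>2 M * norm x \<le> norm (M *v x)"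
proof -
  obtain e1 e2 where e: "norm e1 = 1" "norm e2 = 1" "e1 \<bullet> e2 = 0" "(M *v e1) \<bullet> (M *v e2) = 0"
    "norm (M *v e1) = \<alpha>\<^sub>1 M" "norm (M *v e2) = \<alpha>\<^sub>2 M" "\<alpha>\<^sub>2 M \<le> \<alpha>\<^sub>1 M"
    by (rule singular_frame)
  define a b where "a = x \<bullet> e1" and "b = x \<bullet> e2"
  have x: "x = a *\<^sub>R e1 + b *\<^sub>R e2" and n: "(norm x)\<^sup>2 = a\<^sup>2 + b\<^sup>2"
    unfolding a_def b_def by (rule orthonormal_2_expand[OF e(1-3)])+
  have m: "(norm (M *v x))\<^sup>2 = a\<^sup>2 * (\<alpha>\<^sub>1 M)\<^sup>2 + b\<^sup>2 * (\<alpha>\<^sub>2 M)\<^sup>2"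
    unfolding e(5,6)[symmetric] using e(4) unfolding x power2_norm_eq_inner
    by (simp add: matrix_vector_right_distrib matrix_vector_mult_scaleR algebra_simps
        inner_commute power2_eq_square)
  have sq: "(\<alpha>\<^sub>2 M)\<^sup>2 \<le> (\<alpha>\<^sub>1 M)\<^sup>2"
    using e(7) \<alpha>\<^sub>2_nonneg by (intro power_mono)
  have "(norm (M *v x))\<^sup>2 \<le> (\<alpha>\<^sub>1 M * norm x)\<^sup>2"
    using mult_left_mono[OF sq, of "b\<^sup>2"] by (simp add: m power_mult_distrib n algebra_simps)
  then show "norm (M *v x) \<le> \<alpha>\<^sub>1 M * norm x"
    by (rule power2_le_imp_le) (simp add: \<alpha>\<^sub>1_nonneg)
  have "(\<alpha>\<^sub>2 M * norm x)\<^sup>2 \<le> (norm (M *v x))\<^sup>2"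
    using mult_left_mono[OF sq, of "a\<^sup>2"] by (simp add: m power_mult_distrib n algebra_simps)
  then show "\<alpha>\<^sub>2 M * norm x \<le> norm (M *v x)"
    by (rule power2_le_imp_le) simp
qed

lemma \<alpha>\<^sub>1_mult_\<alpha>\<^sub>2: "\<alpha>\<^sub>1 M * \<alpha>\<^sub>2 M = \<bar>det M\<bar>"
proof -
  obtain e1 e2 where e: "norm e1 = 1" "norm e2 = 1" "e1 \<bullet> e2 = 0" "(M *v e1) \<bullet> (M *v e2) = 0"
    "norm (M *v e1) = \<alpha>\<^sub>1 M" "norm (M *v e2) = \<alpha>\<^sub>2 M" "\<alpha>\<^sub>2 M \<le> \<alpha>\<^sub>1 M"
    by (rule singular_frame)
  have "(\<alpha>\<^sub>1 M * \<alpha>\<^sub>2 M)\<^sup>2 = (det M)\<^sup>2"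
    using wedge_sq[of "M *v e1" "M *v e2"] wedge_sq[of e1 e2] e(1-6)
    by (simp add: wedge_matrix power_mult_distrib)
  then show ?thesis
    by (metis \<alpha>\<^sub>1_nonneg \<alpha>\<^sub>2_nonneg abs_of_nonneg mult_nonneg_nonneg real_sqrt_abs)
qed

section \<open>Singular values of products\<close>

lemma \<alpha>\<^sub>1_mult_le: "\<alpha>\<^sub>1 (M ** N) \<le> \<alpha>\<^sub>1 M * \<alpha>\<^sub>1 N"
proof -
  obtain e where e: "norm e = 1" "norm ((M ** N) *v e) = \<alpha>\<^sub>1 (M ** N)"
    by (rule singular_frame)
  have "norm (M *v (N *v e)) \<le> \<alpha>\<^sub>1 M * norm (N *v e)" by (rule \<alpha>_bounds)
  also have "\<dots> \<le> \<alpha>\<^sub>1 M * (\<alpha>\<^sub>1 N * norm e)"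
    by (intro mult_left_mono \<alpha>_bounds \<alpha>\<^sub>1_nonneg)
  finally show ?thesis using e by (simp add: matrix_vector_mul_assoc)
qed

lemma \<alpha>\<^sub>2_mult_ge: "\<alpha>\<^sub>2 M * \<alpha>\<^sub>2 N \<le> \<alpha>\<^sub>2 (M ** N)"
proof -
  obtain e where e: "norm e = 1" "norm ((M ** N) *v e) = \<alpha>\<^sub>2 (M ** N)"
    by (rule singular_frame)
  have "\<alpha>\<^sub>2 M * (\<alpha>\<^sub>2 N * norm e) \<le> \<alpha>\<^sub>2 M * norm (N *v e)"
    by (intro mult_left_mono \<alpha>_bounds \<alpha>\<^sub>2_nonneg)
  also have "\<dots> \<le> norm (M *v (N *v e))" by (rule \<alpha>_bounds)
  finally show ?thesis using e by (simp add: matrix_vector_mul_assoc)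
qed

text \<open>Evaluated at the unit vector that \<open>N\<close> contracts most. The norm belongs to
  the left factor: later a prefix stretches a ball by at most this amount, and the width of the
  longer cylinder must not exceed the stretched radius.\<close>

lemma \<alpha>\<^sub>2_mult_le: "\<alpha>\<^sub>2 (M ** N) \<le> \<alpha>\<^sub>1 M * \<alpha>\<^sub>2 N"
proof -
  obtain e where e: "norm e = 1" "norm (N *v e) = \<alpha>\<^sub>2 N"
    by (rule singular_frame)
  have "\<alpha>\<^sub>2 (M ** N) * norm e \<le> norm (M *v (N *v e))"
    by (metis \<alpha>_bounds(2) matrix_vector_mul_assoc)
  also have "\<dots> \<le> \<alpha>\<^sub>1 M * norm (N *v e)" by (rule \<alpha>_bounds)
  finally show ?thesis using e by simp
qed

lemma \<alpha>_mat_1 [simp]: "\<alpha>\<^sub>1 (mat 1) = 1" "\<alpha>\<^sub>2 (mat 1) = 1"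
  by (rule singular_frame[of "mat 1"]; simp)+

lemma \<alpha>\<^sub>2_pos: "det M \<noteq> 0 \<Longrightarrow> 0 < \<alpha>\<^sub>2 M"
  using \<alpha>\<^sub>1_mult_\<alpha>\<^sub>2[of M] \<alpha>\<^sub>2_nonneg[of M] by (cases "\<alpha>\<^sub>2 M = 0") auto

lemma \<alpha>\<^sub>1_eq_onorm: "\<alpha>\<^sub>1 M = onorm ((*v) M)"
proof (rule antisym)
  obtain e where e: "norm e = 1" "norm (M *v e) = \<alpha>\<^sub>1 M"
    by (rule singular_frame)
  then show "\<alpha>\<^sub>1 M \<le> onorm ((*v) M)"
    using onorm[OF matrix_vector_mul_bounded_linear[of M], of e] by simp
  show "onorm ((*v) M) \<le> \<alpha>\<^sub>1 M"
    by (intro onorm_le \<alpha>_bounds)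
qed

section \<open>Domination and almost multiplicativity of the norm\<close>

lemma summable_square_geometric:
  fixes \<tau> :: real
  assumes "0 < \<tau>" "\<tau> < 1"
  shows "summable (\<lambda>n. (real n + 1)\<^sup>2 * \<tau> ^ n)"
proof -
  have "(\<lambda>n. (1 + inverse (real (Suc n)))\<^sup>2 * \<tau>) \<longlonglongrightarrow> 1\<^sup>2 * \<tau>"
    by (intro tendsto_intros LIMSEQ_inverse_real_of_nat_add)
  then have "\<forall>\<^sub>F n in sequentially. (1 + inverse (real (Suc n)))\<^sup>2 * \<tau> < (1 + \<tau>) / 2"
    using assms by (intro order_tendstoD) auto
  then obtain N where N: "(1 + inverse (real (Suc n)))\<^sup>2 * \<tau> < (1 + \<tau>) / 2" if "n \<ge> N" for n
    by (auto simp: eventually_sequentially)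
  show ?thesis
  proof (rule summable_ratio_test[of "(1 + \<tau>) / 2" N])
    fix n assume n: "n \<ge> N"
    have "real (Suc n) + 1 = (1 + inverse (real (Suc n))) * (real n + 1)"
      by (simp add: field_simps)
    then have "(real (Suc n) + 1)\<^sup>2 * \<tau> ^ Suc n
        = ((1 + inverse (real (Suc n)))\<^sup>2 * \<tau>) * ((real n + 1)\<^sup>2 * \<tau> ^ n)"
      by (simp only: power_mult_distrib power_Suc mult_ac)
    also have "\<dots> \<le> (1 + \<tau>) / 2 * ((real n + 1)\<^sup>2 * \<tau> ^ n)"
      using N[OF n] assms by (intro mult_right_mono) auto
    finally show "norm ((real (Suc n) + 1)\<^sup>2 * \<tau> ^ Suc n) \<le> (1 + \<tau>) / 2 * norm ((real n + 1)\<^sup>2 * \<tau> ^ n)"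
      using assms by simp
  qed (use assms in simp)
qed

lemma geometric_beats_square:
  fixes \<tau> c B :: real
  assumes "0 < \<tau>" "\<tau> < 1" "0 < c"
  obtains L where "\<And>n. n \<ge> L \<Longrightarrow> B * (real n + 1)\<^sup>2 * \<tau> ^ n < c"
proof -
  have "(\<lambda>n. B * ((real n + 1)\<^sup>2 * \<tau> ^ n)) \<longlonglongrightarrow> B * 0"
    by (intro tendsto_intros summable_LIMSEQ_zero summable_square_geometric assms)
  then have "\<forall>\<^sub>F n in sequentially. B * ((real n + 1)\<^sup>2 * \<tau> ^ n) < c"
    using assms(3) by (intro order_tendstoD) auto
  then show thesis
    using that by (auto simp: eventually_sequentially mult.assoc)
qed

text \<open>Along an orbit \<open>x\<^sub>k\<close> the sequence \<open>y\<^sub>k = \<bar>det\<^sub>k\<bar> / \<bar>x\<^sub>k\<bar>\<^sup>2\<close> satisfies the third condition by domination. Between two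
  values \<open>\<ge> u\<close>, on a window where \<open>y\<close> is otherwise below \<open>u\<close>, that condition bounds the length of
  the window, so that \<open>y\<close> cannot drop far below \<open>u\<close>.\<close>

definition valley_free :: "real \<Rightarrow> real \<Rightarrow> real \<Rightarrow> nat \<Rightarrow> (nat \<Rightarrow> real) \<Rightarrow> bool" where
  "valley_free B c \<tau> N y \<longleftrightarrow>
     (\<forall>k\<le>N. 0 < y k) \<and> (\<forall>k<N. y k \<le> B * y (Suc k) \<and> y (Suc k) \<le> B * y k) \<and>
     (\<forall>a b. a \<le> b \<longrightarrow> b \<le> N \<longrightarrow> c * (y a * y b) \<le> \<tau> ^ (b - a) * (\<Sum>k=a..b. y k)\<^sup>2)"

lemma step_iterate:
  fixes y :: "nat \<Rightarrow> real"
  assumes "\<And>k. k < N \<Longrightarrow> y k \<le> B * y (Suc k)" "0 \<le> B" "m + n \<le> N"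
  shows "y m \<le> B ^ n * y (m + n)"
  using assms(3)
proof (induction n)
  case (Suc n)
  then have "y m \<le> B ^ n * y (m + n)" by simp
  also have "\<dots> \<le> B ^ n * (B * y (Suc (m + n)))"
    using Suc.prems assms(1,2) by (intro mult_left_mono) auto
  finally show ?case by (simp add: mult_ac)
qed simp

lemma valley_bound:
  fixes B c \<tau> :: real
  assumes B: "1 \<le> B" and c: "0 < c" and \<tau>: "0 < \<tau>" "\<tau> < 1"
  obtains K where "K \<ge> 1" "\<And>N y i m j u. valley_free B c \<tau> N y \<Longrightarrow> i \<le> m \<Longrightarrow> m \<le> j \<Longrightarrow> j \<le> N \<Longrightarrow>
      0 < u \<Longrightarrow> u \<le> y i \<Longrightarrow> u \<le> y j \<Longrightarrow> u \<le> K * y m"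
proof -
  obtain L where L: "\<And>n. n \<ge> L \<Longrightarrow> B\<^sup>2 * (real n + 1)\<^sup>2 * \<tau> ^ n < c"
    using geometric_beats_square[OF \<tau> c] by blast
  have main: "u \<le> B ^ L * y m"
    if v: "valley_free B c \<tau> N y" and ij: "i \<le> m" "m \<le> j" "j \<le> N" and u: "0 < u" "u \<le> y i" "u \<le> y j"
    for N y i m j u
  proof (cases "u \<le> y m")
    case True
    have "0 < y m" using v ij by (auto simp: valley_free_def)
    moreover have "1 \<le> B ^ L" using B by simp
    ultimately have "y m \<le> B ^ L * y m" by simp
    then show ?thesis using True by simp
  next
    case False
    \<comment> \<open>The last index before and the first index after \<open>m\<close> where the
      level \<open>u\<close> is reached; strictly between them \<open>y\<close> stays below
      \<open>u\<close>.\<close>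
    define a where "a = (GREATEST k. k \<le> m \<and> u \<le> y k)"
    define b where "b = (LEAST k. m \<le> k \<and> u \<le> y k)"
    have a: "a \<le> m \<and> u \<le> y a"
      unfolding a_def by (rule GreatestI_nat[of _ i m]) (use ij u in auto)
    have a_max: "k \<le> a" if "k \<le> m" "u \<le> y k" for k
      unfolding a_def by (rule Greatest_le_nat[of _ _ m]) (use that in auto)
    have b: "m \<le> b \<and> u \<le> y b"
      unfolding b_def by (rule LeastI[of _ j]) (use ij u in auto)
    have b_min: "b \<le> k" if "m \<le> k" "u \<le> y k" for k
      unfolding b_def by (rule Least_le) (use that in auto)
    have "b \<le> N" using b_min[of j] ij u by simp
    have "a \<noteq> m" "b \<noteq> m" using a b False by auto
    then have ab: "a < m" "m < b" using a b by auto
    have inner: "y k < u" if "a < k" "k < b" for k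
      using a_max[of k] b_min[of k] that by (cases "k \<le> m") force+
    have stepB: "y k \<le> B * y (Suc k)" "y (Suc k) \<le> B * y k" if "k < N" for k
      using v that by (auto simp: valley_free_def)
    \<comment> \<open>The endpoints might lie far above \<open>u\<close>, but each has a neighbour
      strictly inside the window, and one step changes \<open>y\<close> by at most the factor
      \<open>B\<close>.\<close>
    have le: "y k \<le> B * u" if "a \<le> k" "k \<le> b" for k
    proof -
      have "k = a \<or> a < k \<and> k < b \<or> k = b" using that by linarith
      then consider "k = a" | "a < k" "k < b" | "k = b" by blast
      then show ?thesis
      proof cases
        case 1
        have "y a \<le> B * y (Suc a)" using stepB ab \<open>b \<le> N\<close> by auto
        also have "\<dots> \<le> B * u" using inner[of "Suc a"] ab B by (intro mult_left_mono) auto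
        finally show ?thesis using 1 by simp
      next
        case 2
        then have "y k < u" by (rule inner)
        also have "u \<le> B * u" using B u by simp
        finally show ?thesis by simp
      next
        case 3
        have "y b \<le> B * y (b - 1)" using stepB(2)[of "b - 1"] ab \<open>b \<le> N\<close> by auto
        also have "\<dots> \<le> B * u" using inner[of "b - 1"] ab B by (intro mult_left_mono) fastforce+
        finally show ?thesis using 3 by simp
      qed
    qed
    \<comment> \<open>On a window of length \<open>n\<close> the sum is at most
      \<open>(n + 1) * B * u\<close>, while both ends are at least \<open>u\<close>; for
      \<open>n \<ge> L\<close> the factor \<open>\<tau> ^ n\<close> makes this impossible.\<close>
    have "b - a < L"
    proof (rule ccontr)
      assume "\<not> b - a < L"
      then have l: "B\<^sup>2 * (real (b - a) + 1)\<^sup>2 * \<tau> ^ (b - a) < c" by (intro L) simp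
      have pos: "0 < y k" if "k \<le> N" for k using v that by (auto simp: valley_free_def)
      have "(\<Sum>k=a..b. y k) \<le> real (card {a..b}) * (B * u)"
        using le by (intro sum_bounded_above) auto
      also have "\<dots> = (real (b - a) + 1) * (B * u)"
        using ab by (simp add: Suc_diff_le)
      finally have s: "(\<Sum>k=a..b. y k) \<le> (real (b - a) + 1) * (B * u)" .
      have "c * u\<^sup>2 \<le> c * (y a * y b)"
        using a b u c by (auto simp: power2_eq_square intro!: mult_mono)
      also have "\<dots> \<le> \<tau> ^ (b - a) * (\<Sum>k=a..b. y k)\<^sup>2"
        using v ab \<open>b \<le> N\<close> by (auto simp: valley_free_def)
      also have "\<dots> \<le> \<tau> ^ (b - a) * ((real (b - a) + 1) * (B * u))\<^sup>2"
        using s pos \<open>b \<le> N\<close> \<tau> by (intro mult_left_mono power_mono sum_nonneg) (auto intro: less_imp_le)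
      also have "\<dots> = (B\<^sup>2 * (real (b - a) + 1)\<^sup>2 * \<tau> ^ (b - a)) * u\<^sup>2"
        by (simp add: power_mult_distrib)
      finally show False
        using l u by (simp add: mult_le_cancel_right)
    qed
    \<comment> \<open>From \<open>a\<close> to \<open>m\<close> there are fewer than
      \<open>L\<close> steps, each losing at most the factor \<open>B\<close>.\<close>
    have "u \<le> y a" using a by simp
    also have "\<dots> \<le> B ^ (m - a) * y (a + (m - a))"
      using stepB(1) B ij ab by (intro step_iterate[where N = N]) auto
    also have "\<dots> \<le> B ^ L * y m"
      using \<open>b - a < L\<close> ab B v ij by (auto simp: valley_free_def intro!: mult_right_mono power_increasing)
    finally show ?thesis .
  qed
  show thesis
    by (rule that[of "B ^ L"]) (use B main in auto)
qed

text \<open>The bound by \<open>H * y 0\<close> makes the start a high point for every later level,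
  so each \<open>y k\<close> is at most a constant times any earlier \<open>y m\<close>. With this
  crude bound on the whole window, the squared sum in \<open>valley_free\<close> costs only a factor
  \<open>(k - m + 1)^2\<close>, and the decay \<open>\<tau> ^ (k - m)\<close> yields a summable
  bound for \<open>y k / y m\<close>.\<close>

lemma valley_free_tail:
  fixes B c \<tau> H :: real
  assumes B: "1 \<le> B" and c: "0 < c" and \<tau>: "0 < \<tau>" "\<tau> < 1" and H: "1 \<le> H"
  obtains K where "0 < K" "\<And>N y m. valley_free B c \<tau> N y \<Longrightarrow> (\<And>k. k \<le> N \<Longrightarrow> y k \<le> H * y 0) \<Longrightarrow>
      m \<le> N \<Longrightarrow> (\<Sum>k=m..N. y k) \<le> K * y m"
proof -
  obtain K0 where K0: "K0 \<ge> 1" "\<And>N y i m j u. valley_free B c \<tau> N y \<Longrightarrow> i \<le> m \<Longrightarrow> m \<le> j \<Longrightarrow> j \<le> N \<Longrightarrow>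
      0 < u \<Longrightarrow> u \<le> y i \<Longrightarrow> u \<le> y j \<Longrightarrow> u \<le> K0 * y m"
    using valley_bound[OF B c \<tau>] by blast
  define S where "S = (\<Sum>n. (real n + 1)\<^sup>2 * \<tau> ^ n)"
  define D where "D = (K0 * H)\<^sup>2 / c"
  have D: "D > 0" using K0 H c by (simp add: D_def)
  have main: "(\<Sum>k=m..N. y k) \<le> D * S * y m"
    if v: "valley_free B c \<tau> N y" and h: "\<And>k. k \<le> N \<Longrightarrow> y k \<le> H * y 0" and m: "m \<le> N" for N y m
  proof -
    have pos: "0 < y k" if "k \<le> N" for k using v that by (auto simp: valley_free_def)
    have up: "y k \<le> K0 * H * y m" if "m \<le> k" "k \<le> N" for k
    proof -
      \<comment> \<open>The level \<open>y k / H\<close> is reached at 0 by hypothesis and at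
        \<open>k\<close> because \<open>H \<ge> 1\<close>.\<close>
      have "y k / H \<le> K0 * y m"
      proof (rule K0(2)[OF v, of 0 m k])
        show "y k / H \<le> y 0" using h[OF that(2)] H by (simp add: field_simps)
        show "y k / H \<le> y k" using pos[OF that(2)] H by (simp add: field_simps)
      qed (use that pos H in auto)
      then show ?thesis using H by (simp add: field_simps)
    qed
    have bound: "y k \<le> D * ((real (k - m) + 1)\<^sup>2 * \<tau> ^ (k - m)) * y m" if k: "m \<le> k" "k \<le> N" for k
    proof -
      have "(\<Sum>j=m..k. y j) \<le> real (card {m..k}) * (K0 * H * y m)"
        using up k by (intro sum_bounded_above) auto
      then have s: "(\<Sum>j=m..k. y j) \<le> (real (k - m) + 1) * (K0 * H * y m)"
        using k by (simp add: Suc_diff_le add.commute)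
      have "c * (y m * y k) \<le> \<tau> ^ (k - m) * (\<Sum>j=m..k. y j)\<^sup>2"
        using v k by (auto simp: valley_free_def)
      also have "\<dots> \<le> \<tau> ^ (k - m) * ((real (k - m) + 1) * (K0 * H * y m))\<^sup>2"
        using s pos k \<tau> by (intro mult_left_mono power_mono sum_nonneg) (auto intro: less_imp_le)
      also have "\<dots> = (c * (D * ((real (k - m) + 1)\<^sup>2 * \<tau> ^ (k - m)) * y m)) * y m"
        using c by (simp add: D_def power_mult_distrib) (simp add: power2_eq_square)
      finally have "(c * y k) * y m \<le> (c * (D * ((real (k - m) + 1)\<^sup>2 * \<tau> ^ (k - m)) * y m)) * y m"
        by (simp add: mult_ac)
      then show ?thesis using pos[OF m] c by simp
    qed
    have "(\<Sum>k=m..N. y k) \<le> (\<Sum>k=m..N. D * ((real (k - m) + 1)\<^sup>2 * \<tau> ^ (k - m)) * y m)"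
      by (intro sum_mono bound) auto
    also have "\<dots> = (\<Sum>n=0..N - m. D * ((real n + 1)\<^sup>2 * \<tau> ^ n) * y m)"
      by (rule sum.reindex_bij_witness[of _ "\<lambda>n. n + m" "\<lambda>k. k - m"]) (use m in auto)
    also have "\<dots> = D * y m * (\<Sum>n=0..N - m. (real n + 1)\<^sup>2 * \<tau> ^ n)"
      by (simp add: sum_distrib_left mult_ac)
    also have "\<dots> \<le> D * y m * S"
      unfolding S_def using D pos[OF m] \<tau>
      by (intro mult_left_mono sum_le_suminf summable_square_geometric) auto
    finally show ?thesis by (simp add: mult_ac)
  qed
  have "S > 0"
    unfolding S_def using \<tau> by (intro suminf_pos summable_square_geometric) auto
  then show thesis
    using that[of "D * S"] D main by auto
qed

section \<open>Products of matrices along an orbit\<close>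

fun mat_prod :: "(nat \<Rightarrow> real^2^2) \<Rightarrow> nat \<Rightarrow> nat \<Rightarrow> real^2^2" where
  "mat_prod G a 0 = mat 1"
| "mat_prod G a (Suc n) = G (a + n) ** mat_prod G a n"

lemma mat_prod_add: "mat_prod G a (m + n) = mat_prod G (a + m) n ** mat_prod G a m"
  by (induction n) (simp_all add: matrix_mul_assoc add.assoc)

text \<open>Both sides are the area of the parallelogram spanned by \<open>x\<close> and
  \<open>z\<close>, computed once as base times height.\<close>

lemma component_bound:
  fixes x z :: "real^2"
  assumes "x \<noteq> 0"
  shows "norm (z - ((z \<bullet> x) / (norm x)\<^sup>2) *\<^sub>R x) * norm x = \<bar>wedge x z\<bar>"
proof -
  define c where "c = (z \<bullet> x) / (norm x)\<^sup>2"
  have c: "c * (norm x)\<^sup>2 = z \<bullet> x" using assms by (simp add: c_def)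
  have "(norm (z - c *\<^sub>R x))\<^sup>2 = (norm z)\<^sup>2 - 2 * c * (z \<bullet> x) + c * (c * (norm x)\<^sup>2)"
    unfolding power2_norm_eq_inner
    by (simp add: inner_diff_left inner_diff_right inner_commute[of x z] algebra_simps)
  also have "\<dots> = (norm z)\<^sup>2 - c * (z \<bullet> x)"
    by (simp add: c)
  finally have "(norm (z - c *\<^sub>R x) * norm x)\<^sup>2 = (norm z)\<^sup>2 * (norm x)\<^sup>2 - (c * (norm x)\<^sup>2) * (z \<bullet> x)"
    by (simp only: power_mult_distrib) (simp add: algebra_simps)
  also have "\<dots> = (wedge x z)\<^sup>2"
    using wedge_sq[of x z] c by (simp add: inner_commute power2_eq_square algebra_simps)
  finally have "norm (z - c *\<^sub>R x) * norm x = \<bar>wedge x z\<bar>"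
    by (metis abs_mult abs_norm_cancel real_sqrt_abs)
  then show ?thesis by (simp add: c_def)
qed

text \<open>Every vector \<open>z\<close> is split along the orbit of \<open>x\<close>. The transversal part shrinks by the
  determinant, so the component along the orbit grows in each step by at most
  a term of the sum.\<close>

lemma norm_le_along_orbit:
  fixes G :: "nat \<Rightarrow> real^2^2" and x :: "real^2"
  assumes G: "\<And>k. k < n \<Longrightarrow> \<alpha>\<^sub>1 (G (a + k)) \<le> 1" "\<And>k. k < n \<Longrightarrow> l \<le> \<alpha>\<^sub>2 (G (a + k))"
    and l: "0 < l" "l \<le> 1" and x: "x \<noteq> 0"
  shows "\<alpha>\<^sub>1 (mat_prod G a n) * norm x \<le> 2 / l * norm (mat_prod G a n *v x) *
      (\<Sum>k=0..n. \<bar>det (mat_prod G a k)\<bar> * (norm x)\<^sup>2 / (norm (mat_prod G a k *v x))\<^sup>2)"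
proof -
  obtain z where z: "norm z = 1" "norm (mat_prod G a n *v z) = \<alpha>\<^sub>1 (mat_prod G a n)"
    by (rule singular_frame)
  \<comment> \<open>\<open>c k\<close> is the coefficient of the orbit of \<open>z\<close> along
    that of \<open>x\<close>, and \<open>p k\<close> the part orthogonal to it.\<close>
  define X Z Y c p where "X k = mat_prod G a k *v x" and "Z k = mat_prod G a k *v z"
    and "Y k = \<bar>det (mat_prod G a k)\<bar> * (norm x)\<^sup>2 / (norm (X k))\<^sup>2"
    and "c k = (Z k \<bullet> X k) / (norm (X k))\<^sup>2" and "p k = Z k - c k *\<^sub>R X k" for k
  have X_Suc: "X (Suc k) = G (a + k) *v X k" and Z_Suc: "Z (Suc k) = G (a + k) *v Z k" for k
    by (simp_all add: X_def Z_def matrix_vector_mul_assoc)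
  have l_le: "l * norm v \<le> norm (G (a + k) *v v)" if "k < n" for k v
    using \<alpha>_bounds(2)[of "G (a + k)" v] G(2)[OF that] mult_right_mono[of l "\<alpha>\<^sub>2 (G (a + k))" "norm v"]
    by simp
  have G_le: "norm (G (a + k) *v v) \<le> norm v" if "k < n" for k v
    using \<alpha>_bounds(1)[of "G (a + k)" v] G(1)[OF that] mult_right_mono[of "\<alpha>\<^sub>1 (G (a + k))" 1 "norm v"]
    by simp
  have Xnz: "X k \<noteq> 0" if "k \<le> n" for k
    using that
  proof (induction k)
    case (Suc k)
    then show ?case using l_le[of k "X k"] l by (auto simp: X_Suc mult_le_0_iff)
  qed (simp add: X_def x)
  have Ynn: "0 \<le> Y k" for k by (simp add: Y_def)
  have Y0: "Y 0 = 1" using x by (simp add: Y_def X_def)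
  have p_bound: "norm (p k) * norm x \<le> Y k * norm (X k)" if "k \<le> n" for k
  proof -
    have "norm (p k) * norm (X k) = \<bar>wedge (X k) (Z k)\<bar>"
      unfolding p_def c_def by (rule component_bound[OF Xnz[OF that]])
    also have "\<dots> = \<bar>det (mat_prod G a k)\<bar> * \<bar>wedge x z\<bar>"
      by (simp add: X_def Z_def wedge_matrix abs_mult)
    also have "\<dots> \<le> \<bar>det (mat_prod G a k)\<bar> * norm x"
      using abs_wedge_le[of x z] z by (intro mult_left_mono) auto
    finally have "norm (p k) * norm (X k) * norm x \<le> \<bar>det (mat_prod G a k)\<bar> * norm x * norm x"
      by (rule mult_right_mono) simp
    also have "\<dots> = Y k * norm (X k) * norm (X k)"
      using Xnz[OF that] by (simp add: Y_def power2_eq_square)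
    finally have "(norm (p k) * norm x) * norm (X k) \<le> (Y k * norm (X k)) * norm (X k)"
      by (simp add: mult_ac)
    then show ?thesis using Xnz[OF that] by simp
  qed
  \<comment> \<open>Only the image of \<open>p k\<close> can change the coefficient, by at most
    \<open>norm (p k) / norm (X (Suc k))\<close>. The area bound for \<open>p k\<close> and the
    lower bound \<open>l\<close> for one step turn this, after multiplication by
    \<open>norm x\<close>, into \<open>Y k / l\<close>.\<close>
  have c_bound: "\<bar>c k\<bar> * norm x \<le> 1 / l * (1 + (\<Sum>j<k. Y j))" if "k \<le> n" for k
    using that
  proof (induction k)
    case 0
    have "\<bar>c 0\<bar> * norm x = \<bar>z \<bullet> x\<bar> / norm x"
      using x by (simp add: c_def X_def Z_def abs_mult power2_eq_square)
    also have "\<dots> \<le> 1"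
      using Cauchy_Schwarz_ineq2[of z x] z x by simp
    also have "\<dots> \<le> 1 / l" using l by simp
    finally show ?case by simp
  next
    case (Suc k)
    then have k: "k < n" "k \<le> n" by auto
    have "Z (Suc k) = c k *\<^sub>R X (Suc k) + G (a + k) *v p k"
      by (simp add: Z_Suc X_Suc p_def matrix_vector_mult_diff_distrib matrix_vector_mult_scaleR)
    then have "c (Suc k) = c k + ((G (a + k) *v p k) \<bullet> X (Suc k)) / (norm (X (Suc k)))\<^sup>2"
      using Xnz[of "Suc k"] k
      by (simp add: c_def[of "Suc k"] inner_add_left add_divide_distrib power2_norm_eq_inner)
    then have "\<bar>c (Suc k)\<bar> \<le> \<bar>c k\<bar> + \<bar>(G (a + k) *v p k) \<bullet> X (Suc k)\<bar> / (norm (X (Suc k)))\<^sup>2"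
      by (metis abs_divide abs_power2 abs_triangle_ineq)
    also have "\<bar>(G (a + k) *v p k) \<bullet> X (Suc k)\<bar> / (norm (X (Suc k)))\<^sup>2
        \<le> norm (p k) * norm (X (Suc k)) / (norm (X (Suc k)))\<^sup>2"
    proof (rule divide_right_mono)
      have "\<bar>(G (a + k) *v p k) \<bullet> X (Suc k)\<bar> \<le> norm (G (a + k) *v p k) * norm (X (Suc k))"
        by (rule Cauchy_Schwarz_ineq2)
      also have "\<dots> \<le> norm (p k) * norm (X (Suc k))"
        by (intro mult_right_mono G_le k) simp
      finally show "\<bar>(G (a + k) *v p k) \<bullet> X (Suc k)\<bar> \<le> norm (p k) * norm (X (Suc k))" .
    qed simp
    also have "\<dots> = norm (p k) / norm (X (Suc k))"
      using Xnz[of "Suc k"] k by (simp add: power2_eq_square)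
    finally have "\<bar>c (Suc k)\<bar> * norm x \<le> \<bar>c k\<bar> * norm x + norm (p k) * norm x / norm (X (Suc k))"
      using mult_right_mono[of _ _ "norm x"] by (fastforce simp: algebra_simps)
    also have "norm (p k) * norm x / norm (X (Suc k)) \<le> Y k * norm (X k) / norm (X (Suc k))"
      by (intro divide_right_mono p_bound k) simp
    also have "\<dots> \<le> Y k * (1 / l)"
    proof -
      have "norm (X k) / norm (X (Suc k)) \<le> 1 / l"
        using l_le[of k "X k"] k l Xnz[of "Suc k"] by (simp add: X_Suc field_simps)
      then show ?thesis using mult_left_mono[OF _ Ynn[of k]] by fastforce
    qed
    finally show ?case using Suc.IH k by (simp add: algebra_simps)
  qed
  define S where "S = (\<Sum>k=0..n. Y k)"
  have S: "S = (\<Sum>j<n. Y j) + Y n"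
    unfolding S_def by (simp add: atLeast0AtMost lessThan_Suc_atMost[symmetric])
  have "1 \<le> S"
    unfolding S_def using member_le_sum[of 0 "{0..n}" Y] Ynn Y0 by simp
  have "norm (Z n) \<le> \<bar>c n\<bar> * norm (X n) + norm (p n)"
    using norm_triangle_ineq[of "c n *\<^sub>R X n" "p n"] by (simp add: p_def)
  then have "norm (Z n) * norm x \<le> (\<bar>c n\<bar> * norm x) * norm (X n) + norm (p n) * norm x"
    using mult_right_mono[of _ _ "norm x"] by (fastforce simp: algebra_simps)
  also have "\<dots> \<le> (1 / l * (1 + (\<Sum>j<n. Y j))) * norm (X n) + Y n * norm (X n)"
    by (intro add_mono mult_right_mono c_bound p_bound) auto
  also have "Y n * norm (X n) \<le> (1 / l * Y n) * norm (X n)"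
    using l Ynn[of n] by (intro mult_right_mono) (auto simp: field_simps mult_left_le_one_le)
  also have "(1 / l * (1 + (\<Sum>j<n. Y j))) * norm (X n) + (1 / l * Y n) * norm (X n)
      = 1 / l * (1 + S) * norm (X n)"
    by (simp add: S algebra_simps)
  also have "\<dots> \<le> 1 / l * (2 * S) * norm (X n)"
    using \<open>1 \<le> S\<close> l by (intro mult_right_mono mult_left_mono) auto
  finally show ?thesis
    using z by (simp add: S_def Y_def X_def Z_def mult_ac)
qed

text \<open>The gap is required for every window of factors, since the orbit estimates are restarted
  at intermediate times.\<close>

definition dominated_seq :: "real \<Rightarrow> real \<Rightarrow> real \<Rightarrow> nat \<Rightarrow> (nat \<Rightarrow> real^2^2) \<Rightarrow> bool" where
  "dominated_seq l C \<tau> N G \<longleftrightarrow>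
     (\<forall>k<N. \<alpha>\<^sub>1 (G k) \<le> 1 \<and> l \<le> \<alpha>\<^sub>2 (G k)) \<and>
     (\<forall>a n. a + n \<le> N \<longrightarrow> \<alpha>\<^sub>2 (mat_prod G a n) \<le> C * \<tau> ^ n * \<alpha>\<^sub>1 (mat_prod G a n))"

text \<open>For a unit vector \<open>x\<close> this is the derivative of the projective action at
  the direction of \<open>x\<close>: the transversal scaling, determinant over norm, divided by the
  scaling along the orbit.\<close>

definition orbit_ratio :: "(nat \<Rightarrow> real^2^2) \<Rightarrow> real^2 \<Rightarrow> nat \<Rightarrow> real" where
  "orbit_ratio G x k = \<bar>det (mat_prod G 0 k)\<bar> / (norm (mat_prod G 0 k *v x))\<^sup>2"

lemma det_bounds_of_\<alpha>:
  assumes "\<alpha>\<^sub>1 M \<le> 1" "l \<le> \<alpha>\<^sub>2 M" "0 < l"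
  shows "l\<^sup>2 \<le> \<bar>det M\<bar>" "\<bar>det M\<bar> \<le> 1"
proof -
  have "l \<le> \<alpha>\<^sub>1 M" using assms(2) \<alpha>\<^sub>2_le_\<alpha>\<^sub>1[of M] by simp
  then show "l\<^sup>2 \<le> \<bar>det M\<bar>"
    unfolding \<alpha>\<^sub>1_mult_\<alpha>\<^sub>2[symmetric] power2_eq_square using assms by (intro mult_mono) auto
  show "\<bar>det M\<bar> \<le> 1"
    unfolding \<alpha>\<^sub>1_mult_\<alpha>\<^sub>2[symmetric] using assms \<alpha>\<^sub>2_le_\<alpha>\<^sub>1[of M] by (intro mult_le_one) auto
qed

context
  fixes l C \<tau> :: real and N :: nat and G :: "nat \<Rightarrow> real^2^2"
  assumes dom: "dominated_seq l C \<tau> N G" and l: "0 < l" "l \<le> 1" and C: "0 < C" and \<tau>: "0 < \<tau>" "\<tau> < 1"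
begin

lemma G_bounds: "k < N \<Longrightarrow> \<alpha>\<^sub>1 (G k) \<le> 1" "k < N \<Longrightarrow> l \<le> \<alpha>\<^sub>2 (G k)"
  using dom by (auto simp: dominated_seq_def)

lemma det_mat_prod_nz: "a + n \<le> N \<Longrightarrow> det (mat_prod G a n) \<noteq> 0"
proof (induction n)
  case (Suc n)
  have "l\<^sup>2 \<le> \<bar>det (G (a + n))\<bar>"
    using Suc.prems G_bounds[of "a + n"] l by (intro det_bounds_of_\<alpha>) auto
  then have "det (G (a + n)) \<noteq> 0" using l by auto
  then show ?case using Suc by (simp add: det_mul)
qed simp

lemma orbit_nz: "k \<le> N \<Longrightarrow> x \<noteq> 0 \<Longrightarrow> norm (mat_prod G 0 k *v x) > 0"
  using det_mat_prod_nz[of 0 k] \<alpha>\<^sub>2_pos[of "mat_prod G 0 k"] \<alpha>_bounds(2)[of "mat_prod G 0 k" x]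
  by (smt (verit, best) add_0 mult_pos_pos zero_less_norm_iff)

lemma orbit_ratio_pos: "k \<le> N \<Longrightarrow> x \<noteq> 0 \<Longrightarrow> orbit_ratio G x k > 0"
  using det_mat_prod_nz[of 0 k] orbit_nz[of k x] by (simp add: orbit_ratio_def)

text \<open>The preceding estimate restarted at time \<open>a\<close>. The ratio is a cocycle, so
  its values relative to time \<open>a\<close> are the quotients
  \<open>orbit_ratio G x k / orbit_ratio G x a\<close>.\<close>

lemma norm_le_orbit_ratio:
  assumes "a \<le> b" "b \<le> N" "x \<noteq> 0"
  shows "\<alpha>\<^sub>1 (mat_prod G a (b - a)) * norm (mat_prod G 0 a *v x) * orbit_ratio G x a
      \<le> 2 / l * norm (mat_prod G 0 b *v x) * (\<Sum>k=a..b. orbit_ratio G x k)"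
proof -
  let ?xa = "mat_prod G 0 a *v x"
  have nz: "0 < orbit_ratio G x a" "0 < norm ?xa"
    using assms orbit_ratio_pos orbit_nz by auto
  have comp: "mat_prod G a k *v ?xa = mat_prod G 0 (a + k) *v x" for k
    by (simp add: mat_prod_add matrix_vector_mul_assoc)
  have "\<bar>det (mat_prod G a k)\<bar> * (norm ?xa)\<^sup>2 / (norm (mat_prod G a k *v ?xa))\<^sup>2
      = orbit_ratio G x (a + k) / orbit_ratio G x a" if "a + k \<le> N" for k
    unfolding comp using det_mat_prod_nz[of 0 a] assms nz
    by (simp add: orbit_ratio_def mat_prod_add det_mul abs_mult field_simps)
  then have "(\<Sum>k=0..b - a. \<bar>det (mat_prod G a k)\<bar> * (norm ?xa)\<^sup>2 / (norm (mat_prod G a k *v ?xa))\<^sup>2)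
      = (\<Sum>k=0..b - a. orbit_ratio G x (a + k) / orbit_ratio G x a)"
    using assms by (intro sum.cong) auto
  also have "\<dots> = (\<Sum>k=a..b. orbit_ratio G x k / orbit_ratio G x a)"
    by (rule sum.reindex_bij_witness[of _ "\<lambda>k. k - a" "\<lambda>k. a + k"]) (use assms in auto)
  finally have sum: "(\<Sum>k=0..b - a. \<bar>det (mat_prod G a k)\<bar> * (norm ?xa)\<^sup>2 / (norm (mat_prod G a k *v ?xa))\<^sup>2)
      = (\<Sum>k=a..b. orbit_ratio G x k) / orbit_ratio G x a"
    by (simp add: sum_divide_distrib)
  have "\<alpha>\<^sub>1 (mat_prod G a (b - a)) * norm ?xa \<le> 2 / l * norm (mat_prod G a (b - a) *v ?xa) *
      ((\<Sum>k=a..b. orbit_ratio G x k) / orbit_ratio G x a)"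
    unfolding sum[symmetric]
    by (rule norm_le_along_orbit) (use G_bounds assms l nz in auto)
  then have "\<alpha>\<^sub>1 (mat_prod G a (b - a)) * norm ?xa * orbit_ratio G x a
      \<le> (2 / l * norm (mat_prod G a (b - a) *v ?xa) * ((\<Sum>k=a..b. orbit_ratio G x k) / orbit_ratio G x a))
        * orbit_ratio G x a"
    using nz by (intro mult_right_mono) auto
  then show ?thesis
    using nz assms by (simp add: comp)
qed

text \<open>Steps are bounded since the singular values of each factor lie between \<open>l\<close>
  and 1. For a window with product \<open>P\<close>, the cocycle identity links the two end values
  through \<open>det P\<close>, which domination bounds by
  \<open>C * \<tau> ^ n * (\<alpha>\<^sub>1 P)\<^sup>2\<close>. The orbit estimate for the norm of
  \<open>P\<close> contributes \<open>2 / l\<close>, whose square explains the constant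
  \<open>l\<^sup>2 / (4 * C)\<close>.\<close>

lemma orbit_ratio_valley_free:
  assumes x: "x \<noteq> 0"
  shows "valley_free (1 / l\<^sup>2) (l\<^sup>2 / (4 * C)) \<tau> N (orbit_ratio G x)"
  unfolding valley_free_def
proof (intro conjI allI impI)
  fix k assume k: "k \<le> N"
  show "0 < orbit_ratio G x k" by (rule orbit_ratio_pos[OF k x])
next
  fix k assume k: "k < N"
  let ?v = "mat_prod G 0 k *v x"
  have v: "norm ?v > 0" using orbit_nz k x by simp
  have b: "\<alpha>\<^sub>1 (G k) \<le> 1" "l \<le> \<alpha>\<^sub>2 (G k)" using G_bounds k by auto
  have d: "l\<^sup>2 \<le> \<bar>det (G k)\<bar>" "\<bar>det (G k)\<bar> \<le> 1" using det_bounds_of_\<alpha>[OF b] l by auto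
  have lo: "l * norm ?v \<le> norm (G k *v ?v)"
    using \<alpha>_bounds(2)[of "G k" ?v] mult_right_mono[OF b(2), of "norm ?v"] by simp
  have hi: "norm (G k *v ?v) \<le> norm ?v"
    using \<alpha>_bounds(1)[of "G k" ?v] mult_right_mono[OF b(1), of "norm ?v"] by simp
  have w: "norm (G k *v ?v) > 0" using lo v l by (smt (verit) mult_pos_pos)
  have lo2: "l\<^sup>2 * (norm ?v)\<^sup>2 \<le> (norm (G k *v ?v))\<^sup>2"
    using power_mono[OF lo, of 2] l by (simp add: power_mult_distrib)
  have hi2: "(norm (G k *v ?v))\<^sup>2 \<le> (norm ?v)\<^sup>2"
    using power_mono[OF hi, of 2] by simp
  have Suc: "orbit_ratio G x (Suc k) = \<bar>det (G k)\<bar> * \<bar>det (mat_prod G 0 k)\<bar> / (norm (G k *v ?v))\<^sup>2"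
    by (simp add: orbit_ratio_def det_mul abs_mult matrix_vector_mul_assoc)
  let ?D = "\<bar>det (mat_prod G 0 k)\<bar>"
  have "?D * (l\<^sup>2 * (norm (G k *v ?v))\<^sup>2) \<le> ?D * (\<bar>det (G k)\<bar> * (norm ?v)\<^sup>2)"
    using d hi2 by (intro mult_left_mono mult_mono) auto
  then show "orbit_ratio G x k \<le> 1 / l\<^sup>2 * orbit_ratio G x (Suc k)"
    unfolding Suc using v w l by (simp add: orbit_ratio_def field_simps)
  have "(\<bar>det (G k)\<bar> * ?D) * (l\<^sup>2 * (norm ?v)\<^sup>2) \<le> (1 * ?D) * (norm (G k *v ?v))\<^sup>2"
    using d lo2 by (intro mult_mono) auto
  then show "orbit_ratio G x (Suc k) \<le> 1 / l\<^sup>2 * orbit_ratio G x k"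
    unfolding Suc using v w l by (simp add: orbit_ratio_def field_simps)
next
  fix a b assume ab: "a \<le> b" "b \<le> N"
  define P where "P = mat_prod G a (b - a)"
  define u v ya yb S t where "u = norm (mat_prod G 0 a *v x)" and "v = norm (mat_prod G 0 b *v x)"
    and "ya = orbit_ratio G x a" and "yb = orbit_ratio G x b"
    and "S = (\<Sum>k=a..b. orbit_ratio G x k)" and "t = \<tau> ^ (b - a)"
  have pos: "0 < u" "0 < v" "0 < ya" "0 < yb" "0 < t"
    using ab orbit_nz orbit_ratio_pos x \<tau> by (auto simp: u_def v_def ya_def yb_def t_def)
  have S: "0 \<le> S" unfolding S_def using ab x by (intro sum_nonneg) (simp add: less_imp_le orbit_ratio_pos)
  have det: "\<bar>det P\<bar> * (ya * u\<^sup>2) = yb * v\<^sup>2"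
  proof -
    have "mat_prod G 0 b = P ** mat_prod G 0 a"
      using mat_prod_add[of G 0 a "b - a"] ab by (simp add: P_def)
    then show ?thesis
      using pos by (simp add: ya_def yb_def orbit_ratio_def u_def v_def det_mul abs_mult)
  qed
  have "\<alpha>\<^sub>2 P \<le> C * t * \<alpha>\<^sub>1 P"
    using dom ab by (simp add: dominated_seq_def P_def t_def)
  then have dP: "\<bar>det P\<bar> \<le> C * t * (\<alpha>\<^sub>1 P)\<^sup>2"
    using mult_left_mono[OF _ \<alpha>\<^sub>1_nonneg[of P]]
    by (fastforce simp: \<alpha>\<^sub>1_mult_\<alpha>\<^sub>2[symmetric] power2_eq_square mult_ac)
  have nb: "\<alpha>\<^sub>1 P * u * ya \<le> 2 / l * v * S"
    using norm_le_orbit_ratio[OF ab x] by (simp add: P_def u_def v_def ya_def S_def)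
  have "(yb * ya) * v\<^sup>2 = (\<bar>det P\<bar> * u\<^sup>2) * ya\<^sup>2"
    using det by (simp add: power2_eq_square mult_ac)
  also have "\<dots> \<le> (C * t * (\<alpha>\<^sub>1 P)\<^sup>2 * u\<^sup>2) * ya\<^sup>2"
    using dP by (intro mult_right_mono) auto
  also have "\<dots> = C * t * (\<alpha>\<^sub>1 P * u * ya)\<^sup>2"
    by (simp add: power_mult_distrib)
  also have "\<dots> \<le> C * t * (2 / l * v * S)\<^sup>2"
    using nb C pos \<alpha>\<^sub>1_nonneg[of P] by (intro mult_left_mono power_mono) auto
  also have "\<dots> = (C * t * (2 / l * S)\<^sup>2) * v\<^sup>2"
    by (simp add: power_mult_distrib power_divide)
  finally have "yb * ya \<le> C * t * (2 / l * S)\<^sup>2"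
    using pos by simp
  then show "l\<^sup>2 / (4 * C) * (orbit_ratio G x a * orbit_ratio G x b)
      \<le> \<tau> ^ (b - a) * (\<Sum>k = a..b. orbit_ratio G x k)\<^sup>2"
    using l C by (simp add: ya_def yb_def t_def S_def field_simps power_mult_distrib power_divide)
qed

end

text \<open>The orbit of the most expanded vector of the whole product realizes the norm of both factors up
  to a constant. The orbit of the most contracted vector has ratio at least \<open>1\<close> at both ends, hence
  no valley in between, and the product of the two ratios is at most \<open>1\<close>.\<close>

lemma dominated_seq_mult:
  fixes l C \<tau> :: real
  assumes l: "0 < l" "l \<le> 1" and C: "0 < C" and \<tau>: "0 < \<tau>" "\<tau> < 1"
  obtains K where "0 < K" "\<And>N G m. dominated_seq l C \<tau> N G \<Longrightarrow> m \<le> N \<Longrightarrow>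
      \<alpha>\<^sub>1 (mat_prod G m (N - m)) * \<alpha>\<^sub>1 (mat_prod G 0 m) \<le> K * \<alpha>\<^sub>1 (mat_prod G 0 N)"
proof -
  have B: "1 \<le> 1 / l\<^sup>2" and c: "0 < l\<^sup>2 / (4 * C)"
    using l C by (auto simp: power_le_one)
  obtain H where H: "H \<ge> 1" "\<And>N y i m j u. valley_free (1 / l\<^sup>2) (l\<^sup>2 / (4 * C)) \<tau> N y \<Longrightarrow>
      i \<le> m \<Longrightarrow> m \<le> j \<Longrightarrow> j \<le> N \<Longrightarrow> 0 < u \<Longrightarrow> u \<le> y i \<Longrightarrow> u \<le> y j \<Longrightarrow> u \<le> H * y m"
    using valley_bound[OF B c \<tau>] by blast
  obtain S where S: "0 < S" "\<And>N y m. valley_free (1 / l\<^sup>2) (l\<^sup>2 / (4 * C)) \<tau> N y \<Longrightarrow>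
      (\<And>k. k \<le> N \<Longrightarrow> y k \<le> H * y 0) \<Longrightarrow> m \<le> N \<Longrightarrow> (\<Sum>k=m..N. y k) \<le> S * y m"
    using valley_free_tail[OF B c \<tau> H(1)] by blast
  have main: "\<alpha>\<^sub>1 (mat_prod G m (N - m)) * \<alpha>\<^sub>1 (mat_prod G 0 m) \<le> (2 / l * S)\<^sup>2 * \<alpha>\<^sub>1 (mat_prod G 0 N)"
    if dom: "dominated_seq l C \<tau> N G" and m: "m \<le> N" for N G m
  proof -
    obtain e1 e2 where e: "norm e1 = 1" "norm e2 = 1" "e1 \<bullet> e2 = 0"
      "norm (mat_prod G 0 N *v e1) = \<alpha>\<^sub>1 (mat_prod G 0 N)"
      "norm (mat_prod G 0 N *v e2) = \<alpha>\<^sub>2 (mat_prod G 0 N)"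
      by (rule singular_frame)
    then have nz: "e1 \<noteq> 0" "e2 \<noteq> 0" by auto
    note facts = dom l C \<tau>
    define y z where "y = orbit_ratio G e1" and "z = orbit_ratio G e2"
    have vy: "valley_free (1 / l\<^sup>2) (l\<^sup>2 / (4 * C)) \<tau> N y" and vz: "valley_free (1 / l\<^sup>2) (l\<^sup>2 / (4 * C)) \<tau> N z"
      unfolding y_def z_def by (intro orbit_ratio_valley_free[OF facts] nz)+
    have y0: "y 0 = 1" and z0: "z 0 = 1"
      using e by (simp_all add: y_def z_def orbit_ratio_def)
    have ypos: "0 < y k" if "k \<le> N" for k
      unfolding y_def by (rule orbit_ratio_pos[OF facts that nz(1)])
    have "0 < \<alpha>\<^sub>2 (mat_prod G 0 N)"
      using orbit_nz[OF facts, of N e2] nz e by simp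
    then have zN: "1 \<le> z N"
      using \<alpha>\<^sub>2_le_\<alpha>\<^sub>1[of "mat_prod G 0 N"]
      by (simp add: z_def orbit_ratio_def e \<alpha>\<^sub>1_mult_\<alpha>\<^sub>2[symmetric] power2_eq_square)
    \<comment> \<open>A frame of area 1 is mapped to one whose area is the absolute determinant, and
      this is at most the product of the two lengths.\<close>
    have yz: "y k * z k \<le> 1" if k: "k \<le> N" for k
    proof -
      let ?u = "mat_prod G 0 k *v e1" let ?v = "mat_prod G 0 k *v e2"
      have "(wedge e1 e2)\<^sup>2 = 1" using wedge_sq[of e1 e2] e by simp
      then have "\<bar>wedge e1 e2\<bar> = 1" by (simp add: abs_square_eq_1)
      then have "\<bar>det (mat_prod G 0 k)\<bar> \<le> norm ?u * norm ?v"
        using abs_wedge_le[of ?u ?v] by (simp add: wedge_matrix abs_mult)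
      then have "(\<bar>det (mat_prod G 0 k)\<bar>)\<^sup>2 \<le> (norm ?u * norm ?v)\<^sup>2"
        by (rule power_mono) simp
      moreover have "0 < norm ?u" "0 < norm ?v"
        using orbit_nz[OF facts k] nz by auto
      ultimately show ?thesis
        by (simp add: y_def z_def orbit_ratio_def power2_eq_square mult_ac)
    qed
    \<comment> \<open>As \<open>z k\<close> is at least \<open>1 / H\<close>, the sequence
      \<open>y\<close> never exceeds \<open>H\<close> times its initial value 1, which is what the
      tail estimate asks for.\<close>
    have yH: "y k \<le> H * y 0" if k: "k \<le> N" for k
    proof -
      have "1 \<le> H * z k"
        by (rule H(2)[OF vz, of 0 k N]) (use k z0 zN in auto)
      then have "y k \<le> H * z k * y k"
        using ypos[OF k] by simp
      also have "\<dots> = H * (y k * z k)" by simp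
      also have "\<dots> \<le> H * 1" using H yz[OF k] by (intro mult_left_mono) auto
      finally show ?thesis by (simp add: y0)
    qed
    let ?xm = "norm (mat_prod G 0 m *v e1)"
    have xm: "?xm > 0" by (rule orbit_nz[OF facts m nz(1)])
    \<comment> \<open>The sum from 0 shows that \<open>e1\<close> realizes the norm of the product
      up to time \<open>m\<close> within a constant; the sum from \<open>m\<close> does the same for
      the remaining product on the image of \<open>e1\<close>.\<close>
    have "\<alpha>\<^sub>1 (mat_prod G 0 m) \<le> 2 / l * ?xm * (\<Sum>k=0..m. y k)"
      using norm_le_orbit_ratio[OF facts, of 0 m e1] m e nz y0 by (simp add: y_def)
    also have "\<dots> \<le> 2 / l * ?xm * (\<Sum>k=0..N. y k)"
      using m l ypos by (intro mult_left_mono sum_mono2) (auto intro: less_imp_le)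
    also have "\<dots> \<le> 2 / l * ?xm * S"
      using S(2)[OF vy yH, of 0] y0 l by (intro mult_left_mono) auto
    finally have 1: "\<alpha>\<^sub>1 (mat_prod G 0 m) \<le> 2 / l * S * ?xm" by (simp add: mult_ac)
    have "(\<alpha>\<^sub>1 (mat_prod G m (N - m)) * ?xm) * y m \<le> 2 / l * \<alpha>\<^sub>1 (mat_prod G 0 N) * (\<Sum>k=m..N. y k)"
      using norm_le_orbit_ratio[OF facts m order_refl nz(1)] by (simp add: y_def e)
    also have "\<dots> \<le> 2 / l * \<alpha>\<^sub>1 (mat_prod G 0 N) * (S * y m)"
      using S(2)[OF vy yH m] l \<alpha>\<^sub>1_nonneg by (intro mult_left_mono) auto
    finally have "(\<alpha>\<^sub>1 (mat_prod G m (N - m)) * ?xm) * y m \<le> (2 / l * S * \<alpha>\<^sub>1 (mat_prod G 0 N)) * y m"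
      by (simp add: mult_ac)
    then have 2: "\<alpha>\<^sub>1 (mat_prod G m (N - m)) * ?xm \<le> 2 / l * S * \<alpha>\<^sub>1 (mat_prod G 0 N)"
      by (rule mult_right_le_imp_le) (rule ypos[OF m])
    have "\<alpha>\<^sub>1 (mat_prod G m (N - m)) * \<alpha>\<^sub>1 (mat_prod G 0 m)
        \<le> \<alpha>\<^sub>1 (mat_prod G m (N - m)) * (2 / l * S * ?xm)"
      by (intro mult_left_mono 1 \<alpha>\<^sub>1_nonneg)
    also have "\<dots> = 2 / l * S * (\<alpha>\<^sub>1 (mat_prod G m (N - m)) * ?xm)" by simp
    also have "\<dots> \<le> 2 / l * S * (2 / l * S * \<alpha>\<^sub>1 (mat_prod G 0 N))"
      using 2 l S by (intro mult_left_mono) auto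
    finally show ?thesis by (simp add: power2_eq_square mult_ac)
  qed
  show thesis
    by (rule that[of "(2 / l * S)\<^sup>2"]) (use S l main in auto)
qed

section \<open>From sequences of matrices to words\<close>

lemma mat_word_Nil [simp]: "mat_word A [] = mat 1"
  and mat_word_Cons [simp]: "mat_word A (i # w) = A i ** mat_word A w"
  by (simp_all add: mat_word_def)

lemma mat_word_append: "mat_word A (u @ v) = mat_word A u ** mat_word A v"
  by (induction u) (simp_all add: matrix_mul_assoc)

text \<open>\<open>mat_prod\<close> puts new factors on the left, so that it describes forward
  orbits, whereas appended letters of a word act on the right; hence the reversal.\<close>

lemma mat_prod_eq_mat_word:
  assumes "a + n \<le> length w"
  shows "mat_prod (\<lambda>k. A (w ! k)) a n = mat_word A (rev (take n (drop a w)))"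
  using assms
proof (induction n)
  case (Suc n)
  then have "take (Suc n) (drop a w) = take n (drop a w) @ [w ! (a + n)]"
    by (simp add: take_Suc_conv_app_nth)
  then show ?case using Suc by simp
qed simp

text \<open>The opposite inequality holds with constant 1, by submultiplicativity of the
  norm.\<close>

definition almost_mult :: "'i set \<Rightarrow> ('i \<Rightarrow> real^2^2) \<Rightarrow> real \<Rightarrow> bool" where
  "almost_mult I A K \<longleftrightarrow> (\<forall>u\<in>lists I. \<forall>v\<in>lists I.
     \<alpha>\<^sub>1 (mat_word A u) * \<alpha>\<^sub>1 (mat_word A v) \<le> K * \<alpha>\<^sub>1 (mat_word A (u @ v)))"

lemma finite_\<alpha>\<^sub>2_lower_bound:
  assumes "finite I" "\<And>i. i \<in> I \<Longrightarrow> det (A i) \<noteq> 0"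
  obtains l where "0 < l" "l \<le> 1" "\<And>i. i \<in> I \<Longrightarrow> l \<le> \<alpha>\<^sub>2 (A i)"
proof -
  \<comment> \<open>The inserted 1 gives \<open>l \<le> 1\<close> and covers an empty index
    set.\<close>
  define l where "l = Min (insert 1 ((\<lambda>i. \<alpha>\<^sub>2 (A i)) ` I))"
  have "0 < l" unfolding l_def using assms by (subst Min_gr_iff) (auto intro: \<alpha>\<^sub>2_pos)
  moreover have "l \<le> 1" "\<And>i. i \<in> I \<Longrightarrow> l \<le> \<alpha>\<^sub>2 (A i)"
    unfolding l_def using assms by (auto intro!: Min_le)
  ultimately show thesis using that by blast
qed

lemma dominated_almost_mult:
  assumes "finite I" "\<And>i. i \<in> I \<Longrightarrow> det (A i) \<noteq> 0" "\<And>i. i \<in> I \<Longrightarrow> \<alpha>\<^sub>1 (A i) \<le> 1" "dominated I A"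
  obtains K where "1 \<le> K" "almost_mult I A K"
proof -
  obtain C \<tau> where C: "0 < C" and \<tau>: "0 < \<tau>" "\<tau> < 1"
    and dom: "\<And>w. w \<in> lists I \<Longrightarrow> \<alpha>\<^sub>2 (mat_word A w) \<le> C * \<tau> ^ length w * \<alpha>\<^sub>1 (mat_word A w)"
    using assms(4) by (auto simp: dominated_def)
  obtain l where l: "0 < l" "l \<le> 1" "\<And>i. i \<in> I \<Longrightarrow> l \<le> \<alpha>\<^sub>2 (A i)"
    using finite_\<alpha>\<^sub>2_lower_bound[where A = A, OF assms(1,2)] by blast
  obtain K where K: "0 < K" "\<And>N G m. dominated_seq l C \<tau> N G \<Longrightarrow> m \<le> N \<Longrightarrow>
      \<alpha>\<^sub>1 (mat_prod G m (N - m)) * \<alpha>\<^sub>1 (mat_prod G 0 m) \<le> K * \<alpha>\<^sub>1 (mat_prod G 0 N)"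
    using dominated_seq_mult[OF l(1,2) C \<tau>] by blast
  have "\<alpha>\<^sub>1 (mat_word A u) * \<alpha>\<^sub>1 (mat_word A v) \<le> K * \<alpha>\<^sub>1 (mat_word A (u @ v))"
    if uv: "u \<in> lists I" "v \<in> lists I" for u v
  proof -
    \<comment> \<open>After reversal the letters of \<open>v\<close> come first, so the product is
      cut at \<open>length v\<close>.\<close>
    define w where "w = rev (u @ v)"
    have w: "w \<in> lists I" using uv by (auto simp: w_def)
    have sub: "rev (take n (drop a w)) \<in> lists I" for a n
      using w set_take_subset[of n "drop a w"] set_drop_subset[of a w] by (auto simp: in_lists_conv_set)
    have "dominated_seq l C \<tau> (length w) (\<lambda>k. A (w ! k))"
      unfolding dominated_seq_def
    proof (intro conjI allI impI)
      fix k assume "k < length w"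
      then have "w ! k \<in> I" using w by (auto simp: in_lists_conv_set)
      then show "\<alpha>\<^sub>1 (A (w ! k)) \<le> 1" "l \<le> \<alpha>\<^sub>2 (A (w ! k))" using assms(3) l by auto
    next
      fix a n assume an: "a + n \<le> length w"
      show "\<alpha>\<^sub>2 (mat_prod (\<lambda>k. A (w ! k)) a n) \<le> C * \<tau> ^ n * \<alpha>\<^sub>1 (mat_prod (\<lambda>k. A (w ! k)) a n)"
        using dom[OF sub[of n a]] an by (simp add: mat_prod_eq_mat_word[OF an])
    qed
    from K(2)[OF this, of "length v"] show ?thesis
      by (simp add: mat_prod_eq_mat_word) (simp add: w_def)
  qed
  then have "almost_mult I A (max 1 K)"
    unfolding almost_mult_def using \<alpha>\<^sub>1_nonneg
    by (meson max.cobounded2 mult_right_mono order_trans)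
  then show thesis using that[of "max 1 K"] by simp
qed

section \<open>The critical exponent\<close>

definition words :: "'i set \<Rightarrow> nat \<Rightarrow> 'i list set" where
  "words I n = {w. w \<in> lists I \<and> length w = n}"

lemma words_0 [simp]: "words I 0 = {[]}"
  by (auto simp: words_def)

lemma finite_words: "finite I \<Longrightarrow> finite (words I n)"
  using finite_lists_length_eq[of I n] by (auto simp: words_def lists_eq_set)

lemma card_words: "finite I \<Longrightarrow> card (words I n) = card I ^ n"
  using card_lists_length_eq[of I n] by (auto simp: words_def lists_eq_set)

lemma words_in_lists: "w \<in> words I n \<Longrightarrow> w \<in> lists I"
  by (simp add: words_def)

lemma words_append: "u \<in> words I m \<Longrightarrow> v \<in> words I n \<Longrightarrow> u @ v \<in> words I (m + n)"
  by (simp add: words_def)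

lemma sum_words_add: "(\<Sum>w\<in>words I (m + n). f w) = (\<Sum>u\<in>words I m. \<Sum>v\<in>words I n. f (u @ v))"
proof -
  have "(\<Sum>w\<in>words I (m + n). f w) = (\<Sum>(u, v)\<in>words I m \<times> words I n. f (u @ v))"
    by (rule sum.reindex_bij_witness[of _ "\<lambda>(u, v). u @ v" "\<lambda>w. (take m w, drop m w)"])
       (auto simp: words_def dest: in_set_takeD in_set_dropD)
  then show ?thesis by (simp add: sum.cartesian_product)
qed

text \<open>The sum of the first \<open>n + m\<close> terms is at most the sum of the first
  \<open>n\<close> terms plus \<theta> times itself, which bounds all partial sums at once.\<close>

lemma summable_of_contracting_shift:
  fixes f :: "nat \<Rightarrow> real"
  assumes "\<And>k. 0 \<le> f k" "\<And>k. f (k + n) \<le> \<theta> * f k" "0 \<le> \<theta>" "\<theta> < 1"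
  shows "summable f"
proof (rule summableI_nonneg_bounded)
  fix m
  have mono: "(\<Sum>k<m. f k) \<le> (\<Sum>k<n + m. f k)"
    using assms(1) by (intro sum_mono2) auto
  have "(\<Sum>k<n + m. f k) = (\<Sum>k<n. f k) + (\<Sum>k<m. f (k + n))"
    using sum.atLeastLessThan_concat[of 0 n "n + m" f] sum.shift_bounds_nat_ivl[of f 0 n m]
    by (simp add: lessThan_atLeast0 add.commute)
  also have "\<dots> \<le> (\<Sum>k<n. f k) + \<theta> * (\<Sum>k<m. f k)"
    unfolding sum_distrib_left using assms(2) by (intro add_mono sum_mono) auto
  also have "\<dots> \<le> (\<Sum>k<n. f k) + \<theta> * (\<Sum>k<n + m. f k)"
    using mono assms(3) by (intro add_mono mult_left_mono) auto
  finally have "(\<Sum>k<n + m. f k) * (1 - \<theta>) \<le> (\<Sum>k<n. f k)"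
    by (simp add: algebra_simps)
  then have "(\<Sum>k<n + m. f k) \<le> (\<Sum>k<n. f k) / (1 - \<theta>)"
    using assms(4) by (simp add: field_simps)
  with mono show "(\<Sum>k<m. f k) \<le> (\<Sum>k<n. f k) / (1 - \<theta>)" by simp
qed (use assms in auto)

locale almost_mult_system =
  fixes I :: "'i set" and A :: "'i \<Rightarrow> real^2^2" and K l \<rho> :: real
  assumes fin: "finite I" and almost_mult: "almost_mult I A K" and K: "1 \<le> K"
    and l: "0 < l" "l \<le> 1" "\<And>i. i \<in> I \<Longrightarrow> l \<le> \<alpha>\<^sub>2 (A i)"
    and \<rho>: "0 < \<rho>" "\<rho> < 1" "\<And>i. i \<in> I \<Longrightarrow> \<alpha>\<^sub>1 (A i) \<le> \<rho>"
begin

abbreviation a1 :: "'i list \<Rightarrow> real" where "a1 w \<equiv> \<alpha>\<^sub>1 (mat_word A w)"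
abbreviation a2 :: "'i list \<Rightarrow> real" where "a2 w \<equiv> \<alpha>\<^sub>2 (mat_word A w)"

text \<open>This agrees with \<open>sv_fun\<close> for exponents in \<open>(1, 2]\<close> but keeps
  one formula everywhere, so that the sums \<open>S s n\<close> are continuous in \<open>s\<close>
  across the value 2.\<close>

definition \<psi> :: "real \<Rightarrow> 'i list \<Rightarrow> real" where
  "\<psi> s w = a1 w * a2 w powr (s - 1)"

definition S :: "real \<Rightarrow> nat \<Rightarrow> real" where
  "S s n = (\<Sum>w\<in>words I n. \<psi> s w)"

lemma a2_pos: "w \<in> lists I \<Longrightarrow> 0 < a2 w"
proof (induction w)
  case (Cons i w)
  then have "0 < \<alpha>\<^sub>2 (A i) * a2 w" using l(3)[of i] l(1) by simp
  then show ?case using \<alpha>\<^sub>2_mult_ge[of "A i" "mat_word A w"] by simp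
qed simp

lemma a1_pos: "w \<in> lists I \<Longrightarrow> 0 < a1 w"
  using a2_pos \<alpha>\<^sub>2_le_\<alpha>\<^sub>1 by (metis less_le_trans)

lemma a1_le_power: "w \<in> lists I \<Longrightarrow> a1 w \<le> \<rho> ^ length w"
proof (induction w)
  case (Cons i w)
  have "a1 (i # w) \<le> \<alpha>\<^sub>1 (A i) * a1 w" by (simp add: \<alpha>\<^sub>1_mult_le)
  also have "\<dots> \<le> \<rho> * \<rho> ^ length w"
    using Cons \<rho> \<alpha>\<^sub>1_nonneg by (intro mult_mono) auto
  finally show ?case by simp
qed simp

lemma a1_le_1: "w \<in> lists I \<Longrightarrow> a1 w \<le> 1"
  using a1_le_power \<rho> power_le_one[of \<rho> "length w"] by fastforce

lemma a2_le_power: "w \<in> lists I \<Longrightarrow> a2 w \<le> \<rho> ^ length w"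
  using a1_le_power \<alpha>\<^sub>2_le_\<alpha>\<^sub>1 order_trans by blast

lemma a1_append_le: "a1 (u @ v) \<le> a1 u * a1 v"
  by (simp add: mat_word_append \<alpha>\<^sub>1_mult_le)

lemma a1_append_ge: "u \<in> lists I \<Longrightarrow> v \<in> lists I \<Longrightarrow> a1 u * a1 v \<le> K * a1 (u @ v)"
  using almost_mult by (auto simp: almost_mult_def)

lemma a2_append_ge: "a2 u * a2 v \<le> a2 (u @ v)"
  by (simp add: mat_word_append \<alpha>\<^sub>2_mult_ge)

text \<open>The product of the two singular values is the absolute determinant and multiplies
  exactly, so the loss \<open>K\<close> for \<open>a1\<close> reappears as the same loss, in the
  other direction, for \<open>a2\<close>.\<close>

lemma a2_append_le:
  assumes "u \<in> lists I" "v \<in> lists I"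
  shows "a2 (u @ v) \<le> K * (a2 u * a2 v)"
proof -
  have uv: "u @ v \<in> lists I" using assms by simp
  have "a1 (u @ v) * a2 (u @ v) = (a1 u * a1 v) * (a2 u * a2 v)"
    using \<alpha>\<^sub>1_mult_\<alpha>\<^sub>2[of "mat_word A u"] \<alpha>\<^sub>1_mult_\<alpha>\<^sub>2[of "mat_word A v"]
      \<alpha>\<^sub>1_mult_\<alpha>\<^sub>2[of "mat_word A (u @ v)"]
    by (simp add: mat_word_append det_mul abs_mult algebra_simps)
  also have "\<dots> \<le> (K * a1 (u @ v)) * (a2 u * a2 v)"
    using a1_append_ge[OF assms] \<alpha>\<^sub>2_nonneg by (intro mult_right_mono) auto
  finally have "a1 (u @ v) * a2 (u @ v) \<le> a1 (u @ v) * (K * (a2 u * a2 v))"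
    by (simp add: mult_ac)
  then show ?thesis using a1_pos[OF uv] by simp
qed

lemma a2_append_le_left: "u \<in> lists I \<Longrightarrow> v \<in> lists I \<Longrightarrow> a2 (u @ v) \<le> a1 u * a2 v"
  by (simp add: mat_word_append \<alpha>\<^sub>2_mult_le)

lemma \<psi>_pos: "w \<in> lists I \<Longrightarrow> 0 < \<psi> s w"
  using a1_pos[of w] a2_pos[of w] by (simp add: \<psi>_def)

lemma \<psi>_Nil [simp]: "\<psi> s [] = 1"
  by (simp add: \<psi>_def)

lemma \<psi>_append_le:
  assumes "u \<in> lists I" "v \<in> lists I" and s: "1 \<le> s" "s \<le> 2"
  shows "\<psi> s (u @ v) \<le> K * (\<psi> s u * \<psi> s v)"
proof -
  have "a2 (u @ v) powr (s - 1) \<le> (K * (a2 u * a2 v)) powr (s - 1)"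
    using assms a2_append_le by (intro powr_mono2) (auto simp: \<alpha>\<^sub>2_nonneg)
  also have "\<dots> = K powr (s - 1) * (a2 u powr (s - 1) * a2 v powr (s - 1))"
    using K by (simp add: powr_mult \<alpha>\<^sub>2_nonneg)
  also have "\<dots> \<le> K * (a2 u powr (s - 1) * a2 v powr (s - 1))"
    using K s powr_mono[of "s - 1" 1 K] by (intro mult_right_mono) auto
  finally have "\<psi> s (u @ v) \<le> (a1 u * a1 v) * (K * (a2 u powr (s - 1) * a2 v powr (s - 1)))"
    unfolding \<psi>_def using a1_append_le \<alpha>\<^sub>1_nonneg by (intro mult_mono) auto
  then show ?thesis by (simp add: \<psi>_def mult_ac)
qed

lemma \<psi>_append_ge:
  assumes "u \<in> lists I" "v \<in> lists I" and s: "1 \<le> s"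
  shows "\<psi> s u * \<psi> s v \<le> K * \<psi> s (u @ v)"
proof -
  have "\<psi> s u * \<psi> s v = (a1 u * a1 v) * (a2 u * a2 v) powr (s - 1)"
    by (simp add: \<psi>_def powr_mult \<alpha>\<^sub>2_nonneg mult_ac)
  also have "\<dots> \<le> (K * a1 (u @ v)) * a2 (u @ v) powr (s - 1)"
  proof (rule mult_mono)
    show "a1 u * a1 v \<le> K * a1 (u @ v)" by (rule a1_append_ge[OF assms(1,2)])
    show "(a2 u * a2 v) powr (s - 1) \<le> a2 (u @ v) powr (s - 1)"
      using s by (intro powr_mono2 a2_append_ge) (auto simp: \<alpha>\<^sub>2_nonneg)
  qed (use K \<alpha>\<^sub>1_nonneg in auto)
  finally show ?thesis by (simp add: \<psi>_def mult_ac)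
qed

lemma S_nonneg: "0 \<le> S s n"
  unfolding S_def by (intro sum_nonneg) (auto simp: words_def intro!: less_imp_le \<psi>_pos)

lemma S_0 [simp]: "S s 0 = 1"
  by (simp add: S_def)

lemma sum_\<psi>_extensions_le:
  assumes "u \<in> lists I" "1 \<le> s" "s \<le> 2"
  shows "(\<Sum>v\<in>words I n. \<psi> s (u @ v)) \<le> K * \<psi> s u * S s n"
  unfolding S_def sum_distrib_left
proof (rule sum_mono)
  fix v assume "v \<in> words I n"
  then show "\<psi> s (u @ v) \<le> K * \<psi> s u * \<psi> s v"
    using \<psi>_append_le[of u v s] assms by (simp add: words_def mult_ac)
qed

lemma sum_\<psi>_extensions_ge:
  assumes "u \<in> lists I" "1 \<le> s"
  shows "\<psi> s u * S s n \<le> K * (\<Sum>v\<in>words I n. \<psi> s (u @ v))"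
  unfolding S_def sum_distrib_left
proof (rule sum_mono)
  fix v assume "v \<in> words I n"
  then show "\<psi> s u * \<psi> s v \<le> K * \<psi> s (u @ v)"
    using \<psi>_append_ge[of u v s] assms by (simp add: words_def mult_ac)
qed

lemma S_add_le:
  assumes "1 \<le> s" "s \<le> 2"
  shows "S s (m + n) \<le> K * (S s m * S s n)"
proof -
  have "S s (m + n) = (\<Sum>u\<in>words I m. \<Sum>v\<in>words I n. \<psi> s (u @ v))"
    unfolding S_def by (rule sum_words_add)
  also have "\<dots> \<le> (\<Sum>u\<in>words I m. K * \<psi> s u * S s n)"
    by (intro sum_mono sum_\<psi>_extensions_le assms) (simp add: words_def)
  also have "\<dots> = K * (S s m * S s n)"
    by (simp add: S_def[of s m] sum_distrib_left sum_distrib_right mult_ac)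
  finally show ?thesis .
qed

lemma S_add_ge:
  assumes "1 \<le> s"
  shows "S s m * S s n \<le> K * S s (m + n)"
proof -
  have "S s m * S s n = (\<Sum>u\<in>words I m. \<psi> s u * S s n)"
    by (simp add: S_def[of s m] sum_distrib_right)
  also have "\<dots> \<le> (\<Sum>u\<in>words I m. K * (\<Sum>v\<in>words I n. \<psi> s (u @ v)))"
    by (intro sum_mono sum_\<psi>_extensions_ge assms) (simp add: words_def)
  also have "\<dots> = K * S s (m + n)"
    by (simp add: S_def sum_words_add sum_distrib_left)
  finally show ?thesis .
qed

section \<open>Weight sums at the critical exponent\<close>

lemma continuous_S: "continuous_on UNIV (\<lambda>s. S s n)"
  unfolding S_def \<psi>_def
  by (intro continuous_intros) (metis a2_pos words_in_lists less_irrefl)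

definition sv_summable :: "real \<Rightarrow> bool" where
  "sv_summable s \<longleftrightarrow> summable (\<lambda>n. \<Sum>w | w \<in> lists I \<and> length w = Suc n. sv_fun s (mat_word A w))"

lemma affinity_dim_eq: "affinity_dim I A = Inf {s. s > 0 \<and> sv_summable s}"
  by (simp add: affinity_dim_def sv_summable_def)

lemma sv_summable_iff:
  assumes "1 < s" "s \<le> 2"
  shows "sv_summable s \<longleftrightarrow> summable (S s)"
proof -
  have "(\<Sum>w | w \<in> lists I \<and> length w = Suc n. sv_fun s (mat_word A w)) = S s (Suc n)" for n
    using assms by (simp add: S_def words_def \<psi>_def sv_fun_def)
  then show ?thesis
    by (simp add: sv_summable_def summable_Suc_iff)
qed

text \<open>Beyond 2 the singular value function changes its formula; since
  \<open>a2 \<le> a1\<close>, it dominates \<psi> there. The case matters when the critical exponent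
  is 2 and is approached from above.\<close>

lemma summable_S:
  assumes "1 < s" "sv_summable s"
  shows "summable (S s)"
proof (cases "s \<le> 2")
  case True
  then show ?thesis using assms sv_summable_iff by blast
next
  case False
  have le: "\<psi> s w \<le> sv_fun s (mat_word A w)" if w: "w \<in> lists I" for w
  proof -
    have p: "0 < a1 w" "0 < a2 w" using a1_pos[OF w] a2_pos[OF w] by auto
    have "\<psi> s w = a1 w * a2 w powr (s / 2 + (s / 2 - 1))"
      by (simp add: \<psi>_def)
    also have "\<dots> = a1 w * (a2 w powr (s / 2) * a2 w powr (s / 2 - 1))"
      by (simp only: powr_add)
    also have "\<dots> \<le> a1 w * (a2 w powr (s / 2) * a1 w powr (s / 2 - 1))"
      using False p \<alpha>\<^sub>2_le_\<alpha>\<^sub>1 by (intro mult_left_mono powr_mono2) auto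
    also have "\<dots> = a2 w powr (s / 2) * (a1 w * a1 w powr (s / 2 - 1))"
      by simp
    also have "a1 w * a1 w powr (s / 2 - 1) = a1 w powr (s / 2)"
      using p by (simp add: powr_mult_base)
    also have "a2 w powr (s / 2) * a1 w powr (s / 2) = sv_fun s (mat_word A w)"
      using False p by (simp add: sv_fun_def \<alpha>\<^sub>1_mult_\<alpha>\<^sub>2[symmetric] powr_mult mult.commute)
    finally show ?thesis .
  qed
  have "summable (\<lambda>n. S s (Suc n))"
  proof (rule summable_comparison_test[OF _ assms(2)[unfolded sv_summable_def]], intro exI allI impI)
    fix n
    show "norm (S s (Suc n)) \<le> (\<Sum>w | w \<in> lists I \<and> length w = Suc n. sv_fun s (mat_word A w))"
      using S_nonneg[of s "Suc n"] le by (auto simp: S_def words_def intro!: sum_mono)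
  qed
  then show ?thesis by (simp add: summable_Suc_iff)
qed

lemma sv_summable_exists: "\<exists>s>0. sv_summable s"
proof -
  obtain m where m: "\<rho> ^ m < 1 / (real (card I) + 1)"
    using real_arch_pow_inv[of "1 / (real (card I) + 1)" \<rho>] \<rho> by auto
  \<comment> \<open>An exponent above 2 selects the determinant formula, which is at most
    \<open>a1 w powr s\<close>. As \<open>s\<close> exceeds \<open>m\<close>, each letter
    contributes at most \<open>\<rho> ^ m\<close>, and the series is dominated by a geometric one
    with ratio \<open>\<theta>\<close>.\<close>
  define s where "s = real m + 3"
  define \<theta> where "\<theta> = real (card I) * \<rho> ^ m"
  have \<theta>: "0 \<le> \<theta>" "\<theta> < 1"
    using m \<rho> by (auto simp: \<theta>_def field_simps)
      (smt (verit, best) zero_less_power)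
  have le: "sv_fun s (mat_word A w) \<le> (\<rho> ^ m) ^ length w" if w: "w \<in> lists I" for w
  proof -
    have p: "0 < a1 w" "0 < a2 w" using a1_pos[OF w] a2_pos[OF w] by auto
    have "sv_fun s (mat_word A w) = (a1 w * a2 w) powr (s / 2)"
      by (simp add: sv_fun_def s_def \<alpha>\<^sub>1_mult_\<alpha>\<^sub>2[symmetric])
    also have "\<dots> \<le> (a1 w * a1 w) powr (s / 2)"
      using p \<alpha>\<^sub>2_le_\<alpha>\<^sub>1 by (intro powr_mono2 mult_left_mono) (auto simp: s_def)
    also have "\<dots> = a1 w powr s"
      using p by (simp add: powr_mult powr_add[symmetric])
    also have "\<dots> \<le> a1 w powr real m"
      using p a1_le_1[OF w] by (intro powr_mono') (auto simp: s_def)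
    also have "\<dots> = a1 w ^ m" using p by (simp add: powr_realpow)
    also have "\<dots> \<le> (\<rho> ^ length w) ^ m" using a1_le_power[OF w] p by (intro power_mono) auto
    finally show ?thesis by (simp add: power_mult[symmetric] mult.commute)
  qed
  have "sv_summable s"
    unfolding sv_summable_def
  proof (rule summable_comparison_test[of _ "\<lambda>n. \<theta> ^ Suc n"], intro exI allI impI)
    fix n
    have "(\<Sum>w\<in>words I (Suc n). sv_fun s (mat_word A w)) \<le> (\<Sum>w\<in>words I (Suc n). (\<rho> ^ m) ^ Suc n)"
      using le by (intro sum_mono) (force simp: words_def)
    also have "\<dots> = \<theta> ^ Suc n"
      using fin by (simp only: sum_constant card_words \<theta>_def power_mult_distrib of_nat_power)
    finally have "(\<Sum>w\<in>words I (Suc n). sv_fun s (mat_word A w)) \<le> \<theta> ^ Suc n" .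
    moreover have "0 \<le> (\<Sum>w\<in>words I (Suc n). sv_fun s (mat_word A w))"
      by (intro sum_nonneg) (simp add: sv_fun_def \<alpha>\<^sub>1_nonneg)
    ultimately show "norm (\<Sum>w | w \<in> lists I \<and> length w = Suc n. sv_fun s (mat_word A w)) \<le> \<theta> ^ Suc n"
      by (simp add: words_def)
  qed (use \<theta> in \<open>simp only: summable_Suc_iff summable_geometric_iff, simp\<close>)
  then show ?thesis by (intro exI[of _ s]) (simp add: s_def)
qed

text \<open>If the bound failed, continuity would give an exponent slightly below the critical one
  with \<open>K * S s n < 1\<close>. Almost submultiplicativity then contracts \<open>S s\<close>
  under shifts by \<open>n\<close>, and the series would converge below the infimum of its exponents
  of convergence.\<close>

lemma S_critical_ge:
  assumes "1 < affinity_dim I A" "affinity_dim I A \<le> 2"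
  shows "1 \<le> K * S (affinity_dim I A) n"
proof (rule ccontr)
  define s0 where "s0 = affinity_dim I A"
  assume "\<not> 1 \<le> K * S (affinity_dim I A) n"
  then have "K * S s0 n < 1" by (simp add: s0_def)
  moreover have "((\<lambda>s. K * S s n) \<longlongrightarrow> K * S s0 n) (at_left s0)"
    using continuous_S[of n] by (intro tendsto_intros)
      (metis UNIV_I continuous_on_def filterlim_at_split open_UNIV at_within_open)
  ultimately have "\<forall>\<^sub>F s in at_left s0. K * S s n < 1"
    by (rule order_tendstoD(2)[rotated])
  moreover have "\<forall>\<^sub>F s in at_left s0. s \<in> {1<..<s0}"
    using assms by (intro eventually_at_leftI[of 1]) (auto simp: s0_def)
  ultimately have "\<forall>\<^sub>F s in at_left s0. K * S s n < 1 \<and> s \<in> {1<..<s0}"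
    by (rule eventually_conj)
  then obtain s where s: "K * S s n < 1" "1 < s" "s < s0"
    by (metis (no_types, lifting) eventually_happens greaterThanLessThan_iff trivial_limit_at_left_real)
  have "summable (S s)"
  proof (rule summable_of_contracting_shift[of _ n "K * S s n"])
    fix k show "S s (k + n) \<le> K * S s n * S s k"
      using S_add_le[of s k n] s assms by (simp add: s0_def mult_ac)
  qed (use S_nonneg s K in auto)
  then have "sv_summable s"
    using sv_summable_iff s assms by (simp add: s0_def)
  then have "s0 \<le> s"
    unfolding s0_def affinity_dim_eq using s by (intro cInf_lower bdd_belowI[of _ 0]) auto
  then show False using s by simp
qed

text \<open>If \<open>S\<close> exceeded \<open>K\<close>, it would do so for all nearby exponents,
  among them one where the series converges. Almost supermultiplicativity keeps
  \<open>S s (q * n) \<ge> 1\<close> for all \<open>q\<close>, a contradiction. This exponent may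
  exceed 2, so only estimates valid there are used.\<close>

lemma S_critical_le:
  assumes "1 < affinity_dim I A"
  shows "S (affinity_dim I A) n \<le> K"
proof (rule ccontr)
  define s0 where "s0 = affinity_dim I A"
  assume "\<not> S (affinity_dim I A) n \<le> K"
  then have gt: "K < S s0 n" by (simp add: s0_def)
  have "open {s. K < S s n}"
    using continuous_S[of n] by (intro open_Collect_less continuous_intros) auto
  then obtain e where e: "e > 0" "\<And>s. \<bar>s - s0\<bar> < e \<Longrightarrow> K < S s n"
    using gt by (auto simp: open_dist dist_real_def)
  have "Inf {s. s > 0 \<and> sv_summable s} < s0 + e"
    using e(1) by (simp add: s0_def affinity_dim_eq)
  then obtain s where s: "s > 0" "sv_summable s" "s < s0 + e"
    using cInf_lessD[of "{s. s > 0 \<and> sv_summable s}"] sv_summable_exists by blast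
  have "s0 \<le> s"
    unfolding s0_def affinity_dim_eq using s by (intro cInf_lower bdd_belowI[of _ 0]) auto
  then have big: "K < S s n" and s1: "1 < s"
    using e(2)[of s] s assms by (auto simp: s0_def)
  have ge: "1 \<le> S s (q * n)" for q
  proof (induction q)
    case (Suc q)
    have "K * 1 \<le> S s (q * n) * S s n"
      using Suc big K by (simp only: mult.commute[of "S s (q * n)"]) (intro mult_mono, auto)
    also have "\<dots> \<le> K * S s (Suc q * n)"
      using S_add_ge[of s "q * n" n] s1 by (simp add: add.commute)
    finally show ?case using K by simp
  qed simp
  have "n \<noteq> 0" using big K by (intro notI) simp
  have "S s \<longlonglongrightarrow> 0"
    by (intro summable_LIMSEQ_zero summable_S s s1)
  then have "(\<lambda>q. S s (q * n)) \<longlonglongrightarrow> 0"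
    using \<open>n \<noteq> 0\<close> by (rule_tac LIMSEQ_subseq_LIMSEQ[unfolded o_def]) (auto simp: strict_mono_def)
  then have "\<forall>\<^sub>F q in sequentially. S s (q * n) < 1"
    by (intro order_tendstoD) auto
  then show False using ge by (auto simp: eventually_sequentially not_less[symmetric])
qed

end

section \<open>Efficient covers of cylinders\<close>

text \<open>Lists let costs add up under unions even if covering sets coincide; padded with empty
  sets, a finite list is an admissible sequence for the content.\<close>

definition cheap_cover :: "real \<Rightarrow> real \<Rightarrow> 'a::metric_space set \<Rightarrow> real \<Rightarrow> bool" where
  "cheap_cover \<delta> s E c \<longleftrightarrow> (\<exists>Us. E \<subseteq> \<Union>(set Us) \<and> (\<forall>V\<in>set Us. bounded V \<and> diameter V \<le> \<delta>) \<and>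
     (\<Sum>V\<leftarrow>Us. diameter V powr s) \<le> c)"

lemma cheap_cover_mono: "cheap_cover \<delta> s E c \<Longrightarrow> F \<subseteq> E \<Longrightarrow> c \<le> d \<Longrightarrow> cheap_cover \<delta> s F d"
  unfolding cheap_cover_def by (meson order_trans)

lemma cheap_cover_empty: "cheap_cover \<delta> s {} 0"
  unfolding cheap_cover_def by (intro exI[of _ "[]"]) simp

lemma cheap_cover_Un:
  assumes "cheap_cover \<delta> s E c" "cheap_cover \<delta> s F d"
  shows "cheap_cover \<delta> s (E \<union> F) (c + d)"
proof -
  obtain Us Vs where "E \<subseteq> \<Union>(set Us)" "\<forall>V\<in>set Us. bounded V \<and> diameter V \<le> \<delta>"
      "(\<Sum>V\<leftarrow>Us. diameter V powr s) \<le> c"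
      "F \<subseteq> \<Union>(set Vs)" "\<forall>V\<in>set Vs. bounded V \<and> diameter V \<le> \<delta>"
      "(\<Sum>V\<leftarrow>Vs. diameter V powr s) \<le> d"
    using assms unfolding cheap_cover_def by auto
  then show ?thesis
    unfolding cheap_cover_def by (intro exI[of _ "Us @ Vs"]) auto
qed

lemma cheap_cover_UN:
  assumes "finite J" "\<And>j. j \<in> J \<Longrightarrow> cheap_cover \<delta> s (E j) (c j)"
  shows "cheap_cover \<delta> s (\<Union>j\<in>J. E j) (\<Sum>j\<in>J. c j)"
  using assms
proof (induction J)
  case (insert j J)
  then show ?case by (simp add: cheap_cover_Un)
qed (simp add: cheap_cover_empty)

lemma cheap_cover_hausdorff_content:
  assumes "cheap_cover \<delta> s E c" "0 \<le> \<delta>" "0 < s"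
  shows "hausdorff_content s \<delta> E \<le> ennreal c"
proof -
  obtain Us where Us: "E \<subseteq> \<Union>(set Us)" "\<forall>V\<in>set Us. bounded V \<and> diameter V \<le> \<delta>"
      "(\<Sum>V\<leftarrow>Us. diameter V powr s) \<le> c"
    using assms unfolding cheap_cover_def by auto
  define U where "U n = (if n < length Us then Us ! n else {})" for n
  have "E \<subseteq> (\<Union>n. U n)"
    using Us(1) by (fastforce simp: U_def in_set_conv_nth split: if_splits)
  moreover have "bounded (U n) \<and> diameter (U n) \<le> \<delta>" for n
    using Us(2) assms(2) by (simp add: U_def)
  ultimately have "hausdorff_content s \<delta> E \<le> (\<Sum>n. diam_pow s (U n))"
    unfolding hausdorff_content_def by (intro INF_lower) auto
  also have "\<dots> = (\<Sum>n<length Us. diam_pow s (U n))"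
    by (intro suminf_finite) (auto simp: U_def diam_pow_def)
  also have "\<dots> \<le> (\<Sum>n<length Us. ennreal (diameter (Us ! n) powr s))"
    using assms(3) by (intro sum_mono) (auto simp: U_def diam_pow_def)
  also have "\<dots> = ennreal (\<Sum>n<length Us. diameter (Us ! n) powr s)"
    by simp
  also have "(\<Sum>n<length Us. diameter (Us ! n) powr s) = (\<Sum>V\<leftarrow>Us. diameter V powr s)"
    by (simp add: sum_list_sum_nth atLeast0LessThan)
  also have "ennreal \<dots> \<le> ennreal c"
    using Us(3) by (rule ennreal_leI)
  finally show ?thesis .
qed

lemma cheap_cover_cballs:
  fixes P :: "(real^2) set"
  assumes "finite P" "E \<subseteq> (\<Union>p\<in>P. cball p r)" "0 \<le> r" "2 * r \<le> \<delta>" "real (card P) \<le> N"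
  shows "cheap_cover \<delta> s E (N * (2 * r) powr s)"
proof -
  obtain xs where xs: "set xs = P" "distinct xs"
    using finite_distinct_list[OF assms(1)] by blast
  have "length xs = card P" using xs distinct_card by metis
  then have "(\<Sum>V\<leftarrow>map (\<lambda>p. cball p r) xs. diameter V powr s) = real (card P) * (2 * r) powr s"
    using assms(3) by (simp add: o_def sum_list_triv)
  also have "\<dots> \<le> N * (2 * r) powr s"
    using assms(5) by (intro mult_right_mono) auto
  finally show ?thesis
    unfolding cheap_cover_def using assms xs
    by (intro exI[of _ "map (\<lambda>p. cball p r) xs"]) auto
qed

text \<open>The critical exponent enters only through the two bounds on \<open>S\<close>: with them
  the weights of each level have total mass between \<open>1 / K\<close> and
  \<open>K\<close>.\<close>

locale planar_ifs = almost_mult_system I A K l \<rho>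
  for I :: "'i set" and A :: "'i \<Rightarrow> real^2^2" and K l \<rho> +
  fixes t :: "'i \<Rightarrow> real^2" and X :: "(real^2) set" and s :: real
  assumes attractor: "is_attractor I A t X" and diam: "0 < diameter X"
    and s: "1 < s" "s \<le> 2"
    and S_ge: "\<And>n. 1 \<le> K * S s n" and S_le: "\<And>n. S s n \<le> K"
begin

abbreviation f :: "'i list \<Rightarrow> real^2 \<Rightarrow> real^2" where "f w \<equiv> aff_word A t w"
abbreviation D :: real where "D \<equiv> diameter X"

lemma f_Nil: "f [] = id" and f_Cons: "f (i # w) = aff A t i \<circ> f w"
  by (simp_all add: aff_word_def)

lemma f_append: "f (u @ v) = f u \<circ> f v"
  by (induction u) (simp_all add: f_Nil f_Cons comp_assoc)

lemma f_diff: "f w x - f w y = mat_word A w *v (x - y)"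
proof (induction w)
  case (Cons i w)
  have "f (i # w) x - f (i # w) y = A i *v (f w x - f w y)"
    by (simp add: f_Cons aff_def matrix_vector_mult_diff_distrib)
  then show ?case by (simp add: Cons matrix_vector_mul_assoc)
qed (simp add: f_Nil)

lemma dist_f_le: "dist (f w x) (f w y) \<le> a1 w * dist x y"
  by (simp add: dist_norm f_diff \<alpha>_bounds)

lemma compact_X: "compact X" and X_ne: "X \<noteq> {}" and X_eq: "X = (\<Union>i\<in>I. aff A t i ` X)"
  using attractor by (auto simp: is_attractor_def)

lemma dist_X: "x \<in> X \<Longrightarrow> y \<in> X \<Longrightarrow> dist x y \<le> D"
  using compact_X by (simp add: compact_imp_bounded diameter_bounded_bound)

lemma X_eq_words: "X = (\<Union>w\<in>words I n. f w ` X)"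
proof (induction n)
  case (Suc n)
  have "(\<Union>w\<in>words I (Suc n). f w ` X) = (\<Union>i\<in>I. aff A t i ` (\<Union>w\<in>words I n. f w ` X))"
  proof (intro equalityI subsetI)
    fix x assume "x \<in> (\<Union>w\<in>words I (Suc n). f w ` X)"
    then obtain w y where w: "w \<in> lists I" "length w = Suc n" "y \<in> X" "x = f w y"
      by (auto simp: words_def)
    then obtain i v where "w = i # v" by (cases w) auto
    then show "x \<in> (\<Union>i\<in>I. aff A t i ` (\<Union>w\<in>words I n. f w ` X))"
      using w by (auto simp: words_def f_Cons)
  next
    fix x assume "x \<in> (\<Union>i\<in>I. aff A t i ` (\<Union>w\<in>words I n. f w ` X))"
    then obtain i w y where "i \<in> I" "w \<in> words I n" "y \<in> X" "x = aff A t i (f w y)"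
      by auto
    then show "x \<in> (\<Union>w\<in>words I (Suc n). f w ` X)"
      by (intro UN_I[of "i # w"]) (auto simp: words_def f_Cons)
  qed
  then show ?case using Suc X_eq by simp
qed (simp add: f_Nil)

lemma f_image_subset: "w \<in> lists I \<Longrightarrow> f w ` X \<subseteq> X"
  using X_eq_words[of "length w"] by (auto simp: words_def)

lemma f_image_split: "f q ` X = (\<Union>w\<in>words I n. f (q @ w) ` X)"
  by (subst X_eq_words[of n]) (simp add: image_UN f_append image_comp)

lemma f_image_append: "f (u @ v) ` X = f u ` (f v ` X)"
  by (simp add: f_append image_comp)

lemma f_image_append_subset: "v \<in> lists I \<Longrightarrow> f (u @ v) ` X \<subseteq> f u ` X"
  unfolding f_image_append by (intro image_mono f_image_subset)

text \<open>A cylinder is a rectangle of width \<open>a2 w * D\<close>, up to a constant.\<close>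

lemma cylinder_cover:
  assumes w: "w \<in> lists I" and E: "E \<subseteq> f w ` X" "\<And>p q. p \<in> E \<Longrightarrow> q \<in> E \<Longrightarrow> dist p q \<le> d"
    and d: "0 \<le> d" and r: "0 < r" "a2 w * D \<le> r"
  obtains P where "finite P" "real (card P) \<le> 3 * (d / r + 1)" "E \<subseteq> (\<Union>p\<in>P. cball p (2 * r))"
proof (cases "E = {}")
  case True
  then show ?thesis using that[of "{}"] d r by simp
next
  case False
  then obtain y where y: "y \<in> E" by blast
  obtain x where x: "x \<in> X" "y = f w x" using y E by blast
  let ?M = "mat_word A w"
  obtain e1 e2 where e: "norm e1 = 1" "norm e2 = 1" "e1 \<bullet> e2 = 0" "(?M *v e1) \<bullet> (?M *v e2) = 0"
    "norm (?M *v e1) = a1 w" "norm (?M *v e2) = a2 w"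
    by (rule singular_frame)
  define g where "g = (?M *v e1) /\<^sub>R a1 w"
  have Me1: "?M *v e1 = a1 w *\<^sub>R g" and g: "norm g = 1"
    using a1_pos[OF w] e by (simp_all add: g_def)
  \<comment> \<open>A grid of mesh \<open>r\<close> on the long axis through \<open>y\<close>, of
    half-length \<open>d\<close>. Rounding costs \<open>r\<close> and the width of the cylinder
    another \<open>r\<close>, hence the radius \<open>2 * r\<close>.\<close>
  define J where "J = {\<lfloor>- (d / r)\<rfloor>..\<lfloor>d / r\<rfloor>}"
  define P where "P = (\<lambda>k. y + (of_int k * r) *\<^sub>R g) ` J"
  have "real (card P) \<le> real (card J)"
    unfolding P_def by (intro of_nat_mono card_image_le) (simp add: J_def)
  also have "real (card J) \<le> 3 * (d / r + 1)"
  proof -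
    have "0 \<le> d / r" using d r by simp
    moreover have "real (card J) = real_of_int (\<lfloor>d / r\<rfloor> - \<lfloor>- (d / r)\<rfloor> + 1)"
      using \<open>0 \<le> d / r\<close> unfolding J_def by simp linarith
    ultimately show ?thesis by simp linarith
  qed
  finally have card: "real (card P) \<le> 3 * (d / r + 1)" .
  have "E \<subseteq> (\<Union>p\<in>P. cball p (2 * r))"
  proof
    fix p assume p: "p \<in> E"
    obtain x' where x': "x' \<in> X" "p = f w x'" using p E by blast
    define u where "u = x' - x"
    define c where "c = (u \<bullet> e1) * a1 w"
    have u: "norm u \<le> D" using dist_X[OF x'(1) x(1)] by (simp add: u_def dist_norm)
    have "p - y = ?M *v u" by (simp add: x x' u_def f_diff)
    also have "u = (u \<bullet> e1) *\<^sub>R e1 + (u \<bullet> e2) *\<^sub>R e2"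
      by (rule orthonormal_2_expand[OF e(1-3)])
    finally have py: "p - y = c *\<^sub>R g + (u \<bullet> e2) *\<^sub>R (?M *v e2)"
      by (simp add: matrix_vector_right_distrib matrix_vector_mult_scaleR Me1 c_def)
    have "g \<bullet> (?M *v e2) = 0" using e(4) by (simp add: g_def)
    then have pg: "(p - y) \<bullet> g = c"
      unfolding py using g
      by (simp add: inner_add_left inner_commute[of "?M *v e2" g] norm_eq_1)
    have "\<bar>c\<bar> \<le> norm (p - y) * norm g"
      unfolding pg[symmetric] by (rule Cauchy_Schwarz_ineq2)
    then have "\<bar>c\<bar> \<le> d"
      using E(2)[OF p y] by (simp only: g dist_norm mult_1_right)
    then have cr: "\<bar>c / r\<bar> \<le> d / r"
      unfolding abs_div_pos[OF r(1), symmetric] by (rule divide_right_mono) (use r in simp)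
    define k where "k = \<lfloor>c / r\<rfloor>"
    have "c / r \<le> d / r" "- (d / r) \<le> c / r"
      using cr unfolding abs_le_iff by linarith+
    then have k: "k \<in> J"
      unfolding J_def k_def by (simp add: floor_mono)
    have "of_int k \<le> c / r" "c / r < of_int k + 1"
      by (simp_all add: k_def)
    then have "of_int k * r \<le> c" "c \<le> of_int k * r + r"
      using r by (simp_all add: field_simps)
    then have ck: "\<bar>c - of_int k * r\<bar> \<le> r" by simp
    have "\<bar>u \<bullet> e2\<bar> \<le> D"
      using Cauchy_Schwarz_ineq2[of u e2] e u by simp
    then have "\<bar>u \<bullet> e2\<bar> * a2 w \<le> D * a2 w"
      by (intro mult_right_mono) (auto simp: \<alpha>\<^sub>2_nonneg)
    also have "\<dots> \<le> r" using r by (simp add: mult.commute)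
    finally have n2: "norm ((u \<bullet> e2) *\<^sub>R (?M *v e2)) \<le> r" by (simp add: e)
    have "p - (y + (of_int k * r) *\<^sub>R g) = (c - of_int k * r) *\<^sub>R g + (u \<bullet> e2) *\<^sub>R (?M *v e2)"
      using py by (simp add: algebra_simps)
    also have "norm \<dots> \<le> r + r"
      using ck n2 g by (intro norm_triangle_mono) auto
    finally have "p \<in> cball (y + (of_int k * r) *\<^sub>R g) (2 * r)"
      by (simp add: dist_norm norm_minus_commute)
    then show "p \<in> (\<Union>p\<in>P. cball p (2 * r))"
      using k by (auto simp: P_def)
  qed
  then show ?thesis using that[of P] card by (simp add: P_def J_def)
qed

end

section \<open>Exhausting the attractor by cheap blocks\<close>

context planar_ifs
begin

text \<open>The weight of \<open>q\<close> read off \<open>n\<close> levels further down. It is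
  exactly additive when \<open>q\<close> is split into longer words, whereas \<open>\<psi> s\<close>
  is additive only up to constants.\<close>

definition \<Phi> :: "nat \<Rightarrow> 'i list \<Rightarrow> real" where
  "\<Phi> n q = (\<Sum>v\<in>words I n. \<psi> s (q @ v))"

lemma s1: "1 \<le> s" using s by simp

lemma finite_sub_words: "B \<subseteq> words I n \<Longrightarrow> finite B"
  using finite_words[OF fin] finite_subset by blast

lemma \<Phi>_0 [simp]: "\<Phi> 0 q = \<psi> s q"
  by (simp add: \<Phi>_def)

lemma \<Phi>_add: "\<Phi> (m + n) q = (\<Sum>u\<in>words I m. \<Phi> n (q @ u))"
  by (simp add: \<Phi>_def sum_words_add)

lemma \<Phi>_ge:
  assumes "q \<in> lists I"
  shows "\<psi> s q \<le> K\<^sup>2 * \<Phi> n q"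
proof -
  have "\<psi> s q \<le> \<psi> s q * (K * S s n)"
    using S_ge[of n] \<psi>_pos[OF assms, of s] by simp
  also have "\<dots> = K * (\<psi> s q * S s n)" by simp
  also have "\<dots> \<le> K * (K * \<Phi> n q)"
    unfolding \<Phi>_def using K by (intro mult_left_mono sum_\<psi>_extensions_ge assms s1) auto
  finally show ?thesis by (simp add: power2_eq_square)
qed

lemma \<Phi>_le:
  assumes "q \<in> lists I"
  shows "\<Phi> n q \<le> K\<^sup>2 * \<psi> s q"
proof -
  have "\<Phi> n q \<le> K * \<psi> s q * S s n"
    unfolding \<Phi>_def by (intro sum_\<psi>_extensions_le assms s1 s)
  also have "\<dots> \<le> K * \<psi> s q * K"
    using S_le K \<psi>_pos[OF assms] by (intro mult_left_mono) (auto simp: less_imp_le)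
  finally show ?thesis by (simp add: power2_eq_square mult_ac)
qed

text \<open>The balls have twice the width \<open>a2 w * D\<close> as radius, and their number is of
  order \<open>d\<close> over that width. For the whole cylinder, \<open>d = a1 w * D\<close> and
  the cost is a multiple of \<open>\<psi> s w\<close>; a shorter \<open>d\<close> makes it
  cheaper.\<close>

lemma cylinder_cheap_cover:
  assumes w: "w \<in> lists I" and E: "E \<subseteq> f w ` X" "\<And>p q. p \<in> E \<Longrightarrow> q \<in> E \<Longrightarrow> dist p q \<le> d"
    and d: "a2 w * D \<le> d" and \<delta>: "4 * (a2 w * D) \<le> \<delta>"
  shows "cheap_cover \<delta> s E (6 * (4 * D) powr s / D * d * a2 w powr (s - 1))"
proof -
  define r where "r = a2 w * D"
  have r: "0 < r" using a2_pos[OF w] diam by (simp add: r_def)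
  obtain P where P: "finite P" "real (card P) \<le> 3 * (d / r + 1)" "E \<subseteq> (\<Union>p\<in>P. cball p (2 * r))"
    using cylinder_cover[OF w E, of r] r d by (auto simp: r_def)
  have "1 \<le> d / r"
    using r d by (simp add: r_def)
  then have "3 * (d / r + 1) \<le> 6 * (d / r)"
    by (simp only: distrib_left)
  then have "cheap_cover \<delta> s E (6 * (d / r) * (2 * (2 * r)) powr s)"
    using P r \<delta> by (intro cheap_cover_cballs[of P]) (auto simp: r_def)
  moreover have "(2 * (2 * r)) powr s = (4 * D) powr s * (a2 w * a2 w powr (s - 1))"
    using diam \<alpha>\<^sub>2_nonneg[of "mat_word A w"] a2_pos[OF w]
    by (simp add: r_def powr_mult[symmetric] powr_mult_base mult_ac)
  moreover have "6 * (d / r) * ((4 * D) powr s * (a2 w * a2 w powr (s - 1)))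
      = 6 * (4 * D) powr s / D * d * a2 w powr (s - 1)"
    using a2_pos[OF w] by (simp add: r_def)
  ultimately show ?thesis by simp
qed

text \<open>Cylinders ending in the block \<open>w\<close> followed by a word of \<open>B\<close> have a cover that is cheap compared to
  their weight. Almost every infinite word meets such a block, so that these covers
  exhaust \<open>X\<close>, which bounds the content from above.\<close>

context
  fixes w :: "'i list" and B :: "'i list set" and n :: nat and a :: real and z :: "real^2"
  assumes w: "w \<in> lists I" and B: "B \<subseteq> words I n" "B \<noteq> {}" and a: "a2 w * D \<le> a"
    and Ba: "\<And>v. v \<in> B \<Longrightarrow> f (w @ v) ` X \<subseteq> cball z a"
begin

definition wB :: "'i list set" where "wB = (\<lambda>v. w @ v) ` B"

definition L :: nat where "L = length w + n"

text \<open>The price per unit of weight for covering the bad blocks. The factor 12 is 6 from the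
  cylinder cover times 2 from the diameter of the ball; one \<open>K\<close> separates
  \<open>q\<close> from \<open>w\<close> in the length, the other distributes the weight of
  \<open>q @ w\<close> over \<open>B\<close>. It is small if \<open>B\<close> is heavy compared to
  \<open>a / a1 w\<close>.\<close>

definition \<epsilon> :: real where
  "\<epsilon> = 12 * (4 * D) powr s / D * K\<^sup>2 * a / (a1 w * (\<Sum>v\<in>B. \<psi> s v))"

text \<open>A lower bound for the share of weight that any cylinder gives to its bad blocks. Of the
  five factors \<open>K\<close>, two compare \<Phi> of the prefix with \<psi>, one joins prefix and
  block, and two return to \<Phi>.\<close>

definition \<eta> :: real where "\<eta> = (\<Sum>b\<in>wB. \<psi> s b) / K ^ 5"

lemma B_lists: "v \<in> B \<Longrightarrow> v \<in> lists I"
  using B words_in_lists by blast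

lemma wB_lists: "v \<in> B \<Longrightarrow> w @ v \<in> lists I"
  using w B_lists by simp

lemma finite_B: "finite B"
  using finite_sub_words B by blast

lemma wB_words: "wB \<subseteq> words I L"
  using B(1) w words_append[of w I "length w"] by (auto simp: wB_def L_def words_def[of I "length w"])

lemma sum_B_pos: "0 < (\<Sum>v\<in>B. \<psi> s v)"
  using finite_B B(2) by (intro sum_pos \<psi>_pos B_lists)

lemma a_pos: "0 < a"
  using a a2_pos[OF w] diam by (smt (verit) mult_pos_pos)

lemma \<epsilon>_pos: "0 < \<epsilon>"
  unfolding \<epsilon>_def using a_pos sum_B_pos a1_pos[OF w] diam K by simp

lemma sum_wB: "(\<Sum>b\<in>wB. g b) = (\<Sum>v\<in>B. g (w @ v))"
  unfolding wB_def by (subst sum.reindex) (auto simp: inj_on_def)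

text \<open>All these pieces lie in the single cylinder of \<open>q @ w\<close> and also in the
  image of the ball under \<open>f q\<close>. So \<open>2 * a * a1 q\<close> replaces the full
  length of the cylinder in the cost.\<close>

lemma bad_block_cover:
  assumes q: "q \<in> lists I" and \<delta>: "4 * (a2 (q @ w) * D) \<le> \<delta>"
  shows "cheap_cover \<delta> s (\<Union>b\<in>wB. f (q @ b) ` X) (\<epsilon> * (\<Sum>b\<in>wB. \<psi> s (q @ b)))"
proof -
  let ?E = "\<Union>b\<in>wB. f (q @ b) ` X"
  have qw: "q @ w \<in> lists I" using q w by simp
  have sub: "?E \<subseteq> f (q @ w) ` X"
  proof -
    have "f ((q @ w) @ v) ` X \<subseteq> f (q @ w) ` X" if "v \<in> B" for v
      by (rule f_image_append_subset[OF B_lists[OF that]])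
    then show ?thesis unfolding wB_def by (simp add: UN_least)
  qed
  have dist: "dist p p' \<le> 2 * a * a1 q" if pp: "p \<in> ?E" "p' \<in> ?E" for p p'
  proof -
    have "?E \<subseteq> f q ` cball z a"
      using Ba by (auto simp: wB_def f_image_append[of q] simp del: image_image)
    with pp obtain x x' where x: "p = f q x" "x \<in> cball z a" and x': "p' = f q x'" "x' \<in> cball z a"
      by blast
    have "dist x x' \<le> dist z x + dist z x'"
      by (metis dist_commute dist_triangle2)
    then have "dist x x' \<le> 2 * a" using x x' by simp
    then have "a1 q * dist x x' \<le> a1 q * (2 * a)"
      by (intro mult_left_mono \<alpha>\<^sub>1_nonneg)
    then show ?thesis using dist_f_le[of q x x'] x x' by (simp add: mult_ac)
  qed
  have "a2 (q @ w) * D \<le> a1 q * a2 w * D"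
    using a2_append_le_left[OF q w] diam by (intro mult_right_mono) auto
  also have "\<dots> = a1 q * (a2 w * D)" by simp
  also have "\<dots> \<le> a1 q * (2 * a)"
    using a a_pos by (intro mult_left_mono) (auto simp: \<alpha>\<^sub>1_nonneg)
  finally have d: "a2 (q @ w) * D \<le> 2 * a * a1 q" by (simp add: mult_ac)
  define c where "c = 12 * (4 * D) powr s / D"
  have c: "0 < c" using diam by (simp add: c_def)
  have cov: "cheap_cover \<delta> s ?E (c * a * (a1 q * a2 (q @ w) powr (s - 1)))"
    using cylinder_cheap_cover[OF qw sub dist d \<delta>] by (simp add: c_def mult_ac)
  let ?T = "\<Sum>v\<in>B. \<psi> s v"
  have "?T * (\<psi> s (q @ w)) \<le> K * (\<Sum>b\<in>wB. \<psi> s (q @ b))"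
    unfolding sum_wB sum_distrib_left sum_distrib_right
    using \<psi>_append_ge[OF qw _ s1] B_lists by (intro sum_mono) (auto simp: mult_ac)
  then have T: "\<psi> s (q @ w) \<le> K * (\<Sum>b\<in>wB. \<psi> s (q @ b)) / ?T"
    using sum_B_pos by (simp add: field_simps)
  have "a1 q * a2 (q @ w) powr (s - 1) \<le> (K * a1 (q @ w) / a1 w) * a2 (q @ w) powr (s - 1)"
    using a1_append_ge[OF q w] a1_pos[OF w] by (intro mult_right_mono) (auto simp: field_simps)
  also have "\<dots> = K / a1 w * \<psi> s (q @ w)" by (simp add: \<psi>_def)
  also have "\<dots> \<le> K / a1 w * (K * (\<Sum>b\<in>wB. \<psi> s (q @ b)) / ?T)"
    using T K a1_pos[OF w] by (intro mult_left_mono) auto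
  finally have "c * a * (a1 q * a2 (q @ w) powr (s - 1))
      \<le> c * a * (K / a1 w * (K * (\<Sum>b\<in>wB. \<psi> s (q @ b)) / ?T))"
    using c a_pos by (intro mult_left_mono) auto
  also have "\<dots> = \<epsilon> * (\<Sum>b\<in>wB. \<psi> s (q @ b))"
    by (simp add: \<epsilon>_def c_def power2_eq_square)
  finally show ?thesis using cheap_cover_mono[OF cov] by blast
qed

lemma good_block_weight:
  assumes q: "q \<in> lists I"
  shows "(\<Sum>b\<in>words I L - wB. \<Phi> N (q @ b)) \<le> (1 - \<eta>) * \<Phi> (L + N) q"
proof -
  have "\<eta> * \<Phi> (L + N) q \<le> \<eta> * (K\<^sup>2 * \<psi> s q)"
  proof (intro mult_left_mono \<Phi>_le q)
    show "0 \<le> \<eta>"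
      unfolding \<eta>_def sum_wB using K
      by (intro divide_nonneg_nonneg sum_nonneg less_imp_le[OF \<psi>_pos] wB_lists) auto
  qed
  also have "\<dots> = (\<Sum>b\<in>wB. \<psi> s q * \<psi> s b) / K ^ 3"
    using K by (simp add: \<eta>_def sum_distrib_left power_numeral_reduce field_simps)
  also have "\<dots> \<le> (\<Sum>b\<in>wB. K * (K\<^sup>2 * \<Phi> N (q @ b))) / K ^ 3"
  proof (intro divide_right_mono sum_mono)
    fix b assume "b \<in> wB"
    then have b: "b \<in> lists I" using wB_words by (auto simp: words_def)
    have "\<psi> s q * \<psi> s b \<le> K * \<psi> s (q @ b)" by (rule \<psi>_append_ge[OF q b s1])
    also have "\<dots> \<le> K * (K\<^sup>2 * \<Phi> N (q @ b))"
      using K q b by (intro mult_left_mono \<Phi>_ge) auto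
    finally show "\<psi> s q * \<psi> s b \<le> K * (K\<^sup>2 * \<Phi> N (q @ b))" .
  qed (use K in simp)
  also have "\<dots> = (\<Sum>b\<in>wB. \<Phi> N (q @ b))"
    using K by (simp add: sum_distrib_left[symmetric] power_numeral_reduce)
  finally have "\<eta> * \<Phi> (L + N) q \<le> (\<Sum>b\<in>wB. \<Phi> N (q @ b))" .
  moreover have "\<Phi> (L + N) q = (\<Sum>b\<in>words I L - wB. \<Phi> N (q @ b)) + (\<Sum>b\<in>wB. \<Phi> N (q @ b))"
    unfolding \<Phi>_add by (rule sum.subset_diff[OF wB_words finite_words[OF fin]])
  ultimately show ?thesis by (simp add: algebra_simps)
qed

lemma \<eta>_bounds: "0 < \<eta>" "\<eta> \<le> 1"
proof -
  have "0 < (\<Sum>b\<in>wB. \<psi> s b)"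
    unfolding sum_wB using finite_B B(2) by (intro sum_pos \<psi>_pos wB_lists)
  then show "0 < \<eta>" using K by (simp add: \<eta>_def)
  have "(\<Sum>b\<in>wB. \<psi> s b) \<le> S s L"
    unfolding S_def using wB_words finite_words[OF fin]
    by (intro sum_mono2) (auto simp: words_def intro!: less_imp_le \<psi>_pos)
  also have "\<dots> \<le> K" by (rule S_le)
  also have "\<dots> \<le> K ^ 5" using K power_increasing[of 1 5 K] by simp
  finally show "\<eta> \<le> 1" using K by (simp add: \<eta>_def)
qed

text \<open>Each round splits a cylinder along the words of length \<open>L\<close>: bad ones are
  covered at the price \<epsilon>, the others are passed on. The cost is measured against
  \<open>\<Phi> (k * L) q\<close>, whose exact additivity prevents constants \<open>K\<close> from
  accumulating with every round.\<close>

lemma iterated_cover: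
  assumes \<delta>: "\<And>q. q \<in> lists I \<Longrightarrow> m \<le> length q \<Longrightarrow> 4 * (a2 q * D) \<le> \<delta>"
    and q: "q \<in> lists I" "m \<le> length q"
  shows "cheap_cover \<delta> s (f q ` X) ((\<epsilon> * K\<^sup>2 + 6 * (4 * D) powr s * (1 - \<eta>) ^ k) * \<Phi> (k * L) q)"
  using q
proof (induction k arbitrary: q)
  case 0
  \<comment> \<open>Cylinders left over at the end are covered over their full length.\<close>
  have "cheap_cover \<delta> s (f q ` X) (6 * (4 * D) powr s / D * (a1 q * D) * a2 q powr (s - 1))"
  proof (rule cylinder_cheap_cover)
    fix p p' assume "p \<in> f q ` X" "p' \<in> f q ` X"
    then obtain x x' where x: "x \<in> X" "x' \<in> X" "p = f q x" "p' = f q x'" by blast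
    have "a1 q * dist x x' \<le> a1 q * D"
      using x by (intro mult_left_mono dist_X \<alpha>\<^sub>1_nonneg)
    then show "dist p p' \<le> a1 q * D"
      using dist_f_le[of q x x'] x by simp
  next
    show "a2 q * D \<le> a1 q * D"
      using \<alpha>\<^sub>2_le_\<alpha>\<^sub>1 diam by (intro mult_right_mono) auto
  qed (use 0 \<delta> in auto)
  moreover have "6 * (4 * D) powr s / D * (a1 q * D) * a2 q powr (s - 1) = 6 * (4 * D) powr s * \<psi> s q"
    using diam by (simp add: \<psi>_def)
  moreover have "0 \<le> \<epsilon> * K\<^sup>2 * \<psi> s q"
    using \<epsilon>_pos \<psi>_pos[OF 0(1), of s] by simp
  ultimately show ?case
    by (elim cheap_cover_mono) (auto simp: algebra_simps)
next
  case (Suc k)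
  define c where "c = \<epsilon> * K\<^sup>2 + 6 * (4 * D) powr s * (1 - \<eta>) ^ k"
  have "4 * (a2 (q @ w) * D) \<le> \<delta>"
    using Suc.prems w by (intro \<delta>) auto
  then have 1: "cheap_cover \<delta> s (\<Union>b\<in>wB. f (q @ b) ` X) (\<epsilon> * (\<Sum>b\<in>wB. \<psi> s (q @ b)))"
    by (rule bad_block_cover[OF Suc.prems(1)])
  have 2: "cheap_cover \<delta> s (\<Union>b\<in>words I L - wB. f (q @ b) ` X)
      (\<Sum>b\<in>words I L - wB. c * \<Phi> (k * L) (q @ b))"
  proof (rule cheap_cover_UN)
    show "finite (words I L - wB)" using finite_words[OF fin] by simp
  next
    fix b assume "b \<in> words I L - wB"
    then show "cheap_cover \<delta> s (f (q @ b) ` X) (c * \<Phi> (k * L) (q @ b))"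
      unfolding c_def using Suc.prems by (intro Suc.IH) (auto simp: words_def)
  qed
  have "f q ` X = (\<Union>b\<in>wB. f (q @ b) ` X) \<union> (\<Union>b\<in>words I L - wB. f (q @ b) ` X)"
    using wB_words by (subst f_image_split[of q L]) auto
  then have cov: "cheap_cover \<delta> s (f q ` X)
      (\<epsilon> * (\<Sum>b\<in>wB. \<psi> s (q @ b)) + (\<Sum>b\<in>words I L - wB. c * \<Phi> (k * L) (q @ b)))"
    using cheap_cover_Un[OF 1 2] by simp
  have "(\<Sum>b\<in>wB. \<psi> s (q @ b)) \<le> (\<Sum>b\<in>wB. K\<^sup>2 * \<Phi> (k * L) (q @ b))"
    using wB_words Suc.prems by (intro sum_mono \<Phi>_ge) (auto simp: words_def)
  then have "\<epsilon> * (\<Sum>b\<in>wB. \<psi> s (q @ b)) \<le> \<epsilon> * K\<^sup>2 * (\<Sum>b\<in>wB. \<Phi> (k * L) (q @ b))"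
    using \<epsilon>_pos by (simp add: sum_distrib_left[symmetric])
  moreover have "(\<Sum>b\<in>words I L - wB. c * \<Phi> (k * L) (q @ b))
      = \<epsilon> * K\<^sup>2 * (\<Sum>b\<in>words I L - wB. \<Phi> (k * L) (q @ b))
        + 6 * (4 * D) powr s * (1 - \<eta>) ^ k * (\<Sum>b\<in>words I L - wB. \<Phi> (k * L) (q @ b))"
    unfolding c_def sum_distrib_left[symmetric] by (rule distrib_right)
  moreover have "6 * (4 * D) powr s * (1 - \<eta>) ^ k * (\<Sum>b\<in>words I L - wB. \<Phi> (k * L) (q @ b))
      \<le> 6 * (4 * D) powr s * (1 - \<eta>) ^ k * ((1 - \<eta>) * \<Phi> (L + k * L) q)"
    using \<eta>_bounds Suc.prems by (intro mult_left_mono good_block_weight) auto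
  moreover have "\<Phi> (L + k * L) q = (\<Sum>b\<in>words I L - wB. \<Phi> (k * L) (q @ b)) + (\<Sum>b\<in>wB. \<Phi> (k * L) (q @ b))"
    unfolding \<Phi>_add by (rule sum.subset_diff[OF wB_words finite_words[OF fin]])
  ultimately show ?case
    by (intro cheap_cover_mono[OF cov]) (auto simp: algebra_simps)
qed

text \<open>Starting from all words of length \<open>m\<close> makes every cylinder small enough for
  \<delta>. The good part vanishes as \<open>k\<close> grows, leaving
  \<open>\<epsilon> * K\<^sup>2\<close> times a total weight of at most \<open>K\<close>.\<close>

lemma content_upper_bound:
  assumes \<delta>: "\<And>q. q \<in> lists I \<Longrightarrow> m \<le> length q \<Longrightarrow> 4 * (a2 q * D) \<le> \<delta>"
    and h: "\<And>c. cheap_cover \<delta> s X c \<Longrightarrow> h \<le> c"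
  shows "h \<le> 12 * (4 * D) powr s / D * K\<^sup>2 * a / (a1 w * (\<Sum>v\<in>B. \<psi> s v)) * K ^ 3"
proof -
  have "h \<le> (\<epsilon> * K\<^sup>2 + 6 * (4 * D) powr s * (1 - \<eta>) ^ k) * K" for k
  proof -
    define c where "c = \<epsilon> * K\<^sup>2 + 6 * (4 * D) powr s * (1 - \<eta>) ^ k"
    have c: "0 \<le> c" unfolding c_def using \<epsilon>_pos \<eta>_bounds K by simp
    have "cheap_cover \<delta> s (\<Union>p\<in>words I m. f p ` X) (\<Sum>p\<in>words I m. c * \<Phi> (k * L) p)"
      unfolding c_def
      by (intro cheap_cover_UN finite_words fin iterated_cover \<delta>) (auto simp: words_def)
    then have "h \<le> (\<Sum>p\<in>words I m. c * \<Phi> (k * L) p)"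
      using X_eq_words[of m] h by simp
    also have "\<dots> = c * S s (m + k * L)"
      by (simp add: S_def \<Phi>_def sum_words_add sum_distrib_left)
    also have "\<dots> \<le> c * K" using c S_le by (intro mult_left_mono)
    finally show ?thesis by (simp add: c_def)
  qed
  moreover have "(\<lambda>k. (\<epsilon> * K\<^sup>2 + 6 * (4 * D) powr s * (1 - \<eta>) ^ k) * K)
      \<longlonglongrightarrow> (\<epsilon> * K\<^sup>2 + 6 * (4 * D) powr s * 0) * K"
    using \<eta>_bounds by (intro tendsto_intros LIMSEQ_power_zero) auto
  ultimately have "h \<le> (\<epsilon> * K\<^sup>2 + 6 * (4 * D) powr s * 0) * K"
    by (intro LIMSEQ_le_const) auto
  then have "h \<le> \<epsilon> * K ^ 3" by (simp add: power_numeral_reduce)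
  then show ?thesis by (simp only: \<epsilon>_def)
qed

end

section \<open>The density bound, for words of one length and for antichains\<close>

lemma small_cylinders:
  assumes "0 < \<delta>"
  obtains m where "\<And>q. q \<in> lists I \<Longrightarrow> m \<le> length q \<Longrightarrow> a2 q * D \<le> \<delta>"
proof -
  obtain m where m: "\<rho> ^ m < \<delta> / D"
    using real_arch_pow_inv[of "\<delta> / D" \<rho>] assms diam \<rho> by auto
  have "a2 q * D \<le> \<delta>" if "q \<in> lists I" "m \<le> length q" for q
  proof -
    have "a2 q \<le> \<rho> ^ length q" using a2_le_power that by simp
    also have "\<dots> \<le> \<rho> ^ m" using that \<rho> by (intro power_decreasing) auto
    finally have "a2 q \<le> \<delta> / D" using m by simp
    then show ?thesis using diam by (simp add: field_simps)
  qed
  then show thesis using that by blast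
qed

text \<open>At scales above its width a cylinder looks like a segment of length
  \<open>a1 w * D\<close>, so up to the factor \<open>D\<close> the quotient \<open>a / a1 w\<close>
  is the share of its length inside the ball. Hence the linear dependence on
  \<open>a\<close>.\<close>

definition density_bound :: "real \<Rightarrow> bool" where
  "density_bound M \<longleftrightarrow> 0 < M \<and> (\<forall>w\<in>lists I. \<forall>n B z a. B \<subseteq> words I n \<longrightarrow> a2 w * D \<le> a \<longrightarrow>
     (\<forall>v\<in>B. f (w @ v) ` X \<subseteq> cball z a) \<longrightarrow> (\<Sum>v\<in>B. \<psi> s v) \<le> M * a / a1 w)"

lemma density_boundD:
  assumes "density_bound M" "w \<in> lists I" "B \<subseteq> words I n" "a2 w * D \<le> a"
    and "\<And>v. v \<in> B \<Longrightarrow> f (w @ v) ` X \<subseteq> cball z a"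
  shows "(\<Sum>v\<in>B. \<psi> s v) \<le> M * a / a1 w"
  by (rule assms(1)[unfolded density_bound_def, THEN conjunct2, rule_format]) (use assms in auto)

lemma density_bound_exists:
  assumes "0 < h" "0 < \<delta>" and h: "\<And>c. cheap_cover \<delta> s X c \<Longrightarrow> h \<le> c"
  obtains M where "density_bound M"
proof -
  obtain m where m: "\<And>q. q \<in> lists I \<Longrightarrow> m \<le> length q \<Longrightarrow> a2 q * D \<le> \<delta> / 4"
    using small_cylinders[of "\<delta> / 4"] assms(2) by auto
  \<comment> \<open>\<open>K ^ 5\<close> collects \<open>K\<^sup>2\<close> from the price of bad
    blocks and \<open>K ^ 3\<close> from the exhaustion; a weight above \<open>M * a / a1 w\<close>
    would push the cost of covers of \<open>X\<close> below \<open>h\<close>.\<close>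
  define M where "M = 12 * (4 * D) powr s / D * K ^ 5 / h"
  have M: "0 < M" using diam K assms(1) by (simp add: M_def)
  have main: "(\<Sum>v\<in>B. \<psi> s v) \<le> M * a / a1 w"
    if w: "w \<in> lists I" and B: "B \<subseteq> words I n" and a: "a2 w * D \<le> a"
      and Ba: "\<forall>v\<in>B. f (w @ v) ` X \<subseteq> cball z a" for w n B z a
  proof (cases "B = {}")
    case True
    have "0 \<le> a" using a a2_pos[OF w] diam by (smt (verit) mult_pos_pos)
    then show ?thesis using True M a1_pos[OF w] by simp
  next
    case False
    have ctx: "w \<in> lists I" "B \<subseteq> words I n" "B \<noteq> {}" "a2 w * D \<le> a"
      "\<And>v. v \<in> B \<Longrightarrow> f (w @ v) ` X \<subseteq> cball z a"
      using w B False a Ba by auto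
    let ?T = "\<Sum>v\<in>B. \<psi> s v"
    have T: "0 < ?T" by (rule sum_B_pos[OF ctx])
    have "h \<le> 12 * (4 * D) powr s / D * K\<^sup>2 * a / (a1 w * ?T) * K ^ 3"
    proof (rule content_upper_bound[OF ctx])
      fix q assume "q \<in> lists I" "m \<le> length q"
      from m[OF this] show "4 * (a2 q * D) \<le> \<delta>" by simp
    qed (auto intro: h)
    then have "?T * h \<le> 12 * (4 * D) powr s / D * K\<^sup>2 * a / a1 w * K ^ 3"
      using T mult_left_mono[of h _ ?T] by fastforce
    then have "?T \<le> (12 * (4 * D) powr s / D * K\<^sup>2 * a / a1 w * K ^ 3) / h"
      using assms(1) by (simp only: pos_le_divide_eq)
    then show ?thesis
      by (simp add: M_def power_numeral_reduce mult_ac)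
  qed
  have "density_bound M"
    unfolding density_bound_def by (intro conjI ballI allI impI M) (rule main)
  then show thesis by (rule that)
qed

text \<open>Stopping words differ in length, while the density bound concerns a single length. Each
  word is prolonged in all ways to the maximal length; in an antichain the prolongations are
  distinct, and their weights recover that of the word up to \<open>K\<^sup>2\<close>.\<close>

lemma density_bound_antichain:
  assumes M: "density_bound M" and w: "w \<in> lists I" and V: "V \<subseteq> lists I" "finite V"
    and anti: "\<And>u e. u \<in> V \<Longrightarrow> u @ e \<in> V \<Longrightarrow> e = []"
    and a: "a2 w * D \<le> a" and Va: "\<And>v. v \<in> V \<Longrightarrow> f (w @ v) ` X \<subseteq> cball z a"
  shows "(\<Sum>v\<in>V. \<psi> s v) \<le> K\<^sup>2 * M * a / a1 w"
proof -
  define n where "n = Max (insert 0 (length ` V))"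
  have n: "length v \<le> n" if "v \<in> V" for v
    unfolding n_def using V that by (intro Max_ge) auto
  define Q where "Q = Sigma V (\<lambda>v. words I (n - length v))"
  define B where "B = (\<lambda>(v, e). v @ e) ` Q"
  have inj: "inj_on (\<lambda>(v, e). v @ e) Q"
  proof (rule inj_onI, clarify)
    fix v e v' e' assume *: "(v, e) \<in> Q" "(v', e') \<in> Q" "v @ e = v' @ e'"
    then have "v \<in> V" "v' \<in> V" by (auto simp: Q_def)
    moreover from *(3) obtain us where "v = v' @ us \<and> us @ e = e' \<or> v @ us = v' \<and> e = us @ e'"
      by (auto simp: append_eq_append_conv2)
    ultimately have "us = []" using anti by blast
    then show "v = v' \<and> e = e'"
      using \<open>v = v' @ us \<and> us @ e = e' \<or> v @ us = v' \<and> e = us @ e'\<close> by auto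
  qed
  have BW: "B \<subseteq> words I n"
  proof
    fix b assume "b \<in> B"
    then obtain v e where ve: "b = v @ e" "v \<in> V" "e \<in> words I (n - length v)"
      by (auto simp: B_def Q_def)
    then have "v \<in> words I (length v)" using V(1) by (auto simp: words_def)
    then show "b \<in> words I n" using words_append[OF _ ve(3), of v "length v"] ve n[OF ve(2)] by simp
  qed
  have "(\<Sum>v\<in>V. \<psi> s v) \<le> (\<Sum>v\<in>V. K\<^sup>2 * \<Phi> (n - length v) v)"
    using V(1) by (intro sum_mono \<Phi>_ge) blast
  also have "\<dots> = K\<^sup>2 * (\<Sum>v\<in>V. \<Sum>e\<in>words I (n - length v). \<psi> s (v @ e))"
    by (simp add: \<Phi>_def sum_distrib_left)
  also have "(\<Sum>v\<in>V. \<Sum>e\<in>words I (n - length v). \<psi> s (v @ e)) = (\<Sum>(v, e)\<in>Q. \<psi> s (v @ e))"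
    unfolding Q_def using V finite_words[OF fin] by (subst sum.Sigma) auto
  also have "\<dots> = (\<Sum>b\<in>B. \<psi> s b)"
    unfolding B_def by (subst sum.reindex[OF inj]) (simp add: case_prod_unfold o_def)
  also have "\<dots> \<le> M * a / a1 w"
  proof -
    have "f (w @ b) ` X \<subseteq> cball z a" if b: "b \<in> B" for b
    proof -
      obtain v e where ve: "b = v @ e" "v \<in> V" "e \<in> words I (n - length v)"
        using b by (auto simp: B_def Q_def)
      have "f ((w @ v) @ e) ` X \<subseteq> f (w @ v) ` X"
        by (intro f_image_append_subset words_in_lists[OF ve(3)])
      then show ?thesis using Va[OF ve(2)] ve(1) by simp
    qed
    then show ?thesis by (intro density_boundD[OF M w BW a])
  qed
  finally show ?thesis using K by (simp add: mult_left_mono mult.assoc)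
qed

end

section \<open>Counting balls inside a cylinder\<close>

definition ball_cover :: "real \<Rightarrow> 'a::metric_space set \<Rightarrow> real \<Rightarrow> bool" where
  "ball_cover r E N \<longleftrightarrow> (\<exists>P. finite P \<and> real (card P) \<le> N \<and> E \<subseteq> (\<Union>p\<in>P. cball p r))"

lemma ball_cover_mono: "ball_cover r E N \<Longrightarrow> F \<subseteq> E \<Longrightarrow> N \<le> N' \<Longrightarrow> ball_cover r F N'"
  unfolding ball_cover_def by (meson order_trans)

lemma ball_cover_UN:
  assumes "finite J" "\<And>j. j \<in> J \<Longrightarrow> ball_cover r (E j) (N j)"
  shows "ball_cover r (\<Union>j\<in>J. E j) (\<Sum>j\<in>J. N j)"
proof -
  have "\<forall>j\<in>J. \<exists>P. finite P \<and> real (card P) \<le> N j \<and> E j \<subseteq> (\<Union>p\<in>P. cball p r)"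
    using assms(2) by (simp add: ball_cover_def)
  then obtain P where P: "\<forall>j\<in>J. finite (P j) \<and> real (card (P j)) \<le> N j \<and> E j \<subseteq> (\<Union>p\<in>P j. cball p r)"
    by metis
  have "real (card (\<Union>j\<in>J. P j)) \<le> real (\<Sum>j\<in>J. card (P j))"
    by (intro of_nat_mono card_UN_le assms)
  also have "\<dots> \<le> (\<Sum>j\<in>J. N j)"
    unfolding of_nat_sum using P by (intro sum_mono) blast
  finally show ?thesis
    unfolding ball_cover_def
  proof (intro exI[of _ "\<Union>j\<in>J. P j"] conjI)
    show "finite (\<Union>j\<in>J. P j)" using P assms(1) by blast
    show "(\<Union>j\<in>J. E j) \<subseteq> (\<Union>p\<in>(\<Union>j\<in>J. P j). cball p r)" using P by blast
  qed
qed

section \<open>Stopping words and ball covers inside one cylinder\<close>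

context planar_ifs
begin

lemma a2_snoc_ge: "i \<in> I \<Longrightarrow> l * a2 u \<le> a2 (u @ [i])"
  using a2_append_ge[of u "[i]"] mult_right_mono[OF l(3)[of i] \<alpha>\<^sub>2_nonneg[of "mat_word A u"]]
  by (simp add: mult.commute)

text \<open>Demanding the strict inequality of every proper prefix makes the set an antichain at
  once. Unlike in \<open>stopping_words\<close>, the empty word is allowed, for the case that
  \<open>w\<close> itself is already thin.\<close>

definition stop :: "'i list \<Rightarrow> real \<Rightarrow> 'i list set" where
  "stop w r = {v \<in> lists I. a2 (w @ v) * D \<le> r \<and> (\<forall>u e. v = u @ e \<longrightarrow> e \<noteq> [] \<longrightarrow> r < a2 (w @ u) * D)}"

lemma stop_cover:
  assumes w: "w \<in> lists I" and r: "0 < r"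
  shows "f w ` X \<subseteq> (\<Union>v\<in>stop w r. f (w @ v) ` X)"
proof
  fix x assume x: "x \<in> f w ` X"
  obtain m where m: "\<And>q. q \<in> lists I \<Longrightarrow> m \<le> length q \<Longrightarrow> a2 q * D \<le> r"
    using small_cylinders[OF r] by blast
  obtain v0 where v0: "v0 \<in> lists I" "length v0 = m" "x \<in> f (w @ v0) ` X"
    using x f_image_split[of w m] by (auto simp: words_def)
  define k where "k = (LEAST k. a2 (w @ take k v0) * D \<le> r)"
  have k: "a2 (w @ take k v0) * D \<le> r"
    unfolding k_def by (rule LeastI[of _ m]) (use m[of "w @ v0"] v0 w in simp)
  have k_min: "r < a2 (w @ take j v0) * D" if "j < k" for j
    using not_less_Least[OF that[unfolded k_def]] by simp
  have lists: "take k v0 \<in> lists I" "drop k v0 \<in> lists I"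
    using v0(1) by (auto dest: in_set_takeD in_set_dropD)
  have "take k v0 \<in> stop w r"
    unfolding stop_def
  proof (intro CollectI conjI allI impI lists k)
    fix u e assume ue: "take k v0 = u @ e" "e \<noteq> []"
    then have "length u < k" by (metis append_eq_conv_conj length_append length_greater_0_conv
          length_take less_add_same_cancel1 min.cobounded2 min.strict_boundedE order_less_le_trans)
    moreover from ue have "take (length u) v0 = u"
      by (metis \<open>length u < k\<close> append_eq_conv_conj min.absorb1 less_imp_le take_take)
    ultimately show "r < a2 (w @ u) * D" using k_min by metis
  qed
  moreover have "f ((w @ take k v0) @ drop k v0) ` X \<subseteq> f (w @ take k v0) ` X"
    by (rule f_image_append_subset[OF lists(2)])
  then have "x \<in> f (w @ take k v0) ` X" using v0(3) by auto
  ultimately show "x \<in> (\<Union>v\<in>stop w r. f (w @ v) ` X)" by blast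
qed

lemma finite_stop:
  assumes w: "w \<in> lists I" and r: "0 < r"
  shows "finite (stop w r)"
proof -
  obtain m where m: "\<And>q. q \<in> lists I \<Longrightarrow> m \<le> length q \<Longrightarrow> a2 q * D \<le> r"
    using small_cylinders[OF r] by blast
  have "stop w r \<subseteq> (\<Union>k\<in>{..m}. words I k)"
  proof
    fix v assume v: "v \<in> stop w r"
    then have vI: "v \<in> lists I" by (simp add: stop_def)
    have "length v \<le> m"
    proof (rule ccontr)
      assume "\<not> length v \<le> m"
      then have "v = take m v @ drop m v" "drop m v \<noteq> []" by auto
      then have "r < a2 (w @ take m v) * D"
        using v unfolding stop_def by blast
      moreover have "take m v \<in> lists I" using vI by (auto dest: in_set_takeD)
      then have "a2 (w @ take m v) * D \<le> r"
        using \<open>\<not> length v \<le> m\<close> w by (intro m) auto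
      ultimately show False by simp
    qed
    then show "v \<in> (\<Union>k\<in>{..m}. words I k)" using vI by (simp add: words_def)
  qed
  then show ?thesis by (rule finite_subset) (intro finite_UN_I finite_atMost finite_words fin)
qed

lemma stop_width:
  assumes v: "v \<in> stop w r" and lr: "l * r \<le> a2 w * D"
  shows "l * r \<le> a2 (w @ v) * D"
proof (cases v rule: rev_cases)
  case Nil
  then show ?thesis using lr by simp
next
  case (snoc u i)
  then have "r < a2 (w @ u) * D" "i \<in> I" using v by (auto simp: stop_def)
  then have "l * r \<le> l * a2 (w @ u) * D" using l by simp
  also have "\<dots> \<le> a2 ((w @ u) @ [i]) * D"
    using diam by (intro mult_right_mono a2_snoc_ge \<open>i \<in> I\<close>) auto
  finally show ?thesis using snoc by simp
qed

lemma stop_antichain: "u \<in> stop w r \<Longrightarrow> u @ e \<in> stop w r \<Longrightarrow> e = []"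
  unfolding stop_def by fastforce

text \<open>Each \<open>\<psi> s v\<close> is at least of order
  \<open>a / (a1 w * D) * (r / R) powr (s - 1)\<close>, and all pieces lie in a ball of radius
  \<open>R + a\<close>, so the density bound limits their number. Each piece needs of order
  \<open>min R a / r\<close> balls. In the product the length \<open>a\<close> cancels because
  \<open>(R + a) * min R a \<le> 2 * R * a\<close>, so every length class has the same
  bound.\<close>

lemma pieces_cover:
  assumes M: "density_bound M" and w: "w \<in> lists I" and r: "0 < r" "r \<le> R"
    and wR: "a2 w * D \<le> R" "l * R \<le> a2 w * D"
    and V: "V \<subseteq> stop w r" "\<And>v. v \<in> V \<Longrightarrow> f (w @ v) ` X \<inter> cball z R \<noteq> {}"
      "\<And>v. v \<in> V \<Longrightarrow> a / 2 < a1 (w @ v) * D" "\<And>v. v \<in> V \<Longrightarrow> a1 (w @ v) * D \<le> a" and a: "0 < a"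
  shows "ball_cover (2 * r) (\<Union>v\<in>V. f (w @ v) ` X \<inter> cball z R)
    (48 * K\<^sup>2 * M * D / l * (K / l) powr (s - 1) * (R / r) powr s)"
proof -
  have R: "0 < R" using r by simp
  have Mpos: "0 < M" using M by (simp add: density_bound_def)
  have fV: "finite V" using V(1) finite_stop[OF w r(1)] finite_subset by blast
  have VI: "v \<in> lists I" if "v \<in> V" for v using V(1) that by (auto simp: stop_def)
  \<comment> \<open>The diameter bound \<open>d\<close> of a piece inside the ball is at most
    \<open>2 * min R a\<close> and at least \<open>l * r\<close>; the lower bound absorbs the
    additive 1 of the cover count at the price of \<open>1 / l\<close>.\<close>
  define Q where "Q = 12 / l * (min R a / r)"
  have one: "ball_cover (2 * r) (f (w @ v) ` X \<inter> cball z R) Q" if v: "v \<in> V" for v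
  proof -
    define d where "d = min (2 * R) (a1 (w @ v) * D)"
    have vs: "v \<in> stop w r" using V(1) v by blast
    have wv: "w @ v \<in> lists I" using w VI[OF v] by simp
    have small: "a2 (w @ v) * D \<le> r" using vs by (simp add: stop_def)
    have "l * r \<le> l * R" using r l by simp
    then have lr: "l * r \<le> a2 w * D" using wR by simp
    have "a2 (w @ v) * D \<le> a1 (w @ v) * D"
      using \<alpha>\<^sub>2_le_\<alpha>\<^sub>1 diam by (intro mult_right_mono) auto
    then have "l * r \<le> a1 (w @ v) * D" using stop_width[OF vs lr] by simp
    moreover have "l * r \<le> 2 * R" using l r mult_right_mono[of l 1 r] by linarith
    ultimately have ld: "l * r \<le> d" by (simp add: d_def)
    then have d0: "0 \<le> d" using l r by (smt (verit) mult_pos_pos)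
    obtain P where P: "finite P" "real (card P) \<le> 3 * (d / r + 1)"
      "f (w @ v) ` X \<inter> cball z R \<subseteq> (\<Union>p\<in>P. cball p (2 * r))"
    proof (rule cylinder_cover[OF wv, of "f (w @ v) ` X \<inter> cball z R" d r])
      fix p q assume pq: "p \<in> f (w @ v) ` X \<inter> cball z R" "q \<in> f (w @ v) ` X \<inter> cball z R"
      then obtain x y where xy: "x \<in> X" "y \<in> X" "p = f (w @ v) x" "q = f (w @ v) y" by blast
      have "a1 (w @ v) * dist x y \<le> a1 (w @ v) * D"
        using xy by (intro mult_left_mono dist_X \<alpha>\<^sub>1_nonneg)
      then have "dist p q \<le> a1 (w @ v) * D" using dist_f_le[of "w @ v" x y] xy by simp
      moreover have "dist p q \<le> dist z p + dist z q" by (metis dist_commute dist_triangle2)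
      ultimately show "dist p q \<le> d" using pq by (simp add: d_def)
    qed (use d0 r small in auto)
    have dl: "l \<le> d / r" using ld r by (simp add: pos_le_divide_eq)
    have "3 * (d / r + 1) \<le> 6 / l * (d / r)"
    proof -
      have "1 \<le> (d / r) / l" using dl l by (subst pos_le_divide_eq) auto
      moreover have "d / r \<le> (d / r) / l"
        using l dl mult_left_mono[of l 1 "d / r"] by (subst pos_le_divide_eq) auto
      moreover have "3 * (x + 1) \<le> 6 * y" if "1 \<le> y" "x \<le> y" for x y :: real
        using that by (simp add: distrib_left)
      ultimately have "3 * (d / r + 1) \<le> 6 * ((d / r) / l)" by blast
      then show ?thesis by (simp add: mult.commute)
    qed
    also have "\<dots> \<le> 6 / l * (2 * min R a / r)"
    proof -
      have "d \<le> 2 * min R a" using V(4)[OF v] a by (simp add: d_def min_def)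
      then show ?thesis using l r by (intro mult_left_mono divide_right_mono) auto
    qed
    also have "\<dots> = Q" by (simp add: Q_def)
    finally show ?thesis unfolding ball_cover_def using P by (intro exI[of _ P]) auto
  qed
  \<comment> \<open>A lower bound for \<open>a2 v powr (s - 1)\<close>: the width of
    \<open>w @ v\<close> is at least \<open>l * r\<close>, that of \<open>w\<close> at most
    \<open>R\<close>, and separating them loses \<open>K\<close>.\<close>
  define \<kappa> where "\<kappa> = (l * r / (K * R)) powr (s - 1)"
  have \<kappa>: "0 < \<kappa>" unfolding \<kappa>_def using l r R K by simp
  have weight: "a / (2 * (a1 w * D)) * \<kappa> \<le> \<psi> s v" if v: "v \<in> V" for v
  proof -
    have vs: "v \<in> stop w r" using V(1) v by blast
    have "a / 2 < a1 w * a1 v * D"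
      using V(3)[OF v] a1_append_le[of w v] mult_right_mono[of "a1 (w @ v)" "a1 w * a1 v" D] diam by linarith
    then have 1: "a / (2 * (a1 w * D)) \<le> a1 v"
      using a1_pos[OF w] diam by (simp add: field_simps)
    have "l * r \<le> l * R" using r l by simp
    then have "l * r \<le> a2 (w @ v) * D" using wR by (intro stop_width vs) simp
    also have "\<dots> \<le> K * (a2 w * a2 v) * D"
      using a2_append_le[OF w VI[OF v]] diam by (intro mult_right_mono) auto
    also have "\<dots> = K * a2 v * (a2 w * D)" by simp
    also have "\<dots> \<le> K * a2 v * R"
      using wR K \<alpha>\<^sub>2_nonneg by (intro mult_left_mono) auto
    finally have "l * r / (K * R) \<le> a2 v"
      using K R by (simp add: pos_divide_le_eq mult_ac)
    then have "\<kappa> \<le> a2 v powr (s - 1)"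
      unfolding \<kappa>_def using s l r R K by (intro powr_mono2) auto
    then show ?thesis
      unfolding \<psi>_def using 1 \<kappa> a a1_pos[OF w] diam \<alpha>\<^sub>1_nonneg by (intro mult_mono) auto
  qed
  have "real (card V) * (a / (2 * (a1 w * D)) * \<kappa>) \<le> (\<Sum>v\<in>V. \<psi> s v)"
    using weight sum_bounded_below[of V "a / (2 * (a1 w * D)) * \<kappa>" "\<psi> s"] by simp
  also have "\<dots> \<le> K\<^sup>2 * M * (R + a) / a1 w"
  proof (rule density_bound_antichain[OF M w _ fV, where z = z])
    show "V \<subseteq> lists I" using VI by blast
    show "e = []" if "u \<in> V" "u @ e \<in> V" for u e
      using stop_antichain V(1) that by blast
    show "a2 w * D \<le> R + a" using wR a by simp
  next
    fix v assume v: "v \<in> V"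
    obtain y where y: "y \<in> X" "dist z (f (w @ v) y) \<le> R" using V(2)[OF v] by auto
    show "f (w @ v) ` X \<subseteq> cball z (R + a)"
    proof clarify
      fix x assume x: "x \<in> X"
      have "dist (f (w @ v) y) (f (w @ v) x) \<le> a1 (w @ v) * dist y x" by (rule dist_f_le)
      also have "\<dots> \<le> a1 (w @ v) * D" using x y by (intro mult_left_mono dist_X \<alpha>\<^sub>1_nonneg)
      also have "\<dots> \<le> a" by (rule V(4)[OF v])
      finally show "f (w @ v) x \<in> cball z (R + a)"
        using y dist_triangle[of z "f (w @ v) x" "f (w @ v) y"] by simp
    qed
  qed
  finally have "real (card V) * a * \<kappa> \<le> 2 * K\<^sup>2 * M * D * (R + a)"
    using a1_pos[OF w] diam by (simp add: field_simps)
  then have "(real (card V) * a * \<kappa>) * min R a \<le> (2 * K\<^sup>2 * M * D * (R + a)) * min R a"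
    using R a by (intro mult_right_mono) auto
  also have "\<dots> \<le> 2 * K\<^sup>2 * M * D * (2 * R * a)"
  proof -
    have "(R + a) * min R a \<le> 2 * R * a"
    proof (cases "R \<le> a")
      case True
      then have "R * R \<le> a * R" using R by (intro mult_right_mono) auto
      then show ?thesis using True by (simp add: min_def algebra_simps)
    next
      case False
      then have "a * a \<le> R * a" using a by (intro mult_right_mono) auto
      then show ?thesis using False by (simp add: min_def algebra_simps)
    qed
    then show ?thesis using K Mpos diam mult_left_mono[of _ _ "2 * K\<^sup>2 * M * D"] by (simp add: mult.assoc)
  qed
  finally have "(real (card V) * min R a * \<kappa>) * a \<le> (4 * K\<^sup>2 * M * D * R) * a"
    by (simp add: mult_ac)
  then have cnt: "real (card V) * min R a \<le> 4 * K\<^sup>2 * M * D * R / \<kappa>"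
    using a \<kappa> by (simp add: pos_le_divide_eq)
  have "real (card V) * Q = 12 / (l * r) * (real (card V) * min R a)"
    by (simp add: Q_def)
  also have "\<dots> \<le> 12 / (l * r) * (4 * K\<^sup>2 * M * D * R / \<kappa>)"
    using cnt l r by (intro mult_left_mono) auto
  also have "1 / \<kappa> = (K / l) powr (s - 1) * (R / r) powr (s - 1)"
  proof -
    have "1 / \<kappa> = (1 / (l * r / (K * R))) powr (s - 1)"
      unfolding \<kappa>_def using l r R K by (simp add: powr_divide)
    also have "1 / (l * r / (K * R)) = (K / l) * (R / r)"
      by simp
    finally have "1 / \<kappa> = (K / l * (R / r)) powr (s - 1)" .
    also have "\<dots> = (K / l) powr (s - 1) * (R / r) powr (s - 1)"
      by (intro powr_mult)
    finally show ?thesis .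
  qed
  then have "12 / (l * r) * (4 * K\<^sup>2 * M * D * R / \<kappa>)
      = 48 * K\<^sup>2 * M * D / l * (K / l) powr (s - 1) * ((R / r) * (R / r) powr (s - 1))"
  proof -
    assume *: "1 / \<kappa> = (K / l) powr (s - 1) * (R / r) powr (s - 1)"
    have "12 / (l * r) * (4 * K\<^sup>2 * M * D * R / \<kappa>) = 48 * K\<^sup>2 * M * D / l * (R / r) * (1 / \<kappa>)"
      by simp
    then show ?thesis unfolding * by (simp add: mult_ac)
  qed
  also have "(R / r) * (R / r) powr (s - 1) = (R / r) powr s"
    using r R powr_mult_base[of "R / r" "s - 1"] by (simp del: times_divide_eq_left)
  finally have tot: "real (card V) * Q \<le> 48 * K\<^sup>2 * M * D / l * (K / l) powr (s - 1) * (R / r) powr s" .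
  have "ball_cover (2 * r) (\<Union>v\<in>V. f (w @ v) ` X \<inter> cball z R) (\<Sum>v\<in>V. Q)"
    by (intro ball_cover_UN fV one)
  then show ?thesis by (rule ball_cover_mono) (use tot in auto)
qed

lemma cylinder_ball_cover:
  assumes M: "density_bound M"
  obtains C where "0 < C" "\<And>w r R z. w \<in> lists I \<Longrightarrow> 0 < r \<Longrightarrow> r \<le> R \<Longrightarrow> a2 w * D \<le> R \<Longrightarrow>
    l * R \<le> a2 w * D \<Longrightarrow>
    ball_cover (2 * r) (f w ` X \<inter> cball z R) (C * ((R / r) powr s * (1 + ln (R / r))))"
proof -
  define Cg where "Cg = 48 * K\<^sup>2 * M * D / l * (K / l) powr (s - 1)"
  define Cj where "Cj = 1 + (ln (K\<^sup>2 / l) + 1) / ln 2"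
  have Mpos: "0 < M" using M by (simp add: density_bound_def)
  have Cg: "0 < Cg" using Mpos K l diam by (simp add: Cg_def)
  have Kl: "1 \<le> K\<^sup>2 / l" using K l by (simp add: pos_le_divide_eq) (smt (verit) one_le_power)
  have Cj: "1 \<le> Cj" using Kl by (simp add: Cj_def)
  have main: "ball_cover (2 * r) (f w ` X \<inter> cball z R) (Cg * Cj * ((R / r) powr s * (1 + ln (R / r))))"
    if w: "w \<in> lists I" and r: "0 < r" "r \<le> R" and wR: "a2 w * D \<le> R" "l * R \<le> a2 w * D" for w r R z
  proof -
    have R: "0 < R" using r by simp
    have lr: "l * r \<le> a2 w * D"
      using r l wR(2) mult_left_mono[of r R l] by linarith
    define V where "V = {v \<in> stop w r. f (w @ v) ` X \<inter> cball z R \<noteq> {}}"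
    define \<Lambda> where "\<Lambda> = a1 w * D"
    have \<Lambda>: "0 < \<Lambda>" using a1_pos[OF w] diam by (simp add: \<Lambda>_def)
    \<comment> \<open>Bounds the length of the cylinder of \<open>w\<close> over the length of a
      piece: as a piece is not thinner than \<open>l * r\<close>, \<open>a1 v \<ge> a2 v\<close> is
      at least \<open>l * r / (K * R)\<close>, and joining \<open>v\<close> to \<open>w\<close>
      loses another \<open>K\<close>.\<close>
    define q where "q = K\<^sup>2 / l * (R / r)"
    have Rr: "1 \<le> R / r" using r by simp
    have q: "1 \<le> q" unfolding q_def using mult_mono[OF Kl Rr] Kl by simp
    define J where "J = nat \<lfloor>log 2 q\<rfloor> + 1"
    have "0 \<le> log 2 q" using q by simp
    then have J: "log 2 q < real J" "real J \<le> log 2 q + 1"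
      unfolding J_def by linarith+
    have qJ: "q < 2 ^ J"
    proof -
      have "q = 2 powr (log 2 q)" using q by simp
      also have "\<dots> < 2 powr real J" using J by (intro powr_less_mono) auto
      finally show ?thesis by (simp add: powr_realpow)
    qed
    have JC: "real J \<le> Cj * (1 + ln (R / r))"
    proof -
      have "ln q = ln (K\<^sup>2 / l) + ln (R / r)"
        unfolding q_def using Kl Rr by (intro ln_mult_pos) auto
      then have "real J \<le> 1 + (ln (K\<^sup>2 / l) + ln (R / r)) / ln 2"
        using J(2) by (simp add: log_def)
      also have "\<dots> \<le> 1 + (ln (K\<^sup>2 / l) + 1) / ln 2 * (1 + ln (R / r))"
      proof -
        have "ln (K\<^sup>2 / l) + ln (R / r) \<le> (ln (K\<^sup>2 / l) + 1) * (1 + ln (R / r))"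
          using Kl Rr by (simp add: algebra_simps)
        then show ?thesis by (simp add: divide_right_mono)
      qed
      also have "\<dots> \<le> 1 * (1 + ln (R / r)) + (ln (K\<^sup>2 / l) + 1) / ln 2 * (1 + ln (R / r))"
        using Rr by simp
      also have "\<dots> = Cj * (1 + ln (R / r))" by (simp only: Cj_def distrib_right)
      finally show ?thesis .
    qed
    define G where "G j = {v \<in> V. \<Lambda> / 2 ^ j / 2 < a1 (w @ v) * D \<and> a1 (w @ v) * D \<le> \<Lambda> / 2 ^ j}" for j
    have VG: "V \<subseteq> (\<Union>j\<in>{..<J}. G j)"
    proof
      fix v assume v: "v \<in> V"
      then have vI: "v \<in> lists I" and vs: "v \<in> stop w r" by (auto simp: V_def stop_def)
      define b where "b = a1 (w @ v) * D"
      have up: "b \<le> \<Lambda>"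
      proof -
        have "a1 (w @ v) \<le> a1 w * 1"
          using a1_append_le[of w v] mult_left_mono[OF a1_le_1[OF vI] \<alpha>\<^sub>1_nonneg[of "mat_word A w"]]
          by linarith
        then show ?thesis using diam by (simp add: b_def \<Lambda>_def)
      qed
      have "l * r \<le> a2 (w @ v) * D" by (rule stop_width[OF vs lr])
      also have "\<dots> \<le> K * (a2 w * a2 v) * D"
        using a2_append_le[OF w vI] diam by (intro mult_right_mono) auto
      also have "\<dots> = K * a2 v * (a2 w * D)" by simp
      also have "\<dots> \<le> K * a1 v * R"
        using wR K \<alpha>\<^sub>2_nonneg \<alpha>\<^sub>1_nonneg \<alpha>\<^sub>2_le_\<alpha>\<^sub>1 diam by (intro mult_mono) auto
      finally have "(l * r) * \<Lambda> \<le> (K * a1 v * R) * \<Lambda>"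
        using \<Lambda> by (intro mult_right_mono) auto
      also have "\<dots> = K * R * D * (a1 w * a1 v)" by (simp add: \<Lambda>_def)
      also have "\<dots> \<le> K * R * D * (K * a1 (w @ v))"
        using K R diam by (intro mult_left_mono a1_append_ge w vI) auto
      also have "\<dots> = K\<^sup>2 * R * b" by (simp add: b_def power2_eq_square)
      finally have "\<Lambda> \<le> q * b"
        using l r by (simp add: q_def pos_le_divide_eq mult_ac)
      moreover have b: "0 < b" using a1_pos[of "w @ v"] w vI diam by (simp add: b_def)
      ultimately have "\<Lambda> < 2 ^ J * b" using qJ mult_strict_right_mono[OF qJ b] by linarith
      then have low: "\<Lambda> / 2 ^ J < b" by (simp add: field_simps)
      \<comment> \<open>This least index is positive because \<open>b\<close> is at most
        \<open>\<Lambda>\<close>; its predecessor is the dyadic class of \<open>v\<close>, so the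
        classes below \<open>J\<close> suffice.\<close>
      define j where "j = (LEAST j. \<Lambda> / 2 ^ j < b)"
      have jb: "\<Lambda> / 2 ^ j < b" unfolding j_def by (rule LeastI[of _ J]) (rule low)
      have jJ: "j \<le> J" unfolding j_def by (rule Least_le) (rule low)
      have "j \<noteq> 0" using jb up by (intro notI) simp
      then obtain i where i: "j = Suc i" by (cases j) auto
      have "\<not> \<Lambda> / 2 ^ i < b" using not_less_Least[of i "\<lambda>j. \<Lambda> / 2 ^ j < b"] i by (simp add: j_def)
      then have "v \<in> G i" using v jb i by (simp add: G_def b_def mult.commute)
      then show "v \<in> (\<Union>j\<in>{..<J}. G j)" using jJ i by auto
    qed
    have G: "ball_cover (2 * r) (\<Union>v\<in>G j. f (w @ v) ` X \<inter> cball z R) (Cg * (R / r) powr s)" for j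
      unfolding Cg_def
      by (rule pieces_cover[OF M w r wR, where a = "\<Lambda> / 2 ^ j"]) (use \<Lambda> in \<open>auto simp: G_def V_def\<close>)
    have "f w ` X \<inter> cball z R \<subseteq> (\<Union>v\<in>V. f (w @ v) ` X \<inter> cball z R)"
    proof
      fix x assume x: "x \<in> f w ` X \<inter> cball z R"
      then obtain v where "v \<in> stop w r" "x \<in> f (w @ v) ` X"
        using stop_cover[OF w r(1)] by blast
      then show "x \<in> (\<Union>v\<in>V. f (w @ v) ` X \<inter> cball z R)"
        using x unfolding V_def by blast
    qed
    also have "\<dots> \<subseteq> (\<Union>j\<in>{..<J}. \<Union>v\<in>G j. f (w @ v) ` X \<inter> cball z R)"
      using VG by blast
    finally have sub: "f w ` X \<inter> cball z R \<subseteq> (\<Union>j\<in>{..<J}. \<Union>v\<in>G j. f (w @ v) ` X \<inter> cball z R)" .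
    have "ball_cover (2 * r) (\<Union>j\<in>{..<J}. \<Union>v\<in>G j. f (w @ v) ` X \<inter> cball z R)
        (\<Sum>j\<in>{..<J}. Cg * (R / r) powr s)"
      by (intro ball_cover_UN G) simp
    then show ?thesis
    proof (rule ball_cover_mono[OF _ sub])
      have "(\<Sum>j\<in>{..<J}. Cg * (R / r) powr s) = real J * (Cg * (R / r) powr s)" by simp
      also have "\<dots> \<le> Cj * (1 + ln (R / r)) * (Cg * (R / r) powr s)"
        using JC Cg by (intro mult_right_mono) auto
      also have "\<dots> = Cg * Cj * ((R / r) powr s * (1 + ln (R / r)))" by (simp only: mult_ac)
      finally show "(\<Sum>j\<in>{..<J}. Cg * (R / r) powr s) \<le> Cg * Cj * ((R / r) powr s * (1 + ln (R / r)))" .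
    qed
  qed
  show thesis
    by (rule that[of "Cg * Cj"]) (use Cg Cj main in auto)
qed

end

section \<open>Assouad and Hausdorff dimension\<close>

text \<open>One outer scale is enough: the compact set lies in a ball of fixed radius, and for an
  admissible exponent \<sigma> below \<open>s\<close> its covers by balls of radius \<open>r\<close>
  would cost at most \<open>c * r powr (s - \<sigma>)\<close>, which tends to 0.\<close>

lemma assouad_dim_ge_of_hausdorff_measure:
  fixes X :: "(real^2) set"
  assumes X: "compact X" "X \<noteq> {}" and s: "0 < s" and pos: "0 < hausdorff_measure s X"
  shows "ereal s \<le> assouad_dim X"
  unfolding assouad_dim_def
proof (rule Inf_greatest, clarify)
  fix \<sigma> C :: real
  assume \<sigma>: "0 \<le> \<sigma>" and C: "0 < C"
    and cov: "\<forall>r R x. 0 < r \<longrightarrow> r < R \<longrightarrow> x \<in> X \<longrightarrow> (\<exists>P. finite P \<and> real (card P) \<le> C * (R / r) powr \<sigma> \<and>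
      X \<inter> cball x R \<subseteq> (\<Union>p\<in>P. cball p r))"
  show "ereal s \<le> ereal \<sigma>"
  proof (rule ccontr)
    assume "\<not> ereal s \<le> ereal \<sigma>"
    then have less: "\<sigma> < s" by simp
    obtain x0 where x0: "x0 \<in> X" using X by blast
    obtain R0 where R0: "0 < R0" "X \<subseteq> cball x0 R0"
      using bounded_subset_ballD[OF compact_imp_bounded[OF X(1)]] ball_subset_cball by (meson order_trans)
    define c where "c = C * R0 powr \<sigma> * 2 powr s"
    have c: "0 < c" using C R0 by (simp add: c_def)
    have "hausdorff_content s \<delta> X = 0" if \<delta>: "0 < \<delta>" for \<delta>
    proof -
      have le: "hausdorff_content s \<delta> X \<le> 0 + ennreal e" if e: "0 < e" for e
      proof -
        \<comment> \<open>The last term makes the cost at most \<open>e\<close>; half of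
          \<open>R0\<close> keeps \<open>r < R0\<close> strict, and half of \<delta> bounds the
          diameter of the balls.\<close>
        define r where "r = min (min (R0 / 2) (\<delta> / 2)) ((e / c) powr (1 / (s - \<sigma>)))"
        have r: "0 < r" "r < R0" "2 * r \<le> \<delta>" "r \<le> (e / c) powr (1 / (s - \<sigma>))"
          using R0 \<delta> e c by (auto simp: r_def)
        obtain P where P: "finite P" "real (card P) \<le> C * (R0 / r) powr \<sigma>" "X \<inter> cball x0 R0 \<subseteq> (\<Union>p\<in>P. cball p r)"
          using cov[rule_format, OF r(1,2) x0] by (elim exE conjE)
        have "X \<subseteq> (\<Union>p\<in>P. cball p r)" using P(3) R0(2) by blast
        then have "cheap_cover \<delta> s X (C * (R0 / r) powr \<sigma> * (2 * r) powr s)"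
          using P r by (intro cheap_cover_cballs[of P]) auto
        then have "hausdorff_content s \<delta> X \<le> ennreal (C * (R0 / r) powr \<sigma> * (2 * r) powr s)"
          using \<delta> s by (intro cheap_cover_hausdorff_content) auto
        also have "C * (R0 / r) powr \<sigma> * (2 * r) powr s = c * r powr (s - \<sigma>)"
          using r R0 by (simp add: c_def powr_divide powr_mult powr_diff)
        also have "\<dots> \<le> c * ((e / c) powr (1 / (s - \<sigma>))) powr (s - \<sigma>)"
          using r c less by (intro mult_left_mono powr_mono2) auto
        also have "\<dots> = e"
          using less e c by (simp add: powr_powr)
        finally show ?thesis by (simp add: ennreal_leI)
      qed
      have "hausdorff_content s \<delta> X \<le> 0"
        by (rule ennreal_le_epsilon) (rule le)
      then show ?thesis by simp
    qed
    then have "hausdorff_measure s X \<le> 0"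
      unfolding hausdorff_measure_def by (intro SUP_least) simp
    then show False using pos by simp
  qed
qed

text \<open>The content may be infinite, so a positive real number below it is chosen as the lower
  bound for finite covers.\<close>

lemma hausdorff_content_pos_exists:
  assumes "0 < hausdorff_measure s X" "0 < s"
  obtains h \<delta> where "0 < h" "0 < \<delta>" "\<And>c. cheap_cover \<delta> s X c \<Longrightarrow> h \<le> c"
proof -
  obtain \<delta> where \<delta>: "0 < \<delta>" "0 < hausdorff_content s \<delta> X"
    using assms(1) unfolding hausdorff_measure_def less_SUP_iff by auto
  obtain y where y: "0 < y" "y < hausdorff_content s \<delta> X" using dense[OF \<delta>(2)] by blast
  then obtain h where h: "y = ennreal h" "0 \<le> h"
    by (cases y) (auto simp: top_unique)
  then have "0 < h" using y by (cases "h = 0") auto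
  have "h \<le> c" if "cheap_cover \<delta> s X c" for c
  proof (rule ccontr)
    assume "\<not> h \<le> c"
    then have "ennreal c \<le> ennreal h" by (intro ennreal_leI) simp
    moreover have "hausdorff_content s \<delta> X \<le> ennreal c"
      using \<delta> assms(2) that by (intro cheap_cover_hausdorff_content) auto
    ultimately show False using y h by (meson leD order_trans)
  qed
  then show thesis using that \<open>0 < h\<close> \<delta>(1) by blast
qed

text \<open>The neighbourhood condition counts images of \<open>U\<close>, not of the attractor.
  Images of a point of \<open>U\<close> stay in \<open>U\<close> and, by contraction, come
  arbitrarily close to every point of \<open>X\<close>; this lets counts for \<open>U\<close>
  control \<open>X\<close>.\<close>

lemma (in planar_ifs) attractor_subset_closure:
  assumes U: "U \<noteq> {}" "\<And>i. i \<in> I \<Longrightarrow> aff A t i ` U \<subseteq> U"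
  shows "X \<subseteq> closure U"
proof
  fix x assume x: "x \<in> X"
  obtain u where u: "u \<in> U" using U by blast
  have fU: "f w u \<in> U" if "w \<in> lists I" for w
    using that
  proof (induction w)
    case (Cons i w)
    then show ?case using U(2)[of i] by (auto simp: f_Cons)
  qed (simp add: f_Nil u)
  obtain B where B: "0 < B" "X \<subseteq> cball u B"
    using bounded_subset_ballD[OF compact_imp_bounded[OF compact_X]] ball_subset_cball
    by (meson order_trans)
  show "x \<in> closure U"
    unfolding closure_approachable
  proof (intro allI impI)
    fix e :: real assume e: "0 < e"
    obtain n where n: "\<rho> ^ n < e / B"
      using real_arch_pow_inv[of "e / B" \<rho>] e B \<rho> by auto
    obtain w y where w: "w \<in> words I n" and y: "y \<in> X" "x = f w y"
      using x X_eq_words[of n] by blast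
    have wI: "w \<in> lists I" by (rule words_in_lists[OF w])
    have "dist (f w u) x \<le> a1 w * dist u y" using dist_f_le y by simp
    also have "\<dots> \<le> \<rho> ^ n * B"
      using a1_le_power[OF wI] w B y \<rho> by (intro mult_mono) (auto simp: words_def)
    also have "\<dots> < e" using n B by (simp add: pos_less_divide_eq)
    finally show "\<exists>y\<in>U. dist y x < e" using fU[OF wI] by blast
  qed
qed

text \<open>For \<open>r \<ge> D\<close> one ball suffices, and for \<open>D \<le> 2 * R\<close> the
  whole attractor serves as the cylinder. Only for \<open>2 * R < D\<close> does the neighbourhood
  condition apply at radius \<open>2 * R\<close>, its stopping words being non-empty.\<close>

lemma (in planar_ifs) attractor_ball_cover:
  assumes M: "density_bound M" and obnc: "OBNC I A t X"
  obtains C where "0 < C" "\<And>x r R. x \<in> X \<Longrightarrow> 0 < r \<Longrightarrow> r < R \<Longrightarrow>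
    ball_cover r (X \<inter> cball x R) (C * ((R / r) powr s * (1 + ln (R / r))))"
proof -
  obtain U C0 where "U \<noteq> {}" and U': "\<forall>i\<in>I. aff A t i ` U \<subseteq> U" and C0: "0 < C0"
    and count: "\<forall>r>0. \<forall>x. finite {w \<in> stopping_words I A X r. f w ` U \<inter> cball x r \<noteq> {}} \<and>
      real (card {w \<in> stopping_words I A X r. f w ` U \<inter> cball x r \<noteq> {}}) \<le> C0"
    using obnc unfolding OBNC_def by (elim exE conjE)
  note U = \<open>U \<noteq> {}\<close> bspec[OF U']
  obtain C where C: "0 < C" "\<And>w r R z. w \<in> lists I \<Longrightarrow> 0 < r \<Longrightarrow> r \<le> R \<Longrightarrow> a2 w * D \<le> R \<Longrightarrow>
    l * R \<le> a2 w * D \<Longrightarrow>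
    ball_cover (2 * r) (f w ` X \<inter> cball z R) (C * ((R / r) powr s * (1 + ln (R / r))))"
    using cylinder_ball_cover[OF M] by blast
  define g where "g q = q powr s * (1 + ln q)" for q :: real
  have g_mono: "g p \<le> g q" if "1 \<le> p" "p \<le> q" for p q
    unfolding g_def using that s by (intro mult_mono powr_mono2) auto
  have g1: "1 \<le> g q" if "1 \<le> q" for q
    using g_mono[of 1 q] that by (simp add: g_def)
  \<comment> \<open>Working with \<open>2 * R\<close> and \<open>r / 2\<close> multiplies the
    quotient of radii by 4; this constant absorbs the change.\<close>
  define E where "E = 4 powr s * (1 + ln 4)"
  have E: "0 < E" unfolding E_def by (intro mult_pos_pos) (auto simp: add_pos_nonneg)
  have g4: "g (4 * q) \<le> E * g q" if "1 \<le> q" for q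
  proof -
    have "1 + ln (4 * q) \<le> (1 + ln 4) * (1 + ln q)"
      using that by (simp add: ln_mult_pos algebra_simps)
    then have "(4 * q) powr s * (1 + ln (4 * q)) \<le> (4 * q) powr s * ((1 + ln 4) * (1 + ln q))"
      by (intro mult_left_mono) auto
    then show ?thesis using that by (simp add: g_def E_def powr_mult mult_ac)
  qed
  define C' where "C' = 1 + C * E + C0 * C * E"
  have C': "0 < C'" "1 \<le> C'" "C * E \<le> C'" "C0 * (C * E) \<le> C'"
    using C(1) E C0 by (simp_all add: C'_def add_pos_pos)
  have main: "ball_cover r (X \<inter> cball x R) (C' * g (R / r))"
    if x: "x \<in> X" and r: "0 < r" "r < R" for x r R
  proof -
    have Rr: "1 \<le> R / r" using r by simp
    note gR = g1[OF Rr]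
    consider "D \<le> r" | "r < D" "D \<le> 2 * R" | "2 * R < D" by linarith
    then show ?thesis
    proof cases
      case 1
      have "1 \<le> C' * g (R / r)" using mult_mono[OF C'(2) gR] C' by simp
      moreover have "X \<subseteq> cball x r" using dist_X[OF x] 1 by force
      ultimately show ?thesis
        unfolding ball_cover_def by (intro exI[of _ "{x}"]) auto
    next
      case 2
      \<comment> \<open>The empty word has width exactly \<open>D\<close>, so it is admissible at
        radius \<open>D\<close>; and \<open>D \<le> 2 * R\<close> bounds the new quotient by
        \<open>4 * (R / r)\<close>.\<close>
      have "ball_cover (2 * (r / 2)) (f [] ` X \<inter> cball x D) (C * ((D / (r / 2)) powr s * (1 + ln (D / (r / 2)))))"
        using r 2 diam l by (intro C(2)) auto
      then have "ball_cover r (X \<inter> cball x D) (C * g (D / (r / 2)))"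
        by (simp add: g_def f_Nil)
      then show ?thesis
      proof (rule ball_cover_mono)
        show "X \<inter> cball x R \<subseteq> X \<inter> cball x D" using dist_X[OF x] by force
        have "g (D / (r / 2)) \<le> g (4 * (R / r))"
          using 2 r by (intro g_mono) (auto simp: field_simps)
        also have "\<dots> \<le> E * g (R / r)" by (rule g4[OF Rr])
        finally have "C * g (D / (r / 2)) \<le> C * (E * g (R / r))"
          using C(1) by (intro mult_left_mono) auto
        also have "\<dots> = (C * E) * g (R / r)" by simp
        also have "\<dots> \<le> C' * g (R / r)" using C' gR by (intro mult_right_mono) auto
        finally show "C * g (D / (r / 2)) \<le> C' * g (R / r)" .
      qed
    next
      case 3
      \<comment> \<open>The radius is doubled because the point of \<open>U\<close> that represents
        a point of the attractor is only known to be within \<open>R\<close> of it.\<close>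
      define W where "W = {w \<in> stopping_words I A X (2 * R). f w ` U \<inter> cball x (2 * R) \<noteq> {}}"
      have W: "finite W" "real (card W) \<le> C0"
        unfolding W_def using count[rule_format, of "2 * R" x] r by simp_all
      have sub: "X \<inter> cball x R \<subseteq> (\<Union>w\<in>W. f w ` X \<inter> cball x (2 * R))"
      proof
        fix p assume p: "p \<in> X \<inter> cball x R"
        then have "p \<in> (\<Union>v\<in>stop [] (2 * R). f ([] @ v) ` X)"
          using stop_cover[of "[]" "2 * R"] r by (simp add: f_Nil) blast
        then obtain w y where w: "w \<in> stop [] (2 * R)" and y: "y \<in> X" "p = f w y" by auto
        have wI: "w \<in> lists I" and wle: "a2 w * D \<le> 2 * R" using w by (auto simp: stop_def)
        \<comment> \<open>\<open>stop\<close> admits the empty word while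
          \<open>stopping_words\<close> does not; \<open>2 * R < D\<close> excludes it.\<close>
        have "w \<noteq> []" using wle 3 by auto
        then have "w = butlast w @ [last w]" by simp
        then have "2 * R < a2 (butlast w) * D"
          using w unfolding stop_def by (metis (mono_tags, lifting) append_Nil mem_Collect_eq not_Cons_self2)
        then have ws: "w \<in> stopping_words I A X (2 * R)"
          using wI wle \<open>w \<noteq> []\<close> by (simp add: stopping_words_def)
        have "y \<in> closure U" using attractor_subset_closure[OF U] y by blast
        then obtain u where u: "u \<in> U" "dist u y < R"
          using r unfolding closure_approachable by (meson less_trans)
        have "dist (f w u) p \<le> a1 w * dist u y" using dist_f_le y by simp
        also have "\<dots> \<le> 1 * dist u y" by (intro mult_right_mono a1_le_1 wI) simp
        finally have "dist (f w u) p \<le> R" using u by simp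
        then have "dist x (f w u) \<le> 2 * R"
          using p dist_triangle[of x "f w u" p] by (simp add: dist_commute)
        then have "f w u \<in> f w ` U \<inter> cball x (2 * R)" using u by simp
        then have "w \<in> W" using ws unfolding W_def by blast
        moreover have "p \<in> f w ` X \<inter> cball x (2 * R)" using p y r by auto
        ultimately show "p \<in> (\<Union>w\<in>W. f w ` X \<inter> cball x (2 * R))" by blast
      qed
      have one: "ball_cover r (f w ` X \<inter> cball x (2 * R)) (C * E * g (R / r))" if w: "w \<in> W" for w
      proof -
        have ws: "w \<in> lists I" "w \<noteq> []" "a2 w * D \<le> 2 * R" "2 * R < a2 (butlast w) * D"
          using w by (auto simp: W_def stopping_words_def)
        have "last w \<in> I" using ws by (auto simp: in_lists_conv_set)
        have "l * (2 * R) \<le> l * (a2 (butlast w) * D)" using ws(4) l by (intro mult_left_mono) auto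
        also have "\<dots> = (l * a2 (butlast w)) * D" by simp
        also have "\<dots> \<le> a2 (butlast w @ [last w]) * D"
          using diam by (intro mult_right_mono a2_snoc_ge \<open>last w \<in> I\<close>) auto
        finally have low: "l * (2 * R) \<le> a2 w * D" using ws(2) by simp
        have "ball_cover (2 * (r / 2)) (f w ` X \<inter> cball x (2 * R))
            (C * ((2 * R / (r / 2)) powr s * (1 + ln (2 * R / (r / 2)))))"
          using r low ws by (intro C(2)) auto
        then have "ball_cover r (f w ` X \<inter> cball x (2 * R)) (C * g (4 * (R / r)))"
          by (simp add: g_def)
        then show ?thesis
          by (rule ball_cover_mono) (use mult_left_mono[OF g4[OF Rr], of C] C(1) in \<open>auto simp: mult.assoc\<close>)
      qed
      have "ball_cover r (\<Union>w\<in>W. f w ` X \<inter> cball x (2 * R)) (\<Sum>w\<in>W. C * E * g (R / r))"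
        by (intro ball_cover_UN W one)
      then show ?thesis
      proof (rule ball_cover_mono[OF _ sub])
        have "(\<Sum>w\<in>W. C * E * g (R / r)) = real (card W) * (C * E * g (R / r))" by simp
        also have "\<dots> \<le> C0 * (C * E * g (R / r))"
          using W C(1) E gR by (intro mult_right_mono) auto
        also have "\<dots> = C0 * (C * E) * g (R / r)" by simp
        also have "\<dots> \<le> C' * g (R / r)" using C' gR by (intro mult_right_mono) auto
        finally show "(\<Sum>w\<in>W. C * E * g (R / r)) \<le> C' * g (R / r)" .
      qed
    qed
  qed
  show thesis
    by (rule that[of C']) (use C' main in \<open>auto simp: g_def\<close>)
qed

text \<open>The logarithm is absorbed by \<open>q powr e\<close> at the price of the factor
  \<open>1 + 1 / e\<close>. Its growth as \<open>e\<close> tends to 0 is harmless, as the dimension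
  is an infimum over exponents.\<close>

lemma assouad_dim_le_of_ball_cover:
  fixes X :: "'a::metric_space set"
  assumes C: "0 < C" and s: "0 \<le> s"
    and cov: "\<And>x r R. x \<in> X \<Longrightarrow> 0 < r \<Longrightarrow> r < R \<Longrightarrow>
      ball_cover r (X \<inter> cball x R) (C * ((R / r) powr s * (1 + ln (R / r))))"
  shows "assouad_dim X \<le> ereal s"
proof (rule ereal_le_epsilon2)
  fix e :: real assume e: "0 < e"
  have "assouad_dim X \<le> ereal (s + e)"
    unfolding assouad_dim_def
  proof (rule Inf_lower, rule CollectI, rule exI[of _ "s + e"], intro conjI refl)
    show "0 \<le> s + e" using s e by simp
    show "\<exists>C>0. \<forall>r R x. 0 < r \<longrightarrow> r < R \<longrightarrow> x \<in> X \<longrightarrow>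
         (\<exists>P. finite P \<and> real (card P) \<le> C * (R / r) powr (s + e) \<and> X \<inter> cball x R \<subseteq> (\<Union>p\<in>P. cball p r))"
    proof (rule exI[of _ "C * (1 + 1 / e)"], intro conjI allI impI)
      show "0 < C * (1 + 1 / e)" using C e by (simp add: add_pos_pos)
    next
      fix r R :: real and x assume r: "0 < r" "r < R" and x: "x \<in> X"
      define q where "q = R / r"
      have q: "1 \<le> q" using r by (simp add: q_def)
      have "1 + ln q \<le> q powr e + q powr e / e"
        using ln_powr_bound[OF q e] q e by (intro add_mono) (auto simp: ge_one_powr_ge_zero)
      also have "\<dots> = (1 + 1 / e) * q powr e" by (simp add: distrib_right)
      finally have "C * (q powr s * (1 + ln q)) \<le> C * (q powr s * ((1 + 1 / e) * q powr e))"
        using C by (intro mult_left_mono) auto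
      also have "\<dots> = C * (1 + 1 / e) * q powr (s + e)" by (simp add: powr_add mult_ac)
      finally have "ball_cover r (X \<inter> cball x R) (C * (1 + 1 / e) * q powr (s + e))"
        using ball_cover_mono[OF cov[OF x r]] by (simp add: q_def)
      then show "\<exists>P. finite P \<and> real (card P) \<le> C * (1 + 1 / e) * (R / r) powr (s + e) \<and>
          X \<inter> cball x R \<subseteq> (\<Union>p\<in>P. cball p r)"
        by (simp add: ball_cover_def q_def)
    qed
  qed
  then show "assouad_dim X \<le> ereal s + ereal e" by simp
qed

theorem corollary1p1:
  fixes I :: "'i set" and A :: "'i \<Rightarrow> real^2^2" and t :: "'i \<Rightarrow> real^2" and X :: "(real^2) set"
  assumes "affine_IFS I A t"
    and "1 < affinity_dim I A" and "affinity_dim I A \<le> 2"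
    and "dominated I A"
    and "is_attractor I A t X"
    and "OBNC I A t X"
    and "hausdorff_measure (affinity_dim I A) X > 0"
  shows "assouad_dim X = ereal (affinity_dim I A)"
proof (rule antisym)
  define s where "s = affinity_dim I A"
  have X: "compact X" "X \<noteq> {}" using assms(5) by (auto simp: is_attractor_def)
  show "ereal (affinity_dim I A) \<le> assouad_dim X"
    using assms(2,7) by (intro assouad_dim_ge_of_hausdorff_measure X) auto
  have fin: "finite I" and det: "\<And>i. i \<in> I \<Longrightarrow> det (A i) \<noteq> 0"
    and lt1: "\<And>i. i \<in> I \<Longrightarrow> \<alpha>\<^sub>1 (A i) < 1"
    using assms(1) by (auto simp: affine_IFS_def \<alpha>\<^sub>1_eq_onorm)
  obtain K where K: "1 \<le> K" "almost_mult I A K"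
    using dominated_almost_mult[where A = A, OF fin det less_imp_le[OF lt1] assms(4)] by blast
  obtain l where l: "0 < l" "l \<le> 1" "\<And>i. i \<in> I \<Longrightarrow> l \<le> \<alpha>\<^sub>2 (A i)"
    using finite_\<alpha>\<^sub>2_lower_bound[where A = A, OF fin det] by blast
  \<comment> \<open>The inserted \<open>1 / 2\<close> keeps \<rho> positive for every index
    set.\<close>
  define \<rho> where "\<rho> = Max (insert (1 / 2) ((\<lambda>i. \<alpha>\<^sub>1 (A i)) ` I))"
  have "1 / 2 \<le> \<rho>" unfolding \<rho>_def using fin by (intro Max_ge) auto
  then have \<rho>: "0 < \<rho>" by simp
  have \<rho>1: "\<rho> < 1" unfolding \<rho>_def using fin lt1 by (subst Max_less_iff) auto
  have \<rho>A: "\<alpha>\<^sub>1 (A i) \<le> \<rho>" if "i \<in> I" for i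
    unfolding \<rho>_def using fin that by (intro Max_ge) auto
  interpret almost_mult_system I A K l \<rho>
    by unfold_locales (use fin K l \<rho> \<rho>1 \<rho>A in auto)
  obtain h \<delta> where h: "0 < h" "0 < \<delta>" "\<And>c. cheap_cover \<delta> s X c \<Longrightarrow> h \<le> c"
    using hausdorff_content_pos_exists[of s X] assms(2,7) by (auto simp: s_def)
  \<comment> \<open>A set of zero diameter covers itself at cost \<open>0 powr s = 0\<close>,
    against the positive bound \<open>h\<close>.\<close>
  have diam: "0 < diameter X"
  proof (rule ccontr)
    assume "\<not> 0 < diameter X"
    then have "diameter X = 0"
      using diameter_ge_0[OF compact_imp_bounded[OF X(1)]] by simp
    then have "cheap_cover \<delta> s X 0"
      unfolding cheap_cover_def using h(2) compact_imp_bounded[OF X(1)] by (intro exI[of _ "[X]"]) simp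
    then show False using h by fastforce
  qed
  interpret planar_ifs I A K l \<rho> t X s
    by unfold_locales (use assms diam S_critical_ge S_critical_le in \<open>auto simp: s_def\<close>)
  obtain M where M: "density_bound M"
    using density_bound_exists[OF h] by blast
  obtain C where "0 < C" "\<And>x r R. x \<in> X \<Longrightarrow> 0 < r \<Longrightarrow> r < R \<Longrightarrow>
    ball_cover r (X \<inter> cball x R) (C * ((R / r) powr s * (1 + ln (R / r))))"
    using attractor_ball_cover[OF M assms(6)] by blast
  then show "assouad_dim X \<le> ereal (affinity_dim I A)"
    unfolding s_def[symmetric] using assms(2) by (intro assouad_dim_le_of_ball_cover) (auto simp: s_def)
qed

end
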